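(* Let $(M,\mathscr{L})$ be a pseudo-Finsler space modeled on a pseudo-Minkowski space $(V,L)$, with local vierbein $e^a_\mu(x)$ and commutation coefficients $c^a{}_{bc}(x)$. Then the Ricci scalar $\mathrm{Ric}(y)=R^\mu_{\mu\alpha}y^\alpha$ is given by \begin{align*} \mathrm{Ric}(y)=\;&2\frac{\partial G^\mu}{\partial x^\mu}-y^\mu\frac{\partial^2G^\nu}{\partial x^\mu\partial y^\nu}+2G^\mu\frac{\partial^2G^\nu}{\partial y^\mu\partial y^\nu}-\frac{\partial G^\mu}{\partial y^\nu}\frac{\partial G^\nu}{\partial y^\mu}\\ =\;&g^{ad}y^by_c\,c^c{}_{ab,d}+y^ay^b\,c^c{}_{bc,a}+I^by^ay^cy_d\,c^d{}_{bc,a}\\ &+c^i{}_{jk}\,c^l{}_{pn}\,g_{ia}g_{lb}\Big(\tfrac14g^{jp}g^{kn}y^ay^b+g^{bn}g^{kp}y^ay^j-\tfrac12g^{an}g^{bk}y^jy^p-\tfrac12g^{ab}g^{kn}y^jy^p\\ &\quad+2y^ay^jy^pC^{bkn}-y^ay^jy^by^pC^{kq}_rC^{nr}_q+I^jg^{kn}y^ay^by^p-g^{bk}I^ny^ay^jy^p\\ &\quad-g^{en}y^ay^jy^by^p\frac{\partial}{\partial y^e}I^k\Big). \end{align*}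
   Context: Einstein's summation convention is used. A pseudo-Minkowski space is a pair $(V,L)$ where $V$ is an $m$-dimensional real vector space and $L\colon\bar\omega\to\mathbb{R}$ is defined on the closure of an open cone $\omega\subset V$ with vertex the origin, with $L\in C^4(\omega)\cap C^0(\bar\omega)$, $L(sy)=s^2L(y)$ for $s>0$, and non-degenerate Hessian on $\omega$. A pseudo-Finsler space is a pair $(M,\mathscr{L})$, $\dim M=m$, $\mathscr{L}\colon\bar\Omega\to\mathbb{R}$, $\Omega\subset TM$ projecting onto $M$, such that each $(T_xM,\mathscr{L}_x)$, with $\mathscr{L}_x$ the restriction of $\mathscr{L}$ to the fibre (cone $\Omega_x=\Omega\cap T_xM$), is a pseudo-Minkowski space with signature independent of $x$. It is modeled on $(V,L)$ if locally, for $x\in U\subset M$, there are linear isomorphisms $\varphi_x\colon T_xM\to V$, sufficiently differentiable in $x$ ($C^2$ suffices), with $\varphi_x(\Omega_x)=\omega$ and $L(\varphi_x(y))=\mathscr{L}_x(y)$. Fix a basis $\{\tilde e_a\}$ of $V$ and put $e_a=\varphi_x^{-1}(\tilde e_a)=e^\mu_a\partial_\mu$, with dual basis $e^a=e^a_\mu dx^\mu$ (the vierbein), in local coordinates $x^\mu$ of $M$. A tangent vector is $y=y^\mu\partial_\mu=y^ae_a$, $y^\mu=y^ae^\mu_a$; regarding $L$ as a function of $(y^a)$, $\mathscr{L}(x^\mu,y^\nu)=L(e^a_\nu(x)y^\nu)$. The commutation coefficients are defined by $[e_a,e_b]=c^c{}_{ab}e_c$, and $c^c{}_{ab,d}:=e^\mu_d\,\partial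 c^c{}_{ab}/\partial x^\mu$. With $\partial_a=\partial/\partial y^a$: $y_a=\partial_aL$, $g_{ab}=\partial_a\partial_bL$, $g^{ab}$ the inverse of $g_{ab}$, $C_{abc}=\frac12\partial_a\partial_b\partial_cL$, $I_a=g^{bc}C_{abc}$; indices of $C$ and $I$ are raised with $g^{ab}$. In the variables $(x^\mu,y^\nu)$, with $g_{\mu\nu}=\partial^2\mathscr{L}/\partial y^\mu\partial y^\nu$ and inverse $g^{\mu\nu}$, the spray is $G^\mu:=\frac12g^{\mu\sigma}\big(\frac{\partial^2\mathscr{L}}{\partial x^\rho\partial y^\sigma}y^\rho-\frac{\partial\mathscr{L}}{\partial x^\sigma}\big)$, the non-linear connection is $N^\mu_\alpha:=\partial G^\mu/\partial y^\alpha$, and its curvature is $R^\mu_{\alpha\beta}:=\frac{\delta N^\mu_\beta}{\delta x^\alpha}-\frac{\delta N^\mu_\alpha}{\delta x^\beta}$, where $\frac{\delta}{\delta x^\alpha}:=\frac{\partial}{\partial x^\alpha}-N^\mu_\alpha\frac{\partial}{\partial y^\mu}$. *)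

theory Defs
  imports "HOL-Analysis.Analysis"
begin

text \<open>Only meant for open \<open>S\<close>; derivatives are taken in the ambient space.\<close>

primrec Ck_on ::
  "nat \<Rightarrow> ('a::real_normed_vector \<Rightarrow> 'b::real_normed_vector) \<Rightarrow> 'a set \<Rightarrow> bool" where
  "Ck_on 0 f S \<longleftrightarrow> continuous_on S f"
| "Ck_on (Suc k) f S \<longleftrightarrow>
     (\<forall>x\<in>S. f differentiable (at x)) \<and>
     (\<forall>v. Ck_on k (\<lambda>x. frechet_derivative f (at x) v) S)"

text \<open>The inner product carried by the class \<open>euclidean_space\<close> plays no role;
  the class provides the topology of a finite-dimensional real vector space.\<close>

definition hess :: "('v::euclidean_space \<Rightarrow> real) \<Rightarrow> 'v \<Rightarrow> 'v \<Rightarrow> 'v \<Rightarrow> real" where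
  "hess L y u v = frechet_derivative (\<lambda>z. frechet_derivative L (at z) u) (at y) v"

text \<open>Number of positive and of negative squares of a symmetric bilinear form.\<close>

definition signature :: "('v::euclidean_space \<Rightarrow> 'v \<Rightarrow> real) \<Rightarrow> nat \<times> nat" where
  "signature B =
     (Max {dim S |S. subspace S \<and> (\<forall>v\<in>S. v \<noteq> 0 \<longrightarrow> B v v > 0)},
      Max {dim S |S. subspace S \<and> (\<forall>v\<in>S. v \<noteq> 0 \<longrightarrow> B v v < 0)})"

definition open_cone :: "'v::euclidean_space set \<Rightarrow> bool" where
  "open_cone \<omega> \<longleftrightarrow> open \<omega> \<and> (\<forall>y\<in>\<omega>. \<forall>s>0. s *\<^sub>R y \<in> \<omega>)"

definition pseudo_minkowski :: "'v::euclidean_space set \<Rightarrow> ('v \<Rightarrow> real) \<Rightarrow> bool" where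
  "pseudo_minkowski \<omega> L \<longleftrightarrow>
     open_cone \<omega> \<and> Ck_on 4 L \<omega> \<and> continuous_on (closure \<omega>) L \<and>
     (\<forall>y\<in>closure \<omega>. \<forall>s>0. L (s *\<^sub>R y) = s\<^sup>2 * L y) \<and>
     (\<forall>y\<in>\<omega>. \<forall>u. u \<noteq> 0 \<longrightarrow> (\<exists>v. hess L y u v \<noteq> 0))"

text \<open>A set of signatures because the cone is not required to be connected; if it is
  connected (and nonempty) this is a singleton.\<close>

definition minkowski_signature :: "'v::euclidean_space set \<Rightarrow> ('v \<Rightarrow> real) \<Rightarrow> (nat \<times> nat) set" where
  "minkowski_signature \<omega> L = (\<lambda>y. signature (hess L y)) ` \<omega>"

text \<open>The manifold is the (Hausdorff, second countable) space of all points of type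
  \<open>'p\<close>, with a smooth atlas of charts (domain, coordinate map) into \<open>real^'m\<close>.\<close>

type_synonym ('p, 'm) chart = "'p set \<times> ('p \<Rightarrow> real^'m)"

definition chart_inv :: "('p, 'm::finite) chart \<Rightarrow> real^'m \<Rightarrow> 'p" where
  "chart_inv \<kappa> = inv_into (fst \<kappa>) (snd \<kappa>)"

definition is_chart :: "('p::topological_space, 'm::finite) chart \<Rightarrow> bool" where
  "is_chart \<kappa> \<longleftrightarrow> open (fst \<kappa>) \<and> open (snd \<kappa> ` fst \<kappa>) \<and>
     homeomorphism (fst \<kappa>) (snd \<kappa> ` fst \<kappa>) (snd \<kappa>) (chart_inv \<kappa>)"

definition transition ::
  "('p, 'm::finite) chart \<Rightarrow> ('p, 'm) chart \<Rightarrow> real^'m \<Rightarrow> real^'m" where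
  "transition \<kappa> \<kappa>' = snd \<kappa>' \<circ> chart_inv \<kappa>"

definition smooth_atlas ::
  "('p::{t2_space, second_countable_topology}, 'm::finite) chart set \<Rightarrow> bool" where
  "smooth_atlas A \<longleftrightarrow>
     (\<forall>\<kappa>\<in>A. is_chart \<kappa>) \<and> (\<Union>\<kappa>\<in>A. fst \<kappa>) = UNIV \<and>
     (\<forall>\<kappa>\<in>A. \<forall>\<kappa>'\<in>A. \<forall>k. Ck_on k (transition \<kappa> \<kappa>') (snd \<kappa> ` (fst \<kappa> \<inter> fst \<kappa>')))"

text \<open>A tangent vector at \<open>p\<close> is the family of its components in all the charts
  of the atlas around \<open>p\<close>, related by the differentials of the transition maps.  It is
  normalised to be 0 at all other arguments, so that equality of tangent vectors is
  equality of functions.\<close>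

type_synonym ('p, 'm) tangent = "('p, 'm) chart \<Rightarrow> real^'m"

definition tangent_space ::
  "('p, 'm::finite) chart set \<Rightarrow> 'p \<Rightarrow> ('p, 'm) tangent set" where
  "tangent_space A p =
     {v. (\<forall>\<kappa>\<in>A. \<forall>\<kappa>'\<in>A. p \<in> fst \<kappa> \<longrightarrow> p \<in> fst \<kappa>' \<longrightarrow>
            v \<kappa>' = frechet_derivative (transition \<kappa> \<kappa>') (at (snd \<kappa> p)) (v \<kappa>)) \<and>
         (\<forall>\<kappa>. \<not> (\<kappa> \<in> A \<and> p \<in> fst \<kappa>) \<longrightarrow> v \<kappa> = 0)}"

definition tangent_bundle ::
  "('p, 'm::finite) chart set \<Rightarrow> ('p \<times> ('p, 'm) tangent) set" where
  "tangent_bundle A = Sigma UNIV (tangent_space A)"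

text \<open>The tangent vector \<open>w\<^sup>\<mu> \<partial>\<^sub>\<mu>\<close> at \<open>p\<close>, where \<open>\<partial>\<^sub>\<mu>\<close> is the coordinate frame of
  the chart \<open>\<kappa>\<close>.\<close>

definition tvec ::
  "('p, 'm::finite) chart set \<Rightarrow> ('p, 'm) chart \<Rightarrow> 'p \<Rightarrow> real^'m \<Rightarrow> ('p, 'm) tangent" where
  "tvec A \<kappa> p w = (\<lambda>\<kappa>'. if \<kappa>' \<in> A \<and> p \<in> fst \<kappa>'
     then frechet_derivative (transition \<kappa> \<kappa>') (at (snd \<kappa> p)) w else 0)"

text \<open>The tangent spaces are vector spaces under the pointwise operations.\<close>

definition tangent_iso :: "('p, 'm::finite) tangent set \<Rightarrow> (('p, 'm) tangent \<Rightarrow> 'v::real_vector) \<Rightarrow> bool" where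
  "tangent_iso T f \<longleftrightarrow> bij_betw f T UNIV \<and>
     (\<forall>u\<in>T. \<forall>v\<in>T. f (\<lambda>\<kappa>. u \<kappa> + v \<kappa>) = f u + f v) \<and>
     (\<forall>r. \<forall>u\<in>T. f (\<lambda>\<kappa>. r *\<^sub>R u \<kappa>) = r *\<^sub>R f u)"

text \<open>The fibre cone \<open>\<Omega>\<^sub>p\<close> and the fibre restriction of \<open>\<L>\<close>, read in the linear
  coordinates that a chart induces on the tangent space at \<open>p\<close>.\<close>

definition fibre_cone ::
  "('p, 'm::finite) chart set \<Rightarrow> ('p \<times> ('p, 'm) tangent) set \<Rightarrow> ('p, 'm) chart \<Rightarrow> 'p
     \<Rightarrow> (real^'m) set" where
  "fibre_cone A \<Omega> \<kappa> p = {w. (p, tvec A \<kappa> p w) \<in> \<Omega>}"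

definition fibre_fun ::
  "('p, 'm::finite) chart set \<Rightarrow> ('p \<times> ('p, 'm) tangent \<Rightarrow> real) \<Rightarrow> ('p, 'm) chart \<Rightarrow> 'p
     \<Rightarrow> real^'m \<Rightarrow> real" where
  "fibre_fun A \<L> \<kappa> p w = \<L> (p, tvec A \<kappa> p w)"

definition pseudo_finsler ::
  "('p::{t2_space, second_countable_topology}, 'm::finite) chart set
     \<Rightarrow> ('p \<times> ('p, 'm) tangent) set \<Rightarrow> ('p \<times> ('p, 'm) tangent \<Rightarrow> real) \<Rightarrow> bool" where
  "pseudo_finsler A \<Omega> \<L> \<longleftrightarrow>
     smooth_atlas A \<and> \<Omega> \<subseteq> tangent_bundle A \<and> fst ` \<Omega> = UNIV \<and>
     (\<forall>\<kappa>\<in>A. \<forall>p\<in>fst \<kappa>. pseudo_minkowski (fibre_cone A \<Omega> \<kappa> p) (fibre_fun A \<L> \<kappa> p)) \<and>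
     (\<exists>\<sigma>. \<forall>\<kappa>\<in>A. \<forall>p\<in>fst \<kappa>.
        minkowski_signature (fibre_cone A \<Omega> \<kappa> p) (fibre_fun A \<L> \<kappa> p) = \<sigma>)"

text \<open>\<open>C\<^sup>2\<close> dependence of \<open>\<phi>\<close> on the base point is expressed through the coordinate
  frames \<open>\<partial>\<^sub>\<mu>\<close>.\<close>

definition local_model ::
  "('p::{t2_space, second_countable_topology}, 'm::finite) chart set
     \<Rightarrow> ('p \<times> ('p, 'm) tangent) set \<Rightarrow> ('p \<times> ('p, 'm) tangent \<Rightarrow> real)
     \<Rightarrow> 'v::euclidean_space set \<Rightarrow> ('v \<Rightarrow> real)
     \<Rightarrow> 'p set \<Rightarrow> ('p \<Rightarrow> ('p, 'm) tangent \<Rightarrow> 'v) \<Rightarrow> bool" where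
  "local_model A \<Omega> \<L> \<omega> L U \<phi> \<longleftrightarrow>
     open U \<and>
     (\<forall>p\<in>U. tangent_iso (tangent_space A p) (\<phi> p) \<and> \<phi> p ` (\<Omega> `` {p}) = \<omega>) \<and>
     (\<forall>\<kappa>\<in>A. \<forall>p\<in>U \<inter> fst \<kappa>. \<forall>w\<in>closure (fibre_cone A \<Omega> \<kappa> p).
        L (\<phi> p (tvec A \<kappa> p w)) = fibre_fun A \<L> \<kappa> p w) \<and>
     (\<forall>\<kappa>\<in>A. \<forall>w. Ck_on 2 (\<lambda>x. \<phi> (chart_inv \<kappa> x) (tvec A \<kappa> (chart_inv \<kappa> x) w))
        (snd \<kappa> ` (U \<inter> fst \<kappa>)))"

definition modeled_on ::
  "('p::{t2_space, second_countable_topology}, 'm::finite) chart set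
     \<Rightarrow> ('p \<times> ('p, 'm) tangent) set \<Rightarrow> ('p \<times> ('p, 'm) tangent \<Rightarrow> real)
     \<Rightarrow> 'v::euclidean_space set \<Rightarrow> ('v \<Rightarrow> real) \<Rightarrow> bool" where
  "modeled_on A \<Omega> \<L> \<omega> L \<longleftrightarrow> (\<forall>p. \<exists>U \<phi>. p \<in> U \<and> local_model A \<Omega> \<L> \<omega> L U \<phi>)"

definition partial :: "'m::finite \<Rightarrow> (real^'m \<Rightarrow> real) \<Rightarrow> real^'m \<Rightarrow> real" where
  "partial i f x = deriv (\<lambda>t. f (x + t *\<^sub>R axis i 1)) 0"

definition px :: "'m::finite \<Rightarrow> (real^'m \<Rightarrow> real^'m \<Rightarrow> real) \<Rightarrow> real^'m \<Rightarrow> real^'m \<Rightarrow> real" where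
  "px \<mu> F x y = partial \<mu> (\<lambda>x'. F x' y) x"

definition py :: "'m::finite \<Rightarrow> (real^'m \<Rightarrow> real^'m \<Rightarrow> real) \<Rightarrow> real^'m \<Rightarrow> real^'m \<Rightarrow> real" where
  "py \<mu> F x y = partial \<mu> (F x) y"

definition local_fun ::
  "('p, 'm::finite) chart set \<Rightarrow> ('p \<times> ('p, 'm) tangent \<Rightarrow> real) \<Rightarrow> ('p, 'm) chart
     \<Rightarrow> real^'m \<Rightarrow> real^'m \<Rightarrow> real" where
  "local_fun A \<L> \<kappa> x y = fibre_fun A \<L> \<kappa> (chart_inv \<kappa> x) y"

definition metric_mat :: "(real^'m::finite \<Rightarrow> real) \<Rightarrow> real^'m \<Rightarrow> real^'m^'m" where
  "metric_mat f y = (\<chi> a b. partial a (partial b f) y)"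

definition spray ::
  "(real^'m::finite \<Rightarrow> real^'m \<Rightarrow> real) \<Rightarrow> 'm \<Rightarrow> real^'m \<Rightarrow> real^'m \<Rightarrow> real" where
  "spray F \<mu> x y = 1/2 * (\<Sum>\<sigma>\<in>UNIV. matrix_inv (metric_mat (F x) y) $ \<mu> $ \<sigma> *
     ((\<Sum>\<rho>\<in>UNIV. px \<rho> (py \<sigma> F) x y * y $ \<rho>) - px \<sigma> F x y))"

definition nonlin_conn ::
  "(real^'m::finite \<Rightarrow> real^'m \<Rightarrow> real) \<Rightarrow> 'm \<Rightarrow> 'm \<Rightarrow> real^'m \<Rightarrow> real^'m \<Rightarrow> real" where
  "nonlin_conn F \<mu> \<alpha> = py \<alpha> (spray F \<mu>)"

definition delta_deriv ::
  "(real^'m::finite \<Rightarrow> real^'m \<Rightarrow> real) \<Rightarrow> 'm \<Rightarrow> (real^'m \<Rightarrow> real^'m \<Rightarrow> real)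
     \<Rightarrow> real^'m \<Rightarrow> real^'m \<Rightarrow> real" where
  "delta_deriv F \<alpha> H x y = px \<alpha> H x y - (\<Sum>\<mu>\<in>UNIV. nonlin_conn F \<mu> \<alpha> x y * py \<mu> H x y)"

definition curvature ::
  "(real^'m::finite \<Rightarrow> real^'m \<Rightarrow> real) \<Rightarrow> 'm \<Rightarrow> 'm \<Rightarrow> 'm \<Rightarrow> real^'m \<Rightarrow> real^'m \<Rightarrow> real" where
  "curvature F \<mu> \<alpha> \<beta> x y =
     delta_deriv F \<alpha> (nonlin_conn F \<mu> \<beta>) x y - delta_deriv F \<beta> (nonlin_conn F \<mu> \<alpha>) x y"

definition Ric :: "(real^'m::finite \<Rightarrow> real^'m \<Rightarrow> real) \<Rightarrow> real^'m \<Rightarrow> real^'m \<Rightarrow> real" where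
  "Ric F x y = (\<Sum>\<mu>\<in>UNIV. \<Sum>\<alpha>\<in>UNIV. curvature F \<mu> \<mu> \<alpha> x y * y $ \<alpha>)"

text \<open>\<open>vierbein A \<phi> b \<kappa> a x $ \<mu>\<close> is \<open>e\<^sup>\<mu>\<^sub>a(x)\<close>, the coordinate components of
  the preimage of the basis vector \<open>b a\<close> of \<open>V\<close> under \<open>\<phi>\<close> at the point with coordinates \<open>x\<close>.\<close>

definition vierbein ::
  "('p, 'm::finite) chart set \<Rightarrow> ('p \<Rightarrow> ('p, 'm) tangent \<Rightarrow> 'v) \<Rightarrow> ('m \<Rightarrow> 'v)
     \<Rightarrow> ('p, 'm) chart \<Rightarrow> 'm \<Rightarrow> real^'m \<Rightarrow> real^'m" where
  "vierbein A \<phi> b \<kappa> a x =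
     inv_into (tangent_space A (chart_inv \<kappa> x)) (\<phi> (chart_inv \<kappa> x)) (b a) \<kappa>"

text \<open>The coefficients \<open>v\<^sup>a\<close> in \<open>v = v\<^sup>a f\<^sub>a\<close>, for a frame \<open>f\<close>.\<close>

definition frame_coord :: "('m::finite \<Rightarrow> real^'m) \<Rightarrow> real^'m \<Rightarrow> 'm \<Rightarrow> real" where
  "frame_coord f v a = representation (range f) v (f a)"

definition lie_bracket ::
  "(real^'m::finite \<Rightarrow> real^'m) \<Rightarrow> (real^'m \<Rightarrow> real^'m) \<Rightarrow> real^'m \<Rightarrow> real^'m" where
  "lie_bracket X Y x = (\<chi> \<mu>. \<Sum>\<nu>\<in>UNIV.
     X x $ \<nu> * partial \<nu> (\<lambda>z. Y z $ \<mu>) x - Y x $ \<nu> * partial \<nu> (\<lambda>z. X z $ \<mu>) x)"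

text \<open>\<open>comm_coeff e c a b\<close> is \<open>c\<^sup>c\<^sub>a\<^sub>b\<close>: upper index first.  In \<open>comm_coeff_deriv e c a b d\<close>
  the last index is the one after the comma.\<close>

definition comm_coeff ::
  "('m::finite \<Rightarrow> real^'m \<Rightarrow> real^'m) \<Rightarrow> 'm \<Rightarrow> 'm \<Rightarrow> 'm \<Rightarrow> real^'m \<Rightarrow> real" where
  "comm_coeff e c a b x = frame_coord (\<lambda>d. e d x) (lie_bracket (e a) (e b) x) c"

definition comm_coeff_deriv ::
  "('m::finite \<Rightarrow> real^'m \<Rightarrow> real^'m) \<Rightarrow> 'm \<Rightarrow> 'm \<Rightarrow> 'm \<Rightarrow> 'm \<Rightarrow> real^'m \<Rightarrow> real" where
  "comm_coeff_deriv e c a b d x = (\<Sum>\<mu>\<in>UNIV. e d x $ \<mu> * partial \<mu> (comm_coeff e c a b) x)"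

text \<open>\<open>L\<close> regarded as a function of the coefficients \<open>y\<^sup>a\<close> with respect to the basis \<open>b\<close>.\<close>

definition in_basis :: "('m::finite \<Rightarrow> 'v::real_vector) \<Rightarrow> ('v \<Rightarrow> real) \<Rightarrow> real^'m \<Rightarrow> real" where
  "in_basis b L \<eta> = L (\<Sum>a\<in>UNIV. \<eta> $ a *\<^sub>R b a)"

definition metric_inv :: "(real^'m::finite \<Rightarrow> real) \<Rightarrow> real^'m \<Rightarrow> real^'m^'m" where
  "metric_inv f y = matrix_inv (metric_mat f y)"

definition cartan :: "(real^'m::finite \<Rightarrow> real) \<Rightarrow> 'm \<Rightarrow> 'm \<Rightarrow> 'm \<Rightarrow> real^'m \<Rightarrow> real" where
  "cartan f a b c y = 1/2 * partial a (partial b (partial c f)) y"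

definition mean_cartan :: "(real^'m::finite \<Rightarrow> real) \<Rightarrow> 'm \<Rightarrow> real^'m \<Rightarrow> real" where
  "mean_cartan f a y = (\<Sum>b\<in>UNIV. \<Sum>c\<in>UNIV. metric_inv f y $ b $ c * cartan f a b c y)"

text \<open>\<open>I\<^sup>a\<close>, \<open>C\<^sup>a\<^sup>b\<^sub>c\<close> and \<open>C\<^sup>a\<^sup>b\<^sup>c\<close>.\<close>

definition mean_cartan_up :: "(real^'m::finite \<Rightarrow> real) \<Rightarrow> 'm \<Rightarrow> real^'m \<Rightarrow> real" where
  "mean_cartan_up f a y = (\<Sum>i\<in>UNIV. metric_inv f y $ a $ i * mean_cartan f i y)"

definition cartan_up2 :: "(real^'m::finite \<Rightarrow> real) \<Rightarrow> 'm \<Rightarrow> 'm \<Rightarrow> 'm \<Rightarrow> real^'m \<Rightarrow> real" where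
  "cartan_up2 f a b c y = (\<Sum>i\<in>UNIV. \<Sum>j\<in>UNIV.
     metric_inv f y $ a $ i * metric_inv f y $ b $ j * cartan f i j c y)"

definition cartan_up3 :: "(real^'m::finite \<Rightarrow> real) \<Rightarrow> 'm \<Rightarrow> 'm \<Rightarrow> 'm \<Rightarrow> real^'m \<Rightarrow> real" where
  "cartan_up3 f a b c y = (\<Sum>k\<in>UNIV. metric_inv f y $ c $ k * cartan_up2 f a b k y)"

end

theory Submission
  imports Defs
begin

text \<open>
  With \<open>\<eta>\<^sup>a = e\<^sup>a\<^sub>\<nu> y\<^sup>\<nu>\<close> the spray splits as
  \<open>2 G\<^sup>\<mu> = e\<^sup>\<mu>\<^sub>a (v\<^sup>a + H\<^sup>a)\<close>, where \<open>v\<^sup>a = \<partial>\<^sub>\<rho> e\<^sup>a\<^sub>\<nu> y\<^sup>\<rho> y\<^sup>\<nu>\<close> and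
  \<open>H\<^sup>a = g\<^sup>a\<^sup>d P\<^sub>d\<close>, \<open>P\<^sub>d = y\<^sub>i c\<^sup>i\<^sub>d\<^sub>k \<eta>\<^sup>k\<close>.  The divergence of \<open>H\<close> in \<open>\<eta>\<close> is
  \<open>c\<^sup>d\<^sub>d\<^sub>k \<eta>\<^sup>k - 2 J\<close> with \<open>J = I\<^sup>d P\<^sub>d\<close>, so the trace of the non-linear connection is
  \<open>e\<^sup>\<nu>\<^sub>a \<partial>\<^sub>\<sigma> e\<^sup>a\<^sub>\<nu> y\<^sup>\<sigma> - J\<close>; fourth derivatives of \<open>L\<close> thus enter only through
  \<open>\<partial>\<^sub>b I\<^sup>d\<close>.  Inserting this into the first
  expression for the Ricci scalar, all non-tensorial derivatives of the frame cancel and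
  \<open>Ric = D\<^sub>a H\<^sup>a - \<eta>\<^sup>b \<eta>\<^sup>c c\<^sup>a\<^sub>a\<^sub>b\<^sub>,\<^sub>c + \<eta>\<^sup>c D\<^sub>c J + c\<^sup>d\<^sub>d\<^sub>a H\<^sup>a - H\<^sup>b \<partial>\<^sub>b J - tr (Q\<^sup>2) / 4\<close>
  remains, where \<open>D\<^sub>a\<close> is the derivative along \<open>e\<^sub>a\<close> at fixed \<open>\<eta>\<close> and
  \<open>Q\<^sup>a\<^sub>b = c\<^sup>a\<^sub>b\<^sub>k \<eta>\<^sup>k + \<partial>\<^sub>b H\<^sup>a\<close>.  Lowering an index splits \<open>Q\<close> into a symmetric part, made of
  \<open>C\<close> and of \<open>c\<^sup>a\<^sub>b\<^sub>k \<eta>\<^sup>k\<close> symmetrised, and the antisymmetric part \<open>y\<^sub>i c\<^sup>i\<^sub>d\<^sub>b\<close>;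
  the mixed trace vanishes, which gives the quadratic terms.
\<close>

section \<open>Functions of class \<open>C\<^sup>k\<close> and partial derivatives\<close>

text \<open>Modelling on one space enters through a single identity: in coordinates
  \<open>F x y = f (\<epsilon> x *v y)\<close>, where \<open>f\<close> is L read in the basis and
  the same for all points, so that x acts only through the matrix \<open>\<epsilon> x\<close>. The
  locale \<open>frame_model\<close> keeps this identity and the regularity; the manifold returns
  only at the end. Smoothness is limited: \<open>f\<close> is C^4 on the cone and the coframe C^2,
  which gives an inverse metric of class C^2, but a mean Cartan torsion and coefficients c of class
  C^1. Partial derivatives are therefore taken in x at fixed y and in y at fixed x, in the order in
  which the definitions ask for them, and are commuted only inside \<open>f\<close> (with its
  gradient) and inside the coframe. For the same reason contraction precedes differentiation: y is
  contracted into the connection before the x-derivative, and the trace of the connection is brought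
  to closed form before it is differentiated. The remaining index work is done with traces of matrix
  products, where symmetry of an index pair becomes transposition and renaming of bound indices
  becomes cyclicity.\<close>

abbreviation (input) sum_univ :: "('i \<Rightarrow> 'b::comm_monoid_add) \<Rightarrow> 'b" (binder "\<^bold>\<Sum>" 10) where
  "sum_univ t \<equiv> sum t UNIV"

lemma has_derivative_frechet:
  "f differentiable (at x) \<Longrightarrow> (f has_derivative frechet_derivative f (at x)) (at x)"
  by (simp add: frechet_derivative_works)

text \<open>\<open>frechet_derivative\<close> is a choice from the predicate of being a derivative.
  That predicate is the same for both functions, so the chosen values coincide whether or not a
  derivative exists.\<close>

lemma frechet_derivative_cong_open:
  assumes "open S" "x \<in> S" "\<And>z. z \<in> S \<Longrightarrow> f z = g z"
  shows "frechet_derivative f (at x) = frechet_derivative g (at x)"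
proof -
  have "(f has_derivative D) (at x) \<longleftrightarrow> (g has_derivative D) (at x)" for D
    using assms by (metis has_derivative_transform_within_open)
  then show ?thesis
    unfolding frechet_derivative_def by simp
qed

lemma differentiable_cong_open:
  assumes "open S" "x \<in> S" "\<And>z. z \<in> S \<Longrightarrow> f z = g z" "f differentiable (at x)"
  shows "g differentiable (at x)"
  using assms unfolding differentiable_def by (metis has_derivative_transform_within_open)

text \<open>Most closure lemmas below rest on it: the derivative of a compound is replaced on S by
  its formula, to which the induction hypothesis applies. Openness of S matters because the
  derivatives are those of the ambient space.\<close>

lemma Ck_on_cong:
  assumes "open S" "\<And>z. z \<in> S \<Longrightarrow> f z = g z" "Ck_on k f S"
  shows "Ck_on k g S"
  using assms(2,3)
proof (induction k arbitrary: f g)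
  case 0
  then show ?case by (simp cong: continuous_on_cong)
next
  case (Suc k)
  have "Ck_on k (\<lambda>x. frechet_derivative g (at x) v) S" for v
  proof (rule Suc.IH)
    show "Ck_on k (\<lambda>x. frechet_derivative f (at x) v) S" using Suc.prems by simp
    show "frechet_derivative f (at z) v = frechet_derivative g (at z) v" if "z \<in> S" for z
      using frechet_derivative_cong_open[OF assms(1) that Suc.prems(1)] by simp
  qed
  moreover have "g differentiable (at x)" if "x \<in> S" for x
    using differentiable_cong_open[OF assms(1) that Suc.prems(1)] Suc.prems(2) that by simp
  ultimately show ?case by simp
qed

lemma Ck_on_Suc_imp: "Ck_on (Suc k) f S \<Longrightarrow> Ck_on k f S"
proof (induction k arbitrary: f)
  case 0
  then show ?case
    by (simp add: differentiable_imp_continuous_on differentiable_on_def differentiable_at_withinI)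
next
  case (Suc k)
  then show ?case by fastforce
qed

lemma Ck_on_le: "Ck_on k f S \<Longrightarrow> j \<le> k \<Longrightarrow> Ck_on j f S"
  by (induction k) (auto simp: le_Suc_eq simp del: Ck_on.simps dest: Ck_on_Suc_imp)

lemma Ck_on_imp_differentiable: "Ck_on k f S \<Longrightarrow> 0 < k \<Longrightarrow> x \<in> S \<Longrightarrow> f differentiable (at x)"
  by (cases k) auto

lemma Ck_on_imp_continuous_on: "Ck_on k f S \<Longrightarrow> continuous_on S f"
  using Ck_on_le[of k f S 0] by simp

lemma Ck_on_const: "Ck_on k (\<lambda>x. c) S"
  by (induction k arbitrary: c) simp_all

lemma Ck_on_add:
  assumes "open S" "Ck_on k f S" "Ck_on k g S"
  shows "Ck_on k (\<lambda>x. f x + g x) S"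
  using assms(2,3)
proof (induction k arbitrary: f g)
  case 0
  then show ?case by (simp add: continuous_on_add)
next
  case (Suc k)
  have fd: "frechet_derivative (\<lambda>x. f x + g x) (at x) v
      = frechet_derivative f (at x) v + frechet_derivative g (at x) v" if "x \<in> S" for x v
  proof -
    have "((\<lambda>x. f x + g x) has_derivative
        (\<lambda>v. frechet_derivative f (at x) v + frechet_derivative g (at x) v)) (at x)"
      by (rule has_derivative_add[OF has_derivative_frechet has_derivative_frechet]) (use Suc.prems that in auto)
    then show ?thesis by (metis frechet_derivative_at)
  qed
  have "Ck_on k (\<lambda>x. frechet_derivative (\<lambda>x. f x + g x) (at x) v) S" for v
    by (rule Ck_on_cong[OF assms(1) fd[symmetric]]) (use Suc in auto)
  then show ?case using Suc.prems by simp
qed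

lemma Ck_on_mult:
  fixes f g :: "'a::real_normed_vector \<Rightarrow> real"
  assumes "open S" "Ck_on k f S" "Ck_on k g S"
  shows "Ck_on k (\<lambda>x. f x * g x) S"
  using assms(2,3)
proof (induction k arbitrary: f g)
  case 0
  then show ?case by (simp add: continuous_on_mult)
next
  case (Suc k)
  have fd: "frechet_derivative (\<lambda>x. f x * g x) (at x) v
      = f x * frechet_derivative g (at x) v + frechet_derivative f (at x) v * g x" if "x \<in> S" for x v
  proof -
    have "((\<lambda>x. f x * g x) has_derivative
        (\<lambda>v. f x * frechet_derivative g (at x) v + frechet_derivative f (at x) v * g x)) (at x)"
      by (rule has_derivative_mult[OF has_derivative_frechet has_derivative_frechet]) (use Suc.prems that in auto)
    then show ?thesis by (metis frechet_derivative_at)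
  qed
  have "Ck_on k (\<lambda>x. frechet_derivative (\<lambda>x. f x * g x) (at x) v) S" for v
  proof (rule Ck_on_cong[OF assms(1) fd[symmetric]])
    show "Ck_on k (\<lambda>x. f x * frechet_derivative g (at x) v + frechet_derivative f (at x) v * g x) S"
      using Suc.prems Ck_on_Suc_imp[OF Suc.prems(1)] Ck_on_Suc_imp[OF Suc.prems(2)]
      by (intro Ck_on_add Suc.IH assms(1)) simp_all
  qed
  then show ?case using Suc.prems by simp
qed

lemma Ck_on_minus:
  fixes f :: "'a::real_normed_vector \<Rightarrow> real"
  assumes "open S" "Ck_on k f S"
  shows "Ck_on k (\<lambda>x. - f x) S"
  using Ck_on_mult[OF assms(1) Ck_on_const[of k "-1"] assms(2)] by simp

lemma Ck_on_diff:
  fixes f g :: "'a::real_normed_vector \<Rightarrow> real"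
  assumes "open S" "Ck_on k f S" "Ck_on k g S"
  shows "Ck_on k (\<lambda>x. f x - g x) S"
  using Ck_on_add[OF assms(1,2) Ck_on_minus[OF assms(1,3)]] by simp

lemma Ck_on_sum:
  assumes "open S" "\<And>i. i \<in> A \<Longrightarrow> Ck_on k (f i) S"
  shows "Ck_on k (\<lambda>x. \<Sum>i\<in>A. f i x) S"
  using assms(2) by (induction A rule: infinite_finite_induct) (auto intro!: Ck_on_const Ck_on_add assms(1))

lemma Ck_on_prod:
  fixes f :: "'i \<Rightarrow> 'a::real_normed_vector \<Rightarrow> real"
  assumes "open S" "\<And>i. i \<in> A \<Longrightarrow> Ck_on k (f i) S"
  shows "Ck_on k (\<lambda>x. \<Prod>i\<in>A. f i x) S"
  using assms(2) by (induction A rule: infinite_finite_induct) (auto intro!: Ck_on_const Ck_on_mult assms(1))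

lemma Ck_on_inverse:
  fixes f :: "'a::real_normed_vector \<Rightarrow> real"
  assumes "open S" "Ck_on k f S" "\<And>x. x \<in> S \<Longrightarrow> f x \<noteq> 0"
  shows "Ck_on k (\<lambda>x. inverse (f x)) S"
  using assms(2)
proof (induction k)
  case 0
  then show ?case using assms(3) by (simp add: continuous_on_inverse)
next
  case (Suc k)
  have fd: "frechet_derivative (\<lambda>x. inverse (f x)) (at x) v
      = - (inverse (f x) * frechet_derivative f (at x) v * inverse (f x))" if "x \<in> S" for x v
  proof -
    have "((\<lambda>x. inverse (f x)) has_derivative
        (\<lambda>v. - (inverse (f x) * frechet_derivative f (at x) v * inverse (f x)))) (at x)"
      by (rule Deriv.has_derivative_inverse[OF _ has_derivative_frechet]) (use Suc.prems that assms(3) in auto)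
    then show ?thesis by (metis frechet_derivative_at)
  qed
  have "Ck_on k (\<lambda>x. frechet_derivative (\<lambda>x. inverse (f x)) (at x) v) S" for v
  proof (rule Ck_on_cong[OF assms(1) fd[symmetric]])
    show "Ck_on k (\<lambda>x. - (inverse (f x) * frechet_derivative f (at x) v * inverse (f x))) S"
      using Suc.prems Ck_on_Suc_imp[OF Suc.prems] by (intro Ck_on_minus Ck_on_mult Suc.IH assms(1)) simp_all
  qed
  then show ?case using Suc.prems assms(3) by simp
qed

lemma Ck_on_bounded_linear:
  assumes "bounded_linear T"
  shows "Ck_on k T S"
proof (cases k)
  case 0
  then show ?thesis using assms by (simp add: linear_continuous_on)
next
  case (Suc j)
  have "frechet_derivative T (at x) = T" for x
    using bounded_linear_imp_has_derivative[OF assms] frechet_derivative_at by metis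
  then show ?thesis
    using Suc assms by (auto simp: Ck_on_const intro: bounded_linear_imp_differentiable)
qed

lemma Ck_on_nth: "Ck_on k (\<lambda>x::real^'m. x $ i) S"
  by (rule Ck_on_bounded_linear) (rule bounded_linear_vec_nth)

lemma Ck_on_linear_comp:
  assumes "open S" "bounded_linear T" "Ck_on k f S"
  shows "Ck_on k (\<lambda>x. T (f x)) S"
  using assms(3)
proof (induction k arbitrary: f)
  case 0
  then show ?case using bounded_linear.continuous_on[OF assms(2)] by simp
next
  case (Suc k)
  have hd: "((\<lambda>x. T (f x)) has_derivative (\<lambda>v. T (frechet_derivative f (at x) v))) (at x)"
    if "x \<in> S" for x
    by (rule bounded_linear.has_derivative[OF assms(2) has_derivative_frechet]) (use Suc.prems that in simp)
  have "Ck_on k (\<lambda>x. frechet_derivative (\<lambda>x. T (f x)) (at x) v) S" for v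
  proof (rule Ck_on_cong[OF assms(1)])
    show "Ck_on k (\<lambda>x. T (frechet_derivative f (at x) v)) S" using Suc by simp
    show "T (frechet_derivative f (at z) v) = frechet_derivative (\<lambda>x. T (f x)) (at z) v" if "z \<in> S" for z
      using hd[OF that] frechet_derivative_at by metis
  qed
  then show ?case using hd by (auto simp: differentiable_def)
qed

text \<open>The derivative of \<open>f (T x)\<close> along \<open>v\<close> is the derivative of
  \<open>f\<close> along the fixed vector \<open>T v\<close>, again composed with \<open>T\<close>;
  hence the induction over all \<open>f\<close>.\<close>

lemma Ck_on_comp_linear:
  assumes "open S" "bounded_linear T" "Ck_on k f S"
  shows "Ck_on k (\<lambda>x. f (T x)) (T -` S)"
  using assms(3)
proof (induction k arbitrary: f)
  case 0
  then have "continuous_on S f" by simp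
  then show ?case using continuous_on_compose2[OF _ linear_continuous_on[OF assms(2)], of S f] by simp
next
  case (Suc k)
  have op: "open (T -` S)"
    using assms(1,2) by (simp add: continuous_open_vimage linear_continuous_at)
  have hd: "((\<lambda>x. f (T x)) has_derivative (\<lambda>v. frechet_derivative f (at (T x)) (T v))) (at x)"
    if "x \<in> T -` S" for x
    by (rule has_derivative_compose[OF bounded_linear_imp_has_derivative[OF assms(2)], where g=f])
       (use Suc.prems that in \<open>auto simp: has_derivative_frechet\<close>)
  have "Ck_on k (\<lambda>x. frechet_derivative (\<lambda>x. f (T x)) (at x) v) (T -` S)" for v
  proof (rule Ck_on_cong[OF op])
    show "Ck_on k (\<lambda>x. frechet_derivative f (at (T x)) (T v)) (T -` S)"
      using Suc.prems by (intro Suc.IH) simp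
    show "frechet_derivative f (at (T z)) (T v) = frechet_derivative (\<lambda>x. f (T x)) (at z) v"
      if "z \<in> T -` S" for z
      using hd[OF that] frechet_derivative_at by metis
  qed
  then show ?case using hd by (auto simp: differentiable_def)
qed

section \<open>Determinants and inverse matrices\<close>

lemma Ck_on_det:
  fixes M :: "'a::real_normed_vector \<Rightarrow> real^'n^'n"
  assumes "open S" "\<And>a b. Ck_on k (\<lambda>x. M x $ a $ b) S"
  shows "Ck_on k (\<lambda>x. det (M x)) S"
  unfolding det_def
  by (intro Ck_on_sum Ck_on_mult Ck_on_prod Ck_on_const assms)

lemma matrix_inv_mult:
  fixes A :: "real^'n^'n"
  assumes "invertible A"
  shows "A ** matrix_inv A = mat 1" "matrix_inv A ** A = mat 1"
proof -
  have "\<exists>B. A ** B = mat 1 \<and> B ** A = mat 1" using assms by (simp add: invertible_def)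
  then have "A ** matrix_inv A = mat 1 \<and> matrix_inv A ** A = mat 1"
    unfolding matrix_inv_def by (rule someI_ex)
  then show "A ** matrix_inv A = mat 1" "matrix_inv A ** A = mat 1" by auto
qed

lemma matrix_inv_eqI:
  fixes A :: "real^'n^'n"
  assumes "A ** B = mat 1"
  shows "matrix_inv A = B"
proof -
  have "invertible A" using assms by (simp add: invertible_right_inverse) blast
  have "matrix_inv A = matrix_inv A ** (A ** B)" using assms by simp
  also have "\<dots> = B" by (simp add: matrix_mul_assoc matrix_inv_mult[OF \<open>invertible A\<close>])
  finally show ?thesis .
qed

text \<open>Cramer's rule writes the entries of the inverse as determinants divided by
  \<open>det A\<close>; this is how the regularity of a matrix passes to its inverse in
  \<open>Ck_on_matrix_inv\<close>.\<close>

lemma matrix_inv_cramer: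
  fixes A :: "real^'n^'n"
  assumes "invertible A"
  shows "matrix_inv A $ k $ l = det (\<chi> i j. if j = k then axis l 1 $ i else A $ i $ j) * inverse (det A)"
proof -
  have "A *v (matrix_inv A *v axis l 1) = axis l 1"
    by (simp add: matrix_vector_mul_assoc matrix_inv_mult[OF assms])
  then have "matrix_inv A *v axis l 1 = (\<chi> k. det (\<chi> i j. if j = k then axis l 1 $ i else A $ i $ j) / det A)"
    using assms by (simp add: cramer invertible_det_nz)
  then show ?thesis
    by (simp add: vec_eq_iff divide_inverse matrix_vector_mul_component inner_axis row_def
        matrix_vector_mult_basis column_def)
qed

lemma Ck_on_matrix_inv:
  fixes M :: "'a::real_normed_vector \<Rightarrow> real^'n^'n"
  assumes "open S" "\<And>a b. Ck_on k (\<lambda>x. M x $ a $ b) S" "\<And>x. x \<in> S \<Longrightarrow> invertible (M x)"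
  shows "Ck_on k (\<lambda>x. matrix_inv (M x) $ a $ b) S"
proof (rule Ck_on_cong[OF assms(1) matrix_inv_cramer[symmetric]])
  show "Ck_on k (\<lambda>x. det (\<chi> i j. if j = a then axis b 1 $ i else M x $ i $ j) * inverse (det (M x))) S"
  proof (intro Ck_on_mult Ck_on_inverse assms Ck_on_det)
    show "Ck_on k (\<lambda>x. (\<chi> i j. if j = a then axis b 1 $ i else M x $ i $ j) $ i $ j) S" for i j
      using assms by (cases "j = a") (auto simp: Ck_on_const)
    show "det (M x) \<noteq> 0" if "x \<in> S" for x
      using assms(3)[OF that] by (simp add: invertible_det_nz)
  qed
qed (use assms in auto)

section \<open>Partial derivatives and their rules\<close>

lemma has_derivative_partial:
  assumes "(f has_derivative D) (at x)"
  shows "partial i f x = D (axis i 1)"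
proof -
  have "((\<lambda>t. f (x + t *\<^sub>R axis i 1)) has_derivative (\<lambda>t. D (t *\<^sub>R axis i 1))) (at 0)"
    by (rule has_derivative_compose[where g=f]) (use assms in \<open>auto intro!: derivative_eq_intros\<close>)
  then have "((\<lambda>t. f (x + t *\<^sub>R axis i 1)) has_real_derivative D (axis i 1)) (at 0)"
    by (simp add: has_field_derivative_def linear_scale[OF has_derivative_linear[OF assms]] mult_commute_abs)
  then show ?thesis unfolding partial_def by (rule DERIV_imp_deriv)
qed

lemma partial_eq_frechet:
  "f differentiable (at x) \<Longrightarrow> partial i f x = frechet_derivative f (at x) (axis i 1)"
  by (rule has_derivative_partial) (simp add: has_derivative_frechet)

lemma partial_works:
  fixes f :: "real^'m::finite \<Rightarrow> real"
  assumes "f differentiable (at x)"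
  shows "(f has_derivative (\<lambda>v. \<^bold>\<Sum>i. partial i f x * v $ i)) (at x)"
proof -
  let ?D = "frechet_derivative f (at x)"
  have D: "(f has_derivative ?D) (at x)" using assms by (simp add: has_derivative_frechet)
  have "?D v = (\<^bold>\<Sum>i. partial i f x * v $ i)" for v
  proof -
    have "?D v = ?D (\<^bold>\<Sum>i. v $ i *\<^sub>R axis i 1)"
      using basis_expansion[of v] by (simp add: scalar_mult_eq_scaleR)
    also have "\<dots> = (\<^bold>\<Sum>i. v $ i * ?D (axis i 1))"
      using has_derivative_linear[OF D] by (simp add: linear_sum linear_scale)
    finally show ?thesis by (simp add: partial_eq_frechet[OF assms] mult.commute)
  qed
  then show ?thesis using D by presburger
qed

lemma partial_cong_open:
  assumes "open S" "x \<in> S" "\<And>z. z \<in> S \<Longrightarrow> f z = g z"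
  shows "partial i f x = partial i g x"
proof -
  have "\<forall>\<^sub>F t in nhds 0. x + t *\<^sub>R axis i 1 \<in> S"
  proof (rule topological_tendstoD[OF _ assms(1)])
    have "((\<lambda>t. x + t *\<^sub>R axis i 1) \<longlongrightarrow> x + 0 *\<^sub>R axis i 1) (nhds 0)"
      by (intro tendsto_intros filterlim_ident)
    then show "((\<lambda>t. x + t *\<^sub>R axis i 1) \<longlongrightarrow> x) (nhds 0)" by simp
  qed (use assms in simp)
  then have "\<forall>\<^sub>F t in nhds 0. f (x + t *\<^sub>R axis i 1) = g (x + t *\<^sub>R axis i 1)"
    by eventually_elim (use assms in auto)
  then show ?thesis unfolding partial_def by (rule deriv_cong_ev) simp
qed

lemma partial_const [simp]: "partial i (\<lambda>x. c) x = 0"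
  by (simp add: partial_def)

lemma partial_nth: "partial i (\<lambda>x. x $ j) x = (if i = j then 1 else 0)"
proof -
  have "((\<lambda>x::real^'a. x $ j) has_derivative (\<lambda>v. v $ j)) (at x)"
    by (rule bounded_linear_imp_has_derivative) (rule bounded_linear_vec_nth)
  from has_derivative_partial[OF this] show ?thesis by (simp add: axis_def)
qed

lemma partial_add:
  assumes "f differentiable (at x)" "g differentiable (at x)"
  shows "partial i (\<lambda>x. f x + g x) x = partial i f x + partial i g x"
  using has_derivative_partial[OF has_derivative_add[OF assms[unfolded frechet_derivative_works]]]
  by (simp add: partial_eq_frechet assms)

lemma partial_minus:
  assumes "f differentiable (at x)"
  shows "partial i (\<lambda>x. - f x) x = - partial i f x"
  using has_derivative_partial[OF has_derivative_minus[OF assms[unfolded frechet_derivative_works]]]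
  by (simp add: partial_eq_frechet assms)

lemma partial_diff:
  assumes "f differentiable (at x)" "g differentiable (at x)"
  shows "partial i (\<lambda>x. f x - g x) x = partial i f x - partial i g x"
  using has_derivative_partial[OF has_derivative_diff[OF assms[unfolded frechet_derivative_works]]]
  by (simp add: partial_eq_frechet assms)

lemma partial_mult:
  assumes "f differentiable (at x)" "g differentiable (at x)"
  shows "partial i (\<lambda>x. f x * g x) x = partial i f x * g x + f x * partial i g x"
  using has_derivative_partial[OF has_derivative_mult[OF assms[unfolded frechet_derivative_works]]]
  by (simp add: partial_eq_frechet assms)

lemma partial_cmult:
  assumes "f differentiable (at x)"
  shows "partial i (\<lambda>x. c * f x) x = c * partial i f x"
  using partial_mult[OF differentiable_const assms] by simp

lemma partial_multc:
  assumes "f differentiable (at x)"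
  shows "partial i (\<lambda>x. f x * c) x = partial i f x * c"
  using partial_mult[OF assms differentiable_const] by simp

lemma partial_sum:
  assumes "\<And>k. k \<in> A \<Longrightarrow> f k differentiable (at x)"
  shows "partial i (\<lambda>x. \<Sum>k\<in>A. f k x) x = (\<Sum>k\<in>A. partial i (f k) x)"
  using assms
  by (induction A rule: infinite_finite_induct) (auto simp: partial_add differentiable_sum)

lemma differentiable_vec:
  fixes g :: "'a::real_normed_vector \<Rightarrow> real^'m::finite"
  assumes "\<And>a. (\<lambda>x. g x $ a) differentiable (at x)"
  shows "g differentiable (at x)"
proof -
  have "(g has_derivative (\<lambda>v. \<chi> a. frechet_derivative (\<lambda>x. g x $ a) (at x) v)) (at x)"
    by (subst has_derivative_componentwise_within)
       (auto simp: Basis_vec_def inner_axis has_derivative_frechet assms)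
  then show ?thesis by (auto simp: differentiable_def)
qed

lemma differentiable_comp_vec:
  fixes g :: "'a::real_normed_vector \<Rightarrow> real^'m::finite"
  assumes "\<phi> differentiable (at (g x))" "\<And>a. (\<lambda>x. g x $ a) differentiable (at x)"
  shows "(\<lambda>x. \<phi> (g x)) differentiable (at x)"
  using differentiable_chain_at[OF differentiable_vec[OF assms(2)] assms(1)] by (simp add: o_def)

lemma partial_chain:
  fixes g :: "real^'n::finite \<Rightarrow> real^'m::finite"
  assumes "\<phi> differentiable (at (g x))" "\<And>a. (\<lambda>x. g x $ a) differentiable (at x)"
  shows "partial i (\<lambda>x. \<phi> (g x)) x = (\<^bold>\<Sum>a. partial a \<phi> (g x) * partial i (\<lambda>x. g x $ a) x)"
proof -
  have g: "(g has_derivative frechet_derivative g (at x)) (at x)"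
    using differentiable_vec[OF assms(2)] by (simp add: has_derivative_frechet)
  have "partial i (\<lambda>x. g x $ a) x = frechet_derivative g (at x) (axis i 1) $ a" for a
    by (rule has_derivative_partial) (rule bounded_linear.has_derivative[OF bounded_linear_vec_nth g])
  then show ?thesis
    using has_derivative_partial[OF has_derivative_compose[OF g partial_works[OF assms(1)]]]
    by simp
qed

lemma Ck_on_partial:
  assumes "open S" "Ck_on (Suc k) f S"
  shows "Ck_on k (partial i f) S"
  by (rule Ck_on_cong[OF assms(1), of "\<lambda>x. frechet_derivative f (at x) (axis i 1)"])
     (use assms(2) in \<open>auto simp: partial_eq_frechet\<close>)

lemma Ck_on_partial':
  assumes "open S" "Ck_on k f S" "k = Suc j"
  shows "Ck_on j (partial i f) S"
  using Ck_on_partial[OF assms(1)] assms(2,3) by blast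

lemma matrix_inv_matrix_vector:
  fixes A :: "real^'n^'n"
  assumes "invertible A"
  shows "matrix_inv A *v (A *v y) = y" "A *v (matrix_inv A *v y) = y"
  by (simp_all add: matrix_vector_mul_assoc matrix_inv_mult[OF assms])

lemma matrix_add_rdistrib: "(A + B) ** C = A ** C + B ** (C :: real^'k^'n)"
  by (simp add: matrix_matrix_mult_def vec_eq_iff sum.distrib distrib_right)

text \<open>Differentiating \<open>matrix_inv (M z) ** M z = mat 1\<close> gives h' M + h M' = 0,
  and multiplication by the inverse on the right isolates h'. That the inverse is differentiable at
  all comes from Cramer's rule.\<close>

lemma partial_matrix_inv:
  fixes M :: "real^'m::finite \<Rightarrow> real^'n::finite^'n"
  assumes S: "open S" "x \<in> S" "\<And>z. z \<in> S \<Longrightarrow> invertible (M z)"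
    and M: "\<And>a b. Ck_on 1 (\<lambda>z. M z $ a $ b) S"
  shows "partial i (\<lambda>z. matrix_inv (M z) $ a $ d) x
    = - (\<^bold>\<Sum>m n. matrix_inv (M x) $ a $ m * partial i (\<lambda>z. M z $ m $ n) x * matrix_inv (M x) $ n $ d)"
proof -
  let ?h = "\<lambda>z. matrix_inv (M z)"
  have dM: "(\<lambda>z. M z $ a $ b) differentiable (at x)" for a b
    using Ck_on_imp_differentiable[OF M] S(2) by simp
  have dh: "(\<lambda>z. ?h z $ a $ b) differentiable (at x)" for a b
    by (rule Ck_on_imp_differentiable[OF Ck_on_matrix_inv[OF S(1) M S(3)]]) (use S in auto)
  define M' where "M' = (\<chi> a b. partial i (\<lambda>z. M z $ a $ b) x)"
  define h' where "h' = (\<chi> a b. partial i (\<lambda>z. ?h z $ a $ b) x)"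
  have "h' ** M x + ?h x ** M' = 0"
  proof -
    have "(h' ** M x + ?h x ** M') $ a $ b = 0" for a b
    proof -
      have "(h' ** M x + ?h x ** M') $ a $ b = partial i (\<lambda>z. (?h z ** M z) $ a $ b) x"
        by (simp add: matrix_matrix_mult_def partial_sum partial_mult dM dh sum.distrib h'_def M'_def)
      also have "\<dots> = partial i (\<lambda>z. mat 1 $ a $ b :: real) x"
        by (rule partial_cong_open[OF S(1,2)]) (simp add: matrix_inv_mult S(3))
      finally show ?thesis by simp
    qed
    then show ?thesis by (simp add: vec_eq_iff)
  qed
  then have "(h' ** M x + ?h x ** M') ** ?h x = 0" by simp
  moreover have "(h' ** M x + ?h x ** M') ** ?h x = h' ** (M x ** ?h x) + ?h x ** M' ** ?h x"
    by (simp only: matrix_add_rdistrib matrix_mul_assoc)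
  ultimately have "h' + ?h x ** M' ** ?h x = 0"
    using matrix_inv_mult(1)[OF S(3)[OF S(2)]] by simp
  then have "h' = - (?h x ** (M' ** ?h x))"
    unfolding eq_neg_iff_add_eq_0 by (simp only: matrix_mul_assoc)
  then have "h' $ a $ d = - (?h x ** (M' ** ?h x)) $ a $ d" by simp
  then show ?thesis
    by (simp add: h'_def M'_def matrix_matrix_mult_def sum_distrib_left mult.assoc)
qed

section \<open>Symmetry of second partial derivatives\<close>

lemma second_difference:
  fixes f :: "real^'m::finite \<Rightarrow> real"
  assumes ball: "\<And>s t. 0 \<le> s \<Longrightarrow> s \<le> h \<Longrightarrow> 0 \<le> t \<Longrightarrow> t \<le> h \<Longrightarrow> x + s *\<^sub>R axis i 1 + t *\<^sub>R axis j 1 \<in> S"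
    and f: "Ck_on 2 f S" and S: "open S" and h: "0 < h"
  shows "\<exists>s t. 0 < s \<and> s < h \<and> 0 < t \<and> t < h \<and>
    f (x + h *\<^sub>R axis i 1 + h *\<^sub>R axis j 1) - f (x + h *\<^sub>R axis i 1) - f (x + h *\<^sub>R axis j 1) + f x
      = h * h * partial j (partial i f) (x + s *\<^sub>R axis i 1 + t *\<^sub>R axis j 1)"
proof -
  let ?p = "\<lambda>s t. x + s *\<^sub>R axis i 1 + t *\<^sub>R axis j 1"
  have ds: "((\<lambda>s. g (?p s t)) has_real_derivative partial i g (?p s t)) (at s)"
    and dt: "((\<lambda>t. g (?p s t)) has_real_derivative partial j g (?p s t)) (at t)"
    if "Ck_on 1 g S" "?p s t \<in> S" for g s t
  proof -
    have g: "(g has_derivative (\<lambda>v. \<^bold>\<Sum>i. partial i g (?p s t) * v $ i)) (at (?p s t))"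
      by (rule partial_works) (use Ck_on_imp_differentiable[OF that(1) _ that(2)] in simp)
    have *: "(\<lambda>r. \<^bold>\<Sum>l. partial l g (?p s t) * (r *\<^sub>R axis k 1) $ l) = (*) (partial k g (?p s t))" for k
      by (simp add: axis_def if_distrib fun_eq_iff cong: if_cong)
    show "((\<lambda>s. g (?p s t)) has_real_derivative partial i g (?p s t)) (at s)"
      unfolding has_field_derivative_def
      by (subst *[symmetric], rule has_derivative_compose[where f = "\<lambda>s. ?p s t" and g = g, OF _ g]) (auto intro!: derivative_eq_intros)
    show "((\<lambda>t. g (?p s t)) has_real_derivative partial j g (?p s t)) (at t)"
      unfolding has_field_derivative_def
      by (subst *[symmetric], rule has_derivative_compose[where f = "\<lambda>t. ?p s t" and g = g, OF _ g]) (auto intro!: derivative_eq_intros)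
  qed
  have f1: "Ck_on 1 f S" and f2: "Ck_on 1 (partial i f) S"
    using Ck_on_le[OF f, of 1] Ck_on_partial[OF S, of 1 f i] f by (simp_all only: numeral_2_eq_2 One_nat_def)
  \<comment> \<open>Mean value theorem along axis i, applied to the increment in direction j as a
    function of s; a second application, along axis j, then turns this increment of the first
    derivative into a second derivative.\<close>
  have "\<exists>s>0. s < h \<and> (f (?p h h) - f (?p h 0)) - (f (?p 0 h) - f (?p 0 0))
      = (h - 0) * (partial i f (?p s h) - partial i f (?p s 0))"
    by (rule MVT2) (use h ball f1 in \<open>auto intro!: DERIV_diff ds simp del: scaleR_zero_left\<close>)
  then obtain s where s: "0 < s" "s < h" and eq1: "(f (?p h h) - f (?p h 0)) - (f (?p 0 h) - f (?p 0 0))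
      = h * (partial i f (?p s h) - partial i f (?p s 0))" by auto
  have "\<exists>t>0. t < h \<and> partial i f (?p s h) - partial i f (?p s 0)
      = (h - 0) * partial j (partial i f) (?p s t)"
    by (rule MVT2) (use h s ball f2 in \<open>auto intro!: dt simp del: scaleR_zero_left\<close>)
  then obtain t where "0 < t" "t < h" "partial i f (?p s h) - partial i f (?p s 0)
      = h * partial j (partial i f) (?p s t)" by auto
  then show ?thesis using s eq1 by (intro exI[of _ s] exI[of _ t]) simp
qed

text \<open>The second difference over a small square is symmetric in i and j. Evaluating it in both
  orders gives points arbitrarily close to x at which the two mixed derivatives agree, and
  continuity carries the equality to x.\<close>

lemma partial_commute:
  fixes f :: "real^'m::finite \<Rightarrow> real"
  assumes S: "open S" "x \<in> S" and f: "Ck_on 2 f S"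
  shows "partial i (partial j f) x = partial j (partial i f) x"
proof -
  obtain r where r: "r > 0" "ball x r \<subseteq> S" using S by (meson open_contains_ball)
  have inS: "dist x (x + s *\<^sub>R axis i 1 + t *\<^sub>R axis j 1) \<le> s + t" if "0 \<le> s" "0 \<le> t" for s t and i j :: 'm
  proof -
    have "norm (s *\<^sub>R axis i (1::real) + t *\<^sub>R axis j 1) \<le> norm (s *\<^sub>R axis i (1::real)) + norm (t *\<^sub>R axis j (1::real))"
      by (rule norm_triangle_ineq)
    moreover have "dist x (x + (s *\<^sub>R axis i 1 + t *\<^sub>R axis j 1)) = norm (s *\<^sub>R axis i (1::real) + t *\<^sub>R axis j 1)"
      by (metis add_diff_cancel_left' dist_commute dist_norm)
    ultimately show ?thesis using that by (simp add: add.assoc)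
  qed
  have cont: "isCont (partial i (partial j f)) x" for i j
  proof -
    have "Ck_on 0 (partial i (partial j f)) S"
      by (intro Ck_on_partial S) (use f in \<open>simp add: numeral_2_eq_2\<close>)
    then show ?thesis using S by (simp add: continuous_on_eq_continuous_at)
  qed
  have "\<forall>n. \<exists>p q. dist x p \<le> r * inverse (real (Suc n)) \<and> dist x q \<le> r * inverse (real (Suc n)) \<and>
      partial j (partial i f) p = partial i (partial j f) q"
  proof
    fix n :: nat
    \<comment> \<open>All points of the square lie within 2h of x. Dividing by 3 keeps that distance
      below r, so the square stays in the ball, and below r / (n + 1), so the points converge to
      x.\<close>
    define h where "h = r * inverse (real (Suc n)) / 3"
    have h: "0 < h" "2 * h \<le> r * inverse (real (Suc n))" "2 * h < r"
      using r(1) by (auto simp: h_def field_simps add_pos_nonneg mult_pos_pos intro: order_le_less_trans[of _ "r * 2"])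
    have box: "x + s *\<^sub>R axis i 1 + t *\<^sub>R axis j 1 \<in> S"
      if "0 \<le> s" "s \<le> h" "0 \<le> t" "t \<le> h" for s t and i j :: 'm
      using inS[OF that(1,3), of i j] that h r(2) by (force simp: subset_iff)
    obtain s t where st: "0 < s" "s < h" "0 < t" "t < h" and
      e1: "f (x + h *\<^sub>R axis i 1 + h *\<^sub>R axis j 1) - f (x + h *\<^sub>R axis i 1) - f (x + h *\<^sub>R axis j 1) + f x
      = h * h * partial j (partial i f) (x + s *\<^sub>R axis i 1 + t *\<^sub>R axis j 1)"
      using second_difference[OF box f S(1) h(1), of i j] by blast
    obtain s' t' where st': "0 < s'" "s' < h" "0 < t'" "t' < h" and
      e2: "f (x + h *\<^sub>R axis j 1 + h *\<^sub>R axis i 1) - f (x + h *\<^sub>R axis j 1) - f (x + h *\<^sub>R axis i 1) + f x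
      = h * h * partial i (partial j f) (x + s' *\<^sub>R axis j 1 + t' *\<^sub>R axis i 1)"
      using second_difference[OF box f S(1) h(1), of j i] by blast
    have "f (x + h *\<^sub>R axis j 1 + h *\<^sub>R axis i 1) = f (x + h *\<^sub>R axis i 1 + h *\<^sub>R axis j 1)"
      by (simp add: add_ac)
    with e1 e2 have "h * h * partial j (partial i f) (x + s *\<^sub>R axis i 1 + t *\<^sub>R axis j 1)
        = h * h * partial i (partial j f) (x + s' *\<^sub>R axis j 1 + t' *\<^sub>R axis i 1)" by linarith
    then have "partial j (partial i f) (x + s *\<^sub>R axis i 1 + t *\<^sub>R axis j 1)
        = partial i (partial j f) (x + s' *\<^sub>R axis j 1 + t' *\<^sub>R axis i 1)" using h(1) by simp
    moreover have "dist x (x + s *\<^sub>R axis i 1 + t *\<^sub>R axis j 1) \<le> r * inverse (real (Suc n))"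
      "dist x (x + s' *\<^sub>R axis j 1 + t' *\<^sub>R axis i 1) \<le> r * inverse (real (Suc n))"
      using inS[of s t i j] inS[of s' t' j i] st st' h by auto
    ultimately show "\<exists>p q. dist x p \<le> r * inverse (real (Suc n)) \<and> dist x q \<le> r * inverse (real (Suc n)) \<and>
      partial j (partial i f) p = partial i (partial j f) q" by blast
  qed
  then obtain p q where pq: "\<And>n. dist x (p n) \<le> r * inverse (real (Suc n))" "\<And>n. dist x (q n) \<le> r * inverse (real (Suc n))"
      "\<And>n. partial j (partial i f) (p n) = partial i (partial j f) (q n)" by metis
  have "(\<lambda>n. r * inverse (real (Suc n))) \<longlonglongrightarrow> 0"
    by (rule tendsto_mult_right_zero[OF LIMSEQ_inverse_real_of_nat])
  then have lim: "z \<longlonglongrightarrow> x" if "\<And>n. dist x (z n) \<le> r * inverse (real (Suc n))" for z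
    by (rule metric_tendsto_imp_tendsto) (use that r(1) in \<open>simp add: dist_commute[of _ x]\<close>)
  have "(\<lambda>n. partial j (partial i f) (p n)) \<longlonglongrightarrow> partial j (partial i f) x"
    "(\<lambda>n. partial i (partial j f) (q n)) \<longlonglongrightarrow> partial i (partial j f) x"
    using isCont_tendsto_compose[OF cont lim[OF pq(1)]] isCont_tendsto_compose[OF cont lim[OF pq(2)]] by auto
  then show ?thesis using pq(3) LIMSEQ_unique by simp
qed

section \<open>Homogeneous functions\<close>

lemma euler_homogeneous:
  fixes \<phi> :: "real^'m::finite \<Rightarrow> real"
  assumes "\<phi> differentiable (at y)" "\<And>s. s > 0 \<Longrightarrow> \<phi> (s *\<^sub>R y) = s ^ k * \<phi> y"
  shows "(\<^bold>\<Sum>a. y $ a * partial a \<phi> y) = real k * \<phi> y"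
proof -
  have "(\<phi> has_derivative (\<lambda>v. \<^bold>\<Sum>i. partial i \<phi> y * v $ i)) (at (1 *\<^sub>R y))"
    using partial_works[OF assms(1)] by simp
  then have "((\<lambda>s. \<phi> (s *\<^sub>R y)) has_derivative (\<lambda>r. \<^bold>\<Sum>i. partial i \<phi> y * (r *\<^sub>R y) $ i)) (at 1)"
    by (rule has_derivative_compose[rotated]) (auto intro!: derivative_eq_intros)
  moreover have "(\<lambda>r. \<^bold>\<Sum>i. partial i \<phi> y * (r *\<^sub>R y) $ i) = (*) (\<^bold>\<Sum>a. y $ a * partial a \<phi> y)"
    by (simp add: fun_eq_iff sum_distrib_left mult_ac)
  ultimately have "((\<lambda>s. \<phi> (s *\<^sub>R y)) has_real_derivative (\<^bold>\<Sum>a. y $ a * partial a \<phi> y)) (at 1)"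
    by (simp add: has_field_derivative_def)
  \<comment> \<open>Homogeneity is given for positive s only, but these form an open set around the
    base point 1, so it determines the two-sided derivative there.\<close>
  moreover have "((\<lambda>s. \<phi> (s *\<^sub>R y)) has_real_derivative real k * \<phi> y) (at 1)"
  proof -
    have "((\<lambda>s. s ^ k * \<phi> y) has_real_derivative real k * \<phi> y) (at 1)"
      by (auto intro!: derivative_eq_intros)
    then show ?thesis
      by (rule has_field_derivative_transform_within_open[where S = "{0<..}"]) (use assms(2) in auto)
  qed
  ultimately show ?thesis by (rule DERIV_unique)
qed

text \<open>The chain rule for z |-> \<phi> (s z) produces one factor s, which cancels against one
  factor of \<open>s ^ Suc k\<close>.\<close>

lemma partial_homogeneous:
  fixes \<phi> :: "real^'m::finite \<Rightarrow> real"
  assumes S: "open S" "y \<in> S" and \<phi>: "\<phi> differentiable (at (s *\<^sub>R y))" "\<phi> differentiable (at y)"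
    and s: "s > 0" and hom: "\<And>z. z \<in> S \<Longrightarrow> \<phi> (s *\<^sub>R z) = s ^ Suc k * \<phi> z"
  shows "partial a \<phi> (s *\<^sub>R y) = s ^ k * partial a \<phi> y"
proof -
  have "s * partial a \<phi> (s *\<^sub>R y) = partial a (\<lambda>z. \<phi> (s *\<^sub>R z)) y"
  proof -
    have nth: "(\<lambda>x::real^'m. x $ b) differentiable (at y)" for b
      by (rule bounded_linear_imp_differentiable) (rule bounded_linear_vec_nth)
    have "partial a (\<lambda>z. \<phi> (s *\<^sub>R z)) y
        = (\<^bold>\<Sum>b. partial b \<phi> (s *\<^sub>R y) * partial a (\<lambda>z. (s *\<^sub>R z) $ b) y)"
      by (rule partial_chain[where g = "\<lambda>z. s *\<^sub>R z"]) (simp_all add: nth \<phi>)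
    also have "\<dots> = s * partial a \<phi> (s *\<^sub>R y)"
      by (simp add: partial_cmult[OF nth] partial_nth if_distrib cong: if_cong)
    finally show ?thesis ..
  qed
  also have "\<dots> = partial a (\<lambda>z. s ^ Suc k * \<phi> z) y"
    by (rule partial_cong_open[OF S hom])
  also have "\<dots> = s ^ Suc k * partial a \<phi> y" by (rule partial_cmult[OF \<phi>(2)])
  finally show ?thesis using s by simp
qed

section \<open>Sums, traces and frames\<close>

lemma sum_swap4: "(\<Sum>a\<in>A. \<Sum>b\<in>B. \<Sum>c\<in>C. \<Sum>d\<in>D. g a b c d) = (\<Sum>c\<in>C. \<Sum>d\<in>D. \<Sum>a\<in>A. \<Sum>b\<in>B. g a b c d)"
proof -
  have "(\<Sum>a\<in>A. \<Sum>b\<in>B. \<Sum>c\<in>C. \<Sum>d\<in>D. g a b c d) = (\<Sum>a\<in>A. \<Sum>c\<in>C. \<Sum>b\<in>B. \<Sum>d\<in>D. g a b c d)"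
    by (rule sum.cong[OF refl], rule sum.swap)
  also have "\<dots> = (\<Sum>c\<in>C. \<Sum>a\<in>A. \<Sum>b\<in>B. \<Sum>d\<in>D. g a b c d)"
    by (rule sum.swap)
  also have "\<dots> = (\<Sum>c\<in>C. \<Sum>a\<in>A. \<Sum>d\<in>D. \<Sum>b\<in>B. g a b c d)"
    by (rule sum.cong[OF refl], rule sum.cong[OF refl], rule sum.swap)
  also have "\<dots> = (\<Sum>c\<in>C. \<Sum>d\<in>D. \<Sum>a\<in>A. \<Sum>b\<in>B. g a b c d)"
    by (rule sum.cong[OF refl], rule sum.swap)
  finally show ?thesis .
qed

lemma trace_scaleR: "trace (c *\<^sub>R A) = c * trace (A :: real^'n^'n)"
  by (simp add: trace_def sum_distrib_left)

lemma trace_mult_sum: "trace (A ** B) = (\<^bold>\<Sum>i j. A $ i $ j * (B :: real^'n^'k) $ j $ i)"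
  by (simp add: trace_def matrix_matrix_mult_def)

lemma matrix_sub_rdistrib: "(A - B) ** C = A ** C - B ** (C :: real^'k^'n)"
  by (simp add: matrix_matrix_mult_def vec_eq_iff sum_subtractf left_diff_distrib)

lemma sum_product22:
  fixes X Y :: "'i \<Rightarrow> 'i \<Rightarrow> real"
  shows "(\<Sum>j\<in>A. \<Sum>a\<in>A. \<Sum>p\<in>A. \<Sum>b\<in>A. X j a * Y p b) = (\<Sum>j\<in>A. \<Sum>a\<in>A. X j a) * (\<Sum>p\<in>A. \<Sum>b\<in>A. Y p b)"
  by (simp only: sum_distrib_right) (simp only: sum_distrib_left)

lemma sum_product21:
  fixes X :: "'i \<Rightarrow> 'i \<Rightarrow> real"
  shows "(\<Sum>j\<in>A. \<Sum>a\<in>A. \<Sum>p\<in>A. X j a * Y p) = (\<Sum>j\<in>A. \<Sum>a\<in>A. X j a) * (\<Sum>p\<in>A. Y p)"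
  by (simp only: sum_distrib_right) (simp only: sum_distrib_left)

lemma sum_product12:
  fixes Y :: "'i \<Rightarrow> 'i \<Rightarrow> real"
  shows "(\<Sum>a\<in>A. \<Sum>p\<in>A. \<Sum>b\<in>A. X a * Y p b) = (\<Sum>a\<in>A. X a) * (\<Sum>p\<in>A. \<Sum>b\<in>A. Y p b)"
  by (simp only: sum_distrib_right) (simp only: sum_distrib_left)

lemma sum_product11:
  fixes X Y :: "'i \<Rightarrow> real"
  shows "(\<Sum>a\<in>A. \<Sum>b\<in>A. X a * Y b) = (\<Sum>a\<in>A. X a) * (\<Sum>b\<in>A. Y b)"
  by (simp only: sum_distrib_right) (simp only: sum_distrib_left)

lemma sum6_tuple:
  fixes g :: "'m::finite \<Rightarrow> 'm \<Rightarrow> 'm \<Rightarrow> 'm \<Rightarrow> 'm \<Rightarrow> 'm \<Rightarrow> real"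
  shows "(\<^bold>\<Sum>j k p n a b. g j k p n a b)
    = (\<^bold>\<Sum>z. case z of (j, k, p, n, a, b) \<Rightarrow> g j k p n a b)"
  by (simp add: sum.cartesian_product case_prod_beta)

text \<open>As a sum over sextuples each equation is a reindexing by a permutation. Every order puts
  in front the indices that survive a contraction and groups the others by the structure coefficient
  they belong to, so that the inner sum factorises; there is one order for each type of contraction
  in the quadratic part.\<close>

lemma sum6_perm:
  fixes g :: "'m::finite \<Rightarrow> 'm \<Rightarrow> 'm \<Rightarrow> 'm \<Rightarrow> 'm \<Rightarrow> 'm \<Rightarrow> real"
  shows "(\<^bold>\<Sum>j k p n a b. g j k p n a b)
    = (\<^bold>\<Sum>k n j a p b. g j k p n a b)" (is "?S = ?A")
  and "(\<^bold>\<Sum>j k p n a b. g j k p n a b)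
    = (\<^bold>\<Sum>k p j a n b. g j k p n a b)" (is "?S = ?B")
  and "(\<^bold>\<Sum>j k p n a b. g j k p n a b)
    = (\<^bold>\<Sum>a k b n j p. g j k p n a b)" (is "?S = ?C")
  and "(\<^bold>\<Sum>j k p n a b. g j k p n a b)
    = (\<^bold>\<Sum>b n k j a p. g j k p n a b)" (is "?S = ?D")
  and "(\<^bold>\<Sum>j k p n a b. g j k p n a b)
    = (\<^bold>\<Sum>j k n a p b. g j k p n a b)" (is "?S = ?E")
proof -
  show "?S = ?A" unfolding sum6_tuple
    by (rule sum.reindex_bij_witness[where i = "\<lambda>(k, n, j, a, p, b). (j, k, p, n, a, b)" and j = "\<lambda>(j, k, p, n, a, b). (k, n, j, a, p, b)"]) auto
  show "?S = ?B" unfolding sum6_tuple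
    by (rule sum.reindex_bij_witness[where i = "\<lambda>(k, p, j, a, n, b). (j, k, p, n, a, b)" and j = "\<lambda>(j, k, p, n, a, b). (k, p, j, a, n, b)"]) auto
  show "?S = ?C" unfolding sum6_tuple
    by (rule sum.reindex_bij_witness[where i = "\<lambda>(a, k, b, n, j, p). (j, k, p, n, a, b)" and j = "\<lambda>(j, k, p, n, a, b). (a, k, b, n, j, p)"]) auto
  show "?S = ?D" unfolding sum6_tuple
    by (rule sum.reindex_bij_witness[where i = "\<lambda>(b, n, k, j, a, p). (j, k, p, n, a, b)" and j = "\<lambda>(j, k, p, n, a, b). (b, n, k, j, a, p)"]) auto
  show "?S = ?E" unfolding sum6_tuple
    by (rule sum.reindex_bij_witness[where i = "\<lambda>(j, k, n, a, p, b). (j, k, p, n, a, b)" and j = "\<lambda>(j, k, p, n, a, b). (j, k, n, a, p, b)"]) auto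
qed

lemma trace_transpose: "trace (transpose A) = trace (A :: real^'n^'n)"
  by (simp add: trace_def transpose_def)

lemma matrix_neg_mult: "(- A) ** B = - (A ** (B :: real^'k^'n))" "A ** (- B) = - (A ** (B :: real^'k^'n))"
  by (simp_all add: matrix_matrix_mult_def vec_eq_iff sum_negf)

lemma trace_neg: "trace (- A) = - trace (A :: real^'n^'n)"
  by (simp add: trace_def sum_negf)

lemma matrix_scaleR_mult: "(c *\<^sub>R A) ** B = c *\<^sub>R (A ** (B :: real^'k^'n))" "A ** (c *\<^sub>R B) = c *\<^sub>R (A ** (B :: real^'k^'n))"
  by (simp_all add: matrix_matrix_mult_def vec_eq_iff sum_distrib_left mult_ac)

text \<open>The upper indices i and l occur only in the two coefficients and their metric factors.
  Summing over them first lowers both coefficients and leaves six indices.\<close>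

lemma contract8:
  fixes c :: "'m::finite \<Rightarrow> 'm \<Rightarrow> 'm \<Rightarrow> real"
  shows "(\<^bold>\<Sum>i j k l p n a b. c i j k * c l p n * g i a * g l b * T j k p n a b)
    = (\<^bold>\<Sum>j k p n a b. (\<^bold>\<Sum>i. g i a * c i j k) * (\<^bold>\<Sum>l. g l b * c l p n) * T j k p n a b)"
proof -
  let ?t = "\<lambda>i j k l p n a b. c i j k * c l p n * g i a * g l b * T j k p n a b"
  have "(\<^bold>\<Sum>i j k l p n a b. ?t i j k l p n a b)
    = (\<^bold>\<Sum>j i k l p n a b. ?t i j k l p n a b)"
    by (rule sum.swap)
  also have "\<dots> = (\<^bold>\<Sum>j k i l p n a b. ?t i j k l p n a b)"
    by (rule sum.cong[OF refl], rule sum.swap)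
  also have "\<dots> = (\<^bold>\<Sum>j k p n i l a b. ?t i j k l p n a b)"
    by (rule sum.cong[OF refl], rule sum.cong[OF refl], rule sum_swap4)
  also have "\<dots> = (\<^bold>\<Sum>j k p n a b i l. ?t i j k l p n a b)"
    by (rule sum.cong[OF refl], rule sum.cong[OF refl], rule sum.cong[OF refl], rule sum.cong[OF refl], rule sum_swap4)
  also have "\<dots> = (\<^bold>\<Sum>j k p n a b i l. (g i a * c i j k) * (g l b * c l p n * T j k p n a b))"
    by (simp add: mult_ac)
  also have "\<dots> = (\<^bold>\<Sum>j k p n a b. (\<^bold>\<Sum>i. g i a * c i j k) * ((\<^bold>\<Sum>l. g l b * c l p n) * T j k p n a b))"
    by (simp only: sum_product11 sum_distrib_right[symmetric])
  also have "\<dots> = (\<^bold>\<Sum>j k p n a b. (\<^bold>\<Sum>i. g i a * c i j k) * (\<^bold>\<Sum>l. g l b * c l p n) * T j k p n a b)"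
    by (simp only: mult.assoc)
  finally show ?thesis .
qed

section \<open>Coefficients with respect to a basis or frame\<close>

lemma representation_family:
  fixes b :: "'i::finite \<Rightarrow> 'v::real_vector"
  assumes "inj b" "independent (range b)"
  shows "representation (range b) (\<^bold>\<Sum>i. r i *\<^sub>R b i) (b a) = r a"
proof -
  have b: "b i \<in> span (range b)" for i by (simp add: span_base)
  have "representation (range b) (\<^bold>\<Sum>i. r i *\<^sub>R b i) (b a) = (\<^bold>\<Sum>i. r i * representation (range b) (b i) (b a))"
    by (simp add: representation_sum representation_scale assms b span_scale)
  also have "\<dots> = (\<^bold>\<Sum>i. if i = a then r i else 0)"
    by (rule sum.cong) (auto simp: representation_basis assms dest: injD[OF assms(1)])
  finally show ?thesis by simp
qed

lemma representation_family_expand: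
  fixes b :: "'i::finite \<Rightarrow> 'v::real_vector"
  assumes "inj b" "independent (range b)" "v \<in> span (range b)"
  shows "(\<^bold>\<Sum>i. representation (range b) v (b i) *\<^sub>R b i) = v"
proof -
  have "(\<^bold>\<Sum>i. representation (range b) v (b i) *\<^sub>R b i) = (\<Sum>w\<in>range b. representation (range b) v w *\<^sub>R w)"
    by (simp add: sum.reindex assms(1))
  also have "\<dots> = v" by (rule sum_representation_eq) (use assms in auto)
  finally show ?thesis .
qed

text \<open>The columns are the images of the standard basis under an injective linear map, hence
  independent, and M r is their combination with coefficients r.\<close>

lemma frame_coord_column:
  fixes M :: "real^'m::finite^'m"
  assumes "invertible M"
  shows "frame_coord (\<lambda>i. column i M) (M *v r) a = r $ a"
proof -
  have c: "column i M = M *v axis i 1" for i by (simp add: matrix_vector_mult_basis)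
  have inj: "inj ((*v) M)" using assms by (metis injI matrix_inv_matrix_vector(1))
  have ii: "inj (\<lambda>i. column i M)"
    using inj by (auto intro!: injI simp: c inj_eq axis_eq_axis)
  have "independent ((*v) M ` range (\<lambda>i. axis i 1))"
  proof (rule linear_independent_injective_image)
    have "range (\<lambda>i. axis i (1::real)) \<subseteq> (Basis :: (real^'m) set)" by (auto simp: Basis_vec_def)
    then show "independent (range (\<lambda>i. axis i (1::real)) :: (real^'m) set)"
      using independent_Basis independent_mono by blast
  qed (use inj in \<open>auto intro: inj_on_subset\<close>)
  moreover have "(*v) M ` range (\<lambda>i. axis i 1) = range (\<lambda>i. column i M)" by (auto simp: c)
  ultimately have "independent (range (\<lambda>i. column i M))" by simp
  moreover have "M *v r = (\<^bold>\<Sum>i. r $ i *\<^sub>R column i M)"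
    by (simp add: matrix_mult_sum scalar_mult_eq_scaleR)
  ultimately show ?thesis
    unfolding frame_coord_def using representation_family[OF ii, of "($) r" a] by simp
qed

section \<open>The spray and the non-linear connection in a frame\<close>

text \<open>What remains of the geometry in one chart: W is a coordinate domain,
  \<open>\<omega>\<close> the cone and \<open>f\<close> the function L in the chosen basis,
  \<open>\<epsilon> x\<close> the matrix of \<phi>, and F the local expression of the Finsler
  function. \<open>F_eq\<close> speaks about the cone only; the cone is open, so this determines all
  derivatives of F there.\<close>

locale frame_model =
  fixes W \<omega> :: "(real^'m::finite) set"
    and \<epsilon> :: "real^'m \<Rightarrow> real^'m^'m"
    and f :: "real^'m \<Rightarrow> real"
    and F :: "real^'m \<Rightarrow> real^'m \<Rightarrow> real"
  assumes open_W: "open W"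
    and cone: "open_cone \<omega>"
    and f_Ck: "Ck_on 4 f \<omega>"
    and f_hom: "\<And>y s. y \<in> \<omega> \<Longrightarrow> s > 0 \<Longrightarrow> f (s *\<^sub>R y) = s\<^sup>2 * f y"
    and nondeg: "\<And>y. y \<in> \<omega> \<Longrightarrow> invertible (metric_mat f y)"
    and coframe_Ck: "\<And>a \<nu>. Ck_on 2 (\<lambda>x. \<epsilon> x $ a $ \<nu>) W"
    and coframe_inv: "\<And>x. x \<in> W \<Longrightarrow> invertible (\<epsilon> x)"
    and F_eq: "\<And>x y. x \<in> W \<Longrightarrow> \<epsilon> x *v y \<in> \<omega> \<Longrightarrow> F x y = f (\<epsilon> x *v y)"
begin

text \<open>
  \<open>\<epsilon> x $ a $ \<nu>\<close> is \<open>e\<^sup>a\<^sub>\<nu>\<close>, \<open>frm x $ \<mu> $ a\<close> is \<open>e\<^sup>\<mu>\<^sub>a\<close>,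
  \<open>dcof \<rho> a \<nu>\<close> is \<open>\<partial>\<^sub>\<rho> e\<^sup>a\<^sub>\<nu>\<close> and \<open>strc i j k\<close> is \<open>c\<^sup>i\<^sub>j\<^sub>k\<close>.
  \<open>acc\<close>, \<open>Hv\<close> and \<open>Hm\<close> are \<open>v\<^sup>a\<close>, \<open>H\<^sup>a\<close> and \<open>\<partial>\<^sub>b H\<^sup>a\<close>; \<open>H\<^sup>a\<close> is \<open>tens (HC a)\<close> and \<open>J\<close> is \<open>tens JC\<close>.
  Both are written with \<open>tens\<close> so that the dependence on \<open>\<eta>\<close> (in \<open>\<Phi>\<close>)
  and on \<open>x\<close> (in \<open>c\<^sup>i\<^sub>d\<^sub>k\<close>) can be differentiated separately.
\<close>

definition frm :: "real^'m \<Rightarrow> real^'m^'m" where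
  "frm x = matrix_inv (\<epsilon> x)"

definition dcof :: "'m \<Rightarrow> 'm \<Rightarrow> 'm \<Rightarrow> real^'m \<Rightarrow> real" where
  "dcof \<rho> a \<nu> = partial \<rho> (\<lambda>x. \<epsilon> x $ a $ \<nu>)"

definition strc :: "'m \<Rightarrow> 'm \<Rightarrow> 'm \<Rightarrow> real^'m \<Rightarrow> real" where
  "strc i j k x = (\<^bold>\<Sum>\<rho> \<nu>. frm x $ \<rho> $ j * frm x $ \<nu> $ k * (dcof \<nu> i \<rho> x - dcof \<rho> i \<nu> x))"

text \<open>\<open>DX\<close> and \<open>DZ\<close> are the two contractions of the coframe
  derivative with y. \<open>DX x y\<close> is the derivative of \<open>\<epsilon> x *v y\<close> in
  x at fixed y, \<open>DZ x y\<close> the derivative of \<epsilon> along y. They agree when applied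
  to y, and their difference is the structure coefficient contracted with \<eta>
  (\<open>acc_eq\<close>, \<open>Wm_eq\<close>).\<close>

definition DX :: "real^'m \<Rightarrow> real^'m \<Rightarrow> real^'m^'m" where
  "DX x y = (\<chi> a \<rho>. \<^bold>\<Sum>\<nu>. dcof \<rho> a \<nu> x * y $ \<nu>)"

definition DZ :: "real^'m \<Rightarrow> real^'m \<Rightarrow> real^'m^'m" where
  "DZ x y = (\<chi> a \<nu>. \<^bold>\<Sum>\<rho>. dcof \<rho> a \<nu> x * y $ \<rho>)"

definition acc :: "real^'m \<Rightarrow> real^'m \<Rightarrow> real^'m" where
  "acc x y = DX x y *v y"

definition Wm :: "real^'m \<Rightarrow> real^'m \<Rightarrow> real^'m^'m" where
  "Wm x \<eta> = (\<chi> i d. \<^bold>\<Sum>k. strc i d k x * \<eta> $ k)"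

definition gradf :: "real^'m \<Rightarrow> real^'m" where
  "gradf \<eta> = (\<chi> i. partial i f \<eta>)"

abbreviation gm :: "real^'m \<Rightarrow> real^'m^'m" where "gm \<equiv> metric_mat f"
abbreviation hm :: "real^'m \<Rightarrow> real^'m^'m" where "hm \<equiv> metric_inv f"

definition tens :: "('m \<Rightarrow> 'm \<Rightarrow> 'm \<Rightarrow> real^'m \<Rightarrow> real) \<Rightarrow> real^'m \<Rightarrow> real^'m \<Rightarrow> real" where
  "tens \<Phi> x \<eta> = (\<^bold>\<Sum>d i k. \<Phi> d i k \<eta> * strc i d k x)"

definition HC :: "'m \<Rightarrow> 'm \<Rightarrow> 'm \<Rightarrow> 'm \<Rightarrow> real^'m \<Rightarrow> real" where
  "HC a d i k \<eta> = hm \<eta> $ a $ d * partial i f \<eta> * \<eta> $ k"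

definition JC :: "'m \<Rightarrow> 'm \<Rightarrow> 'm \<Rightarrow> real^'m \<Rightarrow> real" where
  "JC d i k \<eta> = mean_cartan_up f d \<eta> * partial i f \<eta> * \<eta> $ k"

definition Hv :: "real^'m \<Rightarrow> real^'m \<Rightarrow> real^'m" where
  "Hv x \<eta> = (\<chi> a. tens (HC a) x \<eta>)"

definition Hm :: "real^'m \<Rightarrow> real^'m \<Rightarrow> real^'m^'m" where
  "Hm x \<eta> = (\<chi> a b. partial b (tens (HC a) x) \<eta>)"

text \<open>\<open>dom_x\<close> and \<open>dom_y\<close> are the slices of the domain of F at fixed
  y and at fixed x. Both are open, so identities valid on them may be differentiated in one
  variable.\<close>

definition dom_x :: "real^'m \<Rightarrow> (real^'m) set" where
  "dom_x y = {x \<in> W. \<epsilon> x *v y \<in> \<omega>}"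

definition dom_y :: "real^'m \<Rightarrow> (real^'m) set" where
  "dom_y x = {y. \<epsilon> x *v y \<in> \<omega>}"

section \<open>Regularity of the coframe, the metric and the coefficient functions\<close>

lemma open_cone_dom: "open \<omega>"
  using cone by (simp add: open_cone_def)

lemma frm_cof: "x \<in> W \<Longrightarrow> frm x ** \<epsilon> x = mat 1" "x \<in> W \<Longrightarrow> \<epsilon> x ** frm x = mat 1"
  by (simp_all add: frm_def matrix_inv_mult coframe_inv)

lemma frm_cof_vec: "x \<in> W \<Longrightarrow> frm x *v (\<epsilon> x *v y) = y"
  by (simp add: matrix_vector_mul_assoc frm_cof)

lemma hm_gm: "\<eta> \<in> \<omega> \<Longrightarrow> hm \<eta> ** gm \<eta> = mat 1" "\<eta> \<in> \<omega> \<Longrightarrow> gm \<eta> ** hm \<eta> = mat 1"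
  by (simp_all add: metric_inv_def matrix_inv_mult nondeg)

lemma coframe_Ck_le: "n \<le> 2 \<Longrightarrow> Ck_on n (\<lambda>x. \<epsilon> x $ a $ \<nu>) W"
  using Ck_on_le[OF coframe_Ck] .

lemma frm_Ck: "Ck_on 2 (\<lambda>x. frm x $ \<mu> $ a) W"
  unfolding frm_def by (rule Ck_on_matrix_inv[OF open_W coframe_Ck coframe_inv])

lemma dcof_Ck: "Ck_on 1 (dcof \<rho> a \<nu>) W"
  unfolding dcof_def by (rule Ck_on_partial'[OF open_W coframe_Ck]) simp

lemma strc_Ck: "Ck_on 1 (strc i j k) W"
  unfolding strc_def
  by (intro Ck_on_sum Ck_on_mult Ck_on_diff open_W dcof_Ck Ck_on_le[OF frm_Ck]) simp_all

lemma fd_Ck: "Ck_on 3 (partial a f) \<omega>"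
  by (rule Ck_on_partial'[OF open_cone_dom f_Ck]) simp

lemma fdd_Ck: "Ck_on 2 (partial a (partial b f)) \<omega>"
  by (rule Ck_on_partial'[OF open_cone_dom fd_Ck]) simp

lemma fddd_Ck: "Ck_on 1 (partial a (partial b (partial c f))) \<omega>"
  by (rule Ck_on_partial'[OF open_cone_dom fdd_Ck]) simp

lemma gm_Ck: "Ck_on 2 (\<lambda>\<eta>. gm \<eta> $ a $ b) \<omega>"
  using fdd_Ck by (simp add: metric_mat_def)

lemma hm_Ck: "Ck_on 2 (\<lambda>\<eta>. hm \<eta> $ a $ b) \<omega>"
  unfolding metric_inv_def by (rule Ck_on_matrix_inv[OF open_cone_dom gm_Ck nondeg])

lemma cartan_Ck: "Ck_on 1 (cartan f a b c) \<omega>"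
  unfolding cartan_def by (intro Ck_on_mult Ck_on_const fddd_Ck open_cone_dom)

lemma mean_cartan_up_Ck: "Ck_on 1 (mean_cartan_up f a) \<omega>"
  unfolding mean_cartan_up_def mean_cartan_def
  by (intro Ck_on_sum Ck_on_mult Ck_on_le[OF hm_Ck] cartan_Ck open_cone_dom) simp_all

lemma HC_Ck: "Ck_on 2 (HC a d i k) \<omega>"
  unfolding HC_def
  by (intro Ck_on_mult hm_Ck Ck_on_le[OF fd_Ck] Ck_on_nth open_cone_dom) simp

lemma JC_Ck: "Ck_on 1 (JC d i k) \<omega>"
  unfolding JC_def
  by (intro Ck_on_mult mean_cartan_up_Ck Ck_on_le[OF fd_Ck] Ck_on_nth open_cone_dom) simp

lemma pHC_Ck: "Ck_on 1 (partial b (HC a d i k)) \<omega>"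
  by (rule Ck_on_partial'[OF open_cone_dom HC_Ck]) simp

lemma W_diff:
  assumes "x \<in> W"
  shows "(\<lambda>x. \<epsilon> x $ a $ \<nu>) differentiable (at x)" "(\<lambda>x. frm x $ a $ \<nu>) differentiable (at x)"
    "dcof \<rho> a \<nu> differentiable (at x)" "strc i j k differentiable (at x)"
  using assms by (auto intro: Ck_on_imp_differentiable[OF coframe_Ck] Ck_on_imp_differentiable[OF frm_Ck]
      Ck_on_imp_differentiable[OF dcof_Ck] Ck_on_imp_differentiable[OF strc_Ck])

lemma cone_diff:
  assumes "\<eta> \<in> \<omega>"
  shows "f differentiable (at \<eta>)" "partial a f differentiable (at \<eta>)"
    "partial a (partial b f) differentiable (at \<eta>)" "(\<lambda>\<eta>. hm \<eta> $ a $ b) differentiable (at \<eta>)"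
    "mean_cartan_up f a differentiable (at \<eta>)"
    "HC a d i k differentiable (at \<eta>)" "JC d i k differentiable (at \<eta>)"
    "partial b (HC a d i k) differentiable (at \<eta>)"
  using assms by (auto intro: Ck_on_imp_differentiable[OF f_Ck] Ck_on_imp_differentiable[OF fd_Ck]
      Ck_on_imp_differentiable[OF fdd_Ck] Ck_on_imp_differentiable[OF hm_Ck]
      Ck_on_imp_differentiable[OF mean_cartan_up_Ck] Ck_on_imp_differentiable[OF HC_Ck]
      Ck_on_imp_differentiable[OF JC_Ck] Ck_on_imp_differentiable[OF pHC_Ck])

lemma nth_diff: "(\<lambda>x::real^'m. x $ b) differentiable (at y)"
  by (rule bounded_linear_imp_differentiable) (rule bounded_linear_vec_nth)

section \<open>The chain rule through \<open>\<epsilon> x *v y\<close>\<close>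

lemma cof_vec_diff_x: "x \<in> W \<Longrightarrow> (\<lambda>x. (\<epsilon> x *v y) $ a) differentiable (at x)"
  by (simp add: matrix_vector_mult_def W_diff)

lemma cof_vec_diff_y: "(\<lambda>y. (\<epsilon> x *v y) $ a) differentiable (at y)"
  by (simp add: matrix_vector_mult_def nth_diff)

lemma open_dom_x: "open (dom_x y)"
proof -
  have "continuous_on W (\<lambda>x. \<epsilon> x *v y)"
    unfolding continuous_on_componentwise[where f = "\<lambda>x. \<epsilon> x *v y"]
    by (auto simp: Basis_vec_def inner_axis matrix_vector_mult_def
        intro!: continuous_on_sum continuous_on_mult Ck_on_imp_continuous_on[OF coframe_Ck] continuous_on_const)
  moreover have "dom_x y = W \<inter> (\<lambda>x. \<epsilon> x *v y) -` \<omega>"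
    by (auto simp: dom_x_def)
  ultimately show ?thesis by (simp add: continuous_open_preimage open_W open_cone_dom)
qed

lemma open_dom_y: "open (dom_y x)"
proof -
  have "dom_y x = (*v) (\<epsilon> x) -` \<omega>" by (auto simp: dom_y_def)
  moreover have "isCont ((*v) (\<epsilon> x)) y" for y
    by (rule linear_continuous_at) (rule matrix_vector_mul_bounded_linear)
  ultimately show ?thesis by (simp add: continuous_open_vimage open_cone_dom)
qed

lemma partial_cof_vec_x:
  "x \<in> W \<Longrightarrow> partial \<mu> (\<lambda>x. (\<epsilon> x *v y) $ b) x = DX x y $ b $ \<mu>"
  by (simp add: matrix_vector_mult_def partial_sum partial_multc W_diff DX_def dcof_def)

lemma partial_cof_vec_y: "partial \<mu> (\<lambda>y. (\<epsilon> x *v y) $ b) y = \<epsilon> x $ b $ \<mu>"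
  by (simp add: matrix_vector_mult_def partial_sum partial_cmult nth_diff partial_nth if_distrib cong: if_cong)

lemma comp_x:
  assumes "x \<in> W" "\<phi> differentiable (at (\<epsilon> x *v y))"
  shows "(\<lambda>x. \<phi> (\<epsilon> x *v y)) differentiable (at x)"
    "partial \<mu> (\<lambda>x. \<phi> (\<epsilon> x *v y)) x = (\<^bold>\<Sum>b. partial b \<phi> (\<epsilon> x *v y) * DX x y $ b $ \<mu>)"
proof -
  show "(\<lambda>x. \<phi> (\<epsilon> x *v y)) differentiable (at x)"
    by (rule differentiable_comp_vec[where g = "\<lambda>x. \<epsilon> x *v y"]) (use assms cof_vec_diff_x in auto)
  show "partial \<mu> (\<lambda>x. \<phi> (\<epsilon> x *v y)) x = (\<^bold>\<Sum>b. partial b \<phi> (\<epsilon> x *v y) * DX x y $ b $ \<mu>)"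
    using partial_chain[where g = "\<lambda>x. \<epsilon> x *v y", OF assms(2) cof_vec_diff_x[OF assms(1)]]
    by (simp add: partial_cof_vec_x assms(1))
qed

lemma comp_y:
  assumes "\<phi> differentiable (at (\<epsilon> x *v y))"
  shows "(\<lambda>y. \<phi> (\<epsilon> x *v y)) differentiable (at y)"
    "partial \<mu> (\<lambda>y. \<phi> (\<epsilon> x *v y)) y = (\<^bold>\<Sum>b. partial b \<phi> (\<epsilon> x *v y) * \<epsilon> x $ b $ \<mu>)"
proof -
  show "(\<lambda>y. \<phi> (\<epsilon> x *v y)) differentiable (at y)"
    by (rule differentiable_comp_vec[where g = "\<lambda>y. \<epsilon> x *v y"]) (use assms cof_vec_diff_y in auto)
  show "partial \<mu> (\<lambda>y. \<phi> (\<epsilon> x *v y)) y = (\<^bold>\<Sum>b. partial b \<phi> (\<epsilon> x *v y) * \<epsilon> x $ b $ \<mu>)"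
    using partial_chain[where g = "\<lambda>y. \<epsilon> x *v y", OF assms cof_vec_diff_y]
    by (simp add: partial_cof_vec_y)
qed

lemma tens_diff: "(\<And>d i k. \<Phi> d i k differentiable (at \<eta>)) \<Longrightarrow> tens \<Phi> x differentiable (at \<eta>)"
  unfolding tens_def by (simp add: differentiable_sum)

lemma partial_tens:
  assumes "\<And>d i k. \<Phi> d i k differentiable (at \<eta>)"
  shows "partial b (tens \<Phi> x) \<eta> = tens (\<lambda>d i k. partial b (\<Phi> d i k)) x \<eta>"
  unfolding tens_def by (simp add: partial_sum partial_multc assms)

lemma tens_comp_y:
  assumes "\<And>d i k. \<Phi> d i k differentiable (at (\<epsilon> x *v y))"
  shows "(\<lambda>y. tens \<Phi> x (\<epsilon> x *v y)) differentiable (at y)"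
    "partial \<mu> (\<lambda>y. tens \<Phi> x (\<epsilon> x *v y)) y = (\<^bold>\<Sum>b. partial b (tens \<Phi> x) (\<epsilon> x *v y) * \<epsilon> x $ b $ \<mu>)"
  by (rule comp_y[OF tens_diff[OF assms]])+

text \<open>The point x acts in two places: directly through \<open>strc\<close>, and through \<eta>
  inside \<open>\<Phi>\<close>. The second contribution is the derivative with the structure
  coefficients frozen at \<open>x\<close>, to which the chain rule \<open>comp_x\<close>
  applies.\<close>

lemma tens_comp_x:
  assumes x: "x \<in> W" and \<Phi>: "\<And>d i k. \<Phi> d i k differentiable (at (\<epsilon> x *v y))"
  shows "(\<lambda>x. tens \<Phi> x (\<epsilon> x *v y)) differentiable (at x)"
    "partial \<mu> (\<lambda>x. tens \<Phi> x (\<epsilon> x *v y)) x =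
      (\<^bold>\<Sum>d i k. \<Phi> d i k (\<epsilon> x *v y) * partial \<mu> (strc i d k) x)
      + (\<^bold>\<Sum>b. partial b (tens \<Phi> x) (\<epsilon> x *v y) * DX x y $ b $ \<mu>)"
proof -
  have d: "(\<lambda>x. \<Phi> d i k (\<epsilon> x *v y)) differentiable (at x)" for d i k
    by (rule comp_x(1)[OF x \<Phi>])
  show "(\<lambda>x. tens \<Phi> x (\<epsilon> x *v y)) differentiable (at x)"
    unfolding tens_def by (simp add: d W_diff[OF x])
  have "(\<^bold>\<Sum>b. partial b (tens \<Phi> x) (\<epsilon> x *v y) * DX x y $ b $ \<mu>)
    = partial \<mu> (\<lambda>z. tens \<Phi> x (\<epsilon> z *v y)) x"
    by (rule comp_x(2)[OF x tens_diff[OF \<Phi>], symmetric])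
  also have "\<dots> = (\<^bold>\<Sum>d i k. partial \<mu> (\<lambda>z. \<Phi> d i k (\<epsilon> z *v y)) x * strc i d k x)"
    unfolding tens_def by (simp add: partial_sum partial_multc d)
  finally show "partial \<mu> (\<lambda>x. tens \<Phi> x (\<epsilon> x *v y)) x =
      (\<^bold>\<Sum>d i k. \<Phi> d i k (\<epsilon> x *v y) * partial \<mu> (strc i d k) x)
      + (\<^bold>\<Sum>b. partial b (tens \<Phi> x) (\<epsilon> x *v y) * DX x y $ b $ \<mu>)"
    by (simp add: tens_def partial_sum partial_mult d W_diff[OF x] sum.distrib add.commute)
qed

lemma gm_sym: "\<eta> \<in> \<omega> \<Longrightarrow> transpose (gm \<eta>) = gm \<eta>"
  unfolding transpose_def metric_mat_def
  by (simp add: vec_eq_iff partial_commute[OF open_cone_dom _ Ck_on_le[OF f_Ck]])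

lemma hm_sym:
  assumes "\<eta> \<in> \<omega>"
  shows "transpose (hm \<eta>) = hm \<eta>"
proof -
  have "gm \<eta> ** transpose (hm \<eta>) = mat 1"
    using hm_gm(1)[OF assms] by (metis gm_sym[OF assms] matrix_transpose_mul transpose_mat)
  from matrix_inv_eqI[OF this] show ?thesis by (simp add: metric_inv_def)
qed

text \<open>One of the two frame factors in c^i_dk meets \<eta> = \<epsilon> y and turns it back
  into y, so only the antisymmetrised coframe derivative and one frame factor remain. This lets the
  later computations run with matrices.\<close>

lemma Wm_eq:
  assumes "x \<in> W"
  shows "Wm x (\<epsilon> x *v y) = (DZ x y - DX x y) ** frm x"
proof -
  have "Wm x (\<epsilon> x *v y) $ i $ d = ((DZ x y - DX x y) ** frm x) $ i $ d" for i d
  proof -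
    have "Wm x (\<epsilon> x *v y) $ i $ d
      = (\<^bold>\<Sum>k \<rho> \<nu>. frm x $ \<rho> $ d * (dcof \<nu> i \<rho> x - dcof \<rho> i \<nu> x) * (frm x $ \<nu> $ k * (\<epsilon> x *v y) $ k))"
      by (simp add: Wm_def strc_def sum_distrib_right sum_distrib_left mult_ac)
    also have "\<dots> = (\<^bold>\<Sum>\<rho> \<nu> k. frm x $ \<rho> $ d * (dcof \<nu> i \<rho> x - dcof \<rho> i \<nu> x) * (frm x $ \<nu> $ k * (\<epsilon> x *v y) $ k))"
      by (subst sum.swap, rule sum.cong[OF refl], subst sum.swap, rule refl)
    also have "\<dots> = (\<^bold>\<Sum>\<rho> \<nu>. frm x $ \<rho> $ d * (dcof \<nu> i \<rho> x - dcof \<rho> i \<nu> x) * (frm x *v (\<epsilon> x *v y)) $ \<nu>)"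
      by (simp add: sum_distrib_left[symmetric] matrix_vector_mult_def[of "frm x"])
    also have "\<dots> = ((DZ x y - DX x y) ** frm x) $ i $ d"
      by (simp add: frm_cof_vec[OF assms] DZ_def DX_def matrix_matrix_mult_def sum_distrib_right sum_distrib_left
          sum_subtractf[symmetric] algebra_simps)
    finally show ?thesis .
  qed
  then show ?thesis by (simp add: vec_eq_iff)
qed

lemma tens_split: "tens (\<lambda>d i k \<eta>. p d \<eta> * partial i f \<eta> * \<eta> $ k) x \<eta> = (\<^bold>\<Sum>d. p d \<eta> * (transpose (Wm x \<eta>) *v gradf \<eta>) $ d)"
  by (simp add: tens_def Wm_def gradf_def transpose_def matrix_vector_mult_def sum_distrib_left sum_distrib_right mult_ac)

lemma Hv_eq: "Hv x \<eta> = hm \<eta> *v (transpose (Wm x \<eta>) *v gradf \<eta>)"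
proof -
  have "tens (HC a) x \<eta> = (\<^bold>\<Sum>d. hm \<eta> $ a $ d * (transpose (Wm x \<eta>) *v gradf \<eta>) $ d)" for a
    using tens_split[of "\<lambda>d \<eta>. hm \<eta> $ a $ d"] by (simp add: HC_def[abs_def])
  then show ?thesis by (simp add: Hv_def matrix_vector_mult_def[of "hm \<eta>"] vec_eq_iff)
qed

lemma acc_eq: "acc x y = DZ x y *v y"
proof -
  have "(DX x y *v y) $ a = (DZ x y *v y) $ a" for a
    unfolding DX_def DZ_def matrix_vector_mult_def
    by (simp add: sum_distrib_right) (subst sum.swap, simp add: mult_ac)
  then show ?thesis by (simp add: acc_def vec_eq_iff)
qed

section \<open>Coordinate metric and spray\<close>

lemma py_F:
  assumes "x \<in> W" "y \<in> dom_y x"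
  shows "py \<sigma> F x y = (\<^bold>\<Sum>a. partial a f (\<epsilon> x *v y) * \<epsilon> x $ a $ \<sigma>)"
proof -
  have "py \<sigma> F x y = partial \<sigma> (\<lambda>y. f (\<epsilon> x *v y)) y"
    unfolding py_def by (rule partial_cong_open[OF open_dom_y assms(2)]) (simp add: dom_y_def F_eq assms(1))
  then show ?thesis using assms by (simp add: comp_y cone_diff dom_y_def)
qed

lemma metric_mat_F:
  assumes "x \<in> W" "y \<in> dom_y x"
  shows "metric_mat (F x) y = transpose (\<epsilon> x) ** gm (\<epsilon> x *v y) ** \<epsilon> x"
proof -
  have "metric_mat (F x) y $ \<alpha> $ \<beta> = (transpose (\<epsilon> x) ** gm (\<epsilon> x *v y) ** \<epsilon> x) $ \<alpha> $ \<beta>" for \<alpha> \<beta>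
  proof -
    have \<eta>: "\<epsilon> x *v y \<in> \<omega>" using assms by (simp add: dom_y_def)
    have "metric_mat (F x) y $ \<alpha> $ \<beta> = partial \<alpha> (py \<beta> F x) y"
      by (simp add: metric_mat_def py_def[abs_def])
    also have "\<dots> = partial \<alpha> (\<lambda>y. \<^bold>\<Sum>a. partial a f (\<epsilon> x *v y) * \<epsilon> x $ a $ \<beta>) y"
      by (rule partial_cong_open[OF open_dom_y assms(2)]) (simp add: py_F assms(1))
    also have "\<dots> = (transpose (\<epsilon> x) ** gm (\<epsilon> x *v y) ** \<epsilon> x) $ \<alpha> $ \<beta>"
      by (simp add: partial_sum partial_multc comp_y cone_diff \<eta>)
         (simp add: metric_mat_def transpose_def matrix_matrix_mult_def mult_ac)
    finally show ?thesis .
  qed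
  then show ?thesis by (simp add: vec_eq_iff)
qed

lemma metric_inv_F:
  assumes "x \<in> W" "y \<in> dom_y x"
  shows "matrix_inv (metric_mat (F x) y) = frm x ** hm (\<epsilon> x *v y) ** transpose (frm x)"
proof (rule matrix_inv_eqI)
  have "transpose (\<epsilon> x) ** gm (\<epsilon> x *v y) ** \<epsilon> x ** (frm x ** hm (\<epsilon> x *v y) ** transpose (frm x))
    = transpose (\<epsilon> x) ** (gm (\<epsilon> x *v y) ** ((\<epsilon> x ** frm x) ** hm (\<epsilon> x *v y))) ** transpose (frm x)"
    by (simp only: matrix_mul_assoc)
  also have "\<dots> = transpose (frm x ** \<epsilon> x)"
    using assms by (simp add: frm_cof(2) hm_gm dom_y_def matrix_transpose_mul)
  finally show "metric_mat (F x) y ** (frm x ** hm (\<epsilon> x *v y) ** transpose (frm x)) = mat 1"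
    using assms by (simp add: metric_mat_F frm_cof transpose_mat)
qed

text \<open>Twice the lowered spray is the covector p. Differentiating the argument of the gradient
  of f along y gives \<epsilon>^T g v; the derivatives of \<epsilon> itself give (DZ - DX)^T applied
  to the gradient. Moved to the frame, the first loses \<epsilon> and the second becomes P by
  \<open>Wm_eq\<close>; raising the index with the metric of f yields v + H.\<close>

lemma spray_vec:
  assumes x: "x \<in> W" and y: "y \<in> dom_y x"
  shows "(\<chi> \<mu>. spray F \<mu> x y) = (1/2) *\<^sub>R (frm x *v (acc x y + Hv x (\<epsilon> x *v y)))"
proof -
  let ?\<eta> = "\<epsilon> x *v y"
  have \<eta>: "?\<eta> \<in> \<omega>" and xd: "x \<in> dom_x y" using x y by (auto simp: dom_y_def dom_x_def)
  have pF: "px \<sigma> F x y = (\<^bold>\<Sum>a. partial a f ?\<eta> * DX x y $ a $ \<sigma>)" for \<sigma>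
  proof -
    have "px \<sigma> F x y = partial \<sigma> (\<lambda>x. f (\<epsilon> x *v y)) x"
      unfolding px_def by (rule partial_cong_open[OF open_dom_x xd]) (simp add: dom_x_def F_eq)
    then show ?thesis by (simp add: comp_x x cone_diff \<eta>)
  qed
  have ppF: "px \<rho> (py \<sigma> F) x y = (\<^bold>\<Sum>a. (\<^bold>\<Sum>b. gm ?\<eta> $ a $ b * DX x y $ b $ \<rho>) * \<epsilon> x $ a $ \<sigma> + partial a f ?\<eta> * dcof \<rho> a \<sigma> x)" for \<rho> \<sigma>
  proof -
    have "px \<rho> (py \<sigma> F) x y = partial \<rho> (\<lambda>x. \<^bold>\<Sum>a. partial a f (\<epsilon> x *v y) * \<epsilon> x $ a $ \<sigma>) x"
      unfolding px_def by (rule partial_cong_open[OF open_dom_x xd]) (simp add: dom_x_def dom_y_def py_F)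
    also have "\<dots> = (\<^bold>\<Sum>a. (\<^bold>\<Sum>b. partial b (partial a f) ?\<eta> * DX x y $ b $ \<rho>) * \<epsilon> x $ a $ \<sigma> + partial a f ?\<eta> * dcof \<rho> a \<sigma> x)"
      by (simp add: partial_sum partial_mult comp_x x cone_diff \<eta> W_diff dcof_def)
    also have "(\<lambda>a b. partial b (partial a f) ?\<eta>) = (\<lambda>a b. gm ?\<eta> $ a $ b)"
      using gm_sym[OF \<eta>] by (simp add: fun_eq_iff metric_mat_def transpose_def vec_eq_iff)
    finally show ?thesis by (simp add: fun_eq_iff)
  qed
  define p where "p = (\<chi> \<sigma>. (\<^bold>\<Sum>\<rho>. px \<rho> (py \<sigma> F) x y * y $ \<rho>) - px \<sigma> F x y)"
  have "p = transpose (\<epsilon> x) *v (gm ?\<eta> *v acc x y) + transpose (DZ x y - DX x y) *v gradf ?\<eta>"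
  proof -
    have 1: "(\<^bold>\<Sum>\<rho>. (\<^bold>\<Sum>a. (\<^bold>\<Sum>b. gm ?\<eta> $ a $ b * DX x y $ b $ \<rho>) * \<epsilon> x $ a $ \<sigma>) * y $ \<rho>)
      = (transpose (\<epsilon> x) *v (gm ?\<eta> *v acc x y)) $ \<sigma>" for \<sigma>
    proof -
      have "(\<^bold>\<Sum>\<rho>. (\<^bold>\<Sum>a. (\<^bold>\<Sum>b. gm ?\<eta> $ a $ b * DX x y $ b $ \<rho>) * \<epsilon> x $ a $ \<sigma>) * y $ \<rho>)
        = ((transpose (\<epsilon> x) ** (gm ?\<eta> ** DX x y)) *v y) $ \<sigma>"
        by (simp add: matrix_vector_mult_def matrix_matrix_mult_def transpose_def mult_ac)
      then show ?thesis by (simp add: acc_def matrix_vector_mul_assoc matrix_mul_assoc)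
    qed
    have 2: "(\<^bold>\<Sum>\<rho>. (\<^bold>\<Sum>a. partial a f ?\<eta> * dcof \<rho> a \<sigma> x) * y $ \<rho>) = (transpose (DZ x y) *v gradf ?\<eta>) $ \<sigma>" for \<sigma>
      by (simp add: DZ_def gradf_def matrix_vector_mult_def transpose_def sum_distrib_left sum_distrib_right mult_ac)
         (subst sum.swap, simp add: mult_ac)
    have 3: "px \<sigma> F x y = (transpose (DX x y) *v gradf ?\<eta>) $ \<sigma>" for \<sigma>
      by (simp add: pF gradf_def matrix_vector_mult_def transpose_def mult_ac)
    have "p $ \<sigma> = (transpose (\<epsilon> x) *v (gm ?\<eta> *v acc x y)) $ \<sigma> + ((transpose (DZ x y) *v gradf ?\<eta>) $ \<sigma> - (transpose (DX x y) *v gradf ?\<eta>) $ \<sigma>)" for \<sigma>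
      unfolding p_def by (simp add: ppF 3 sum.distrib distrib_right 1 2)
    moreover have tr: "transpose (DZ x y - DX x y) = transpose (DZ x y) - transpose (DX x y)"
      by (simp add: transpose_def vec_eq_iff)
    ultimately show ?thesis
      unfolding tr matrix_vector_mult_diff_rdistrib by (simp add: vec_eq_iff del: transpose_matrix_vector)
  qed
  then have "transpose (frm x) *v p = transpose (\<epsilon> x ** frm x) *v (gm ?\<eta> *v acc x y) + transpose (Wm x ?\<eta>) *v gradf ?\<eta>"
    by (simp add: Wm_eq[OF x] matrix_vector_right_distrib matrix_vector_mul_assoc matrix_transpose_mul matrix_mul_assoc
        del: transpose_matrix_vector)
  then have "hm ?\<eta> *v (transpose (frm x) *v p) = acc x y + Hv x ?\<eta>"
    by (simp add: frm_cof x transpose_mat matrix_vector_right_distrib Hv_eq matrix_vector_mul_assoc hm_gm \<eta>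
        del: transpose_matrix_vector)
  moreover have "(\<chi> \<mu>. spray F \<mu> x y) = (1/2) *\<^sub>R (matrix_inv (metric_mat (F x) y) *v p)"
    by (simp add: vec_eq_iff spray_def matrix_vector_mult_def p_def)
  ultimately show ?thesis by (simp add: metric_inv_F x y matrix_vector_mul_assoc del: transpose_matrix_vector)
      (metis matrix_vector_mul_assoc)
qed

definition ddcof :: "'m \<Rightarrow> 'm \<Rightarrow> 'm \<Rightarrow> 'm \<Rightarrow> real^'m \<Rightarrow> real" where
  "ddcof \<mu> \<rho> a \<nu> = partial \<mu> (dcof \<rho> a \<nu>)"

lemma ddcof_sym: "x \<in> W \<Longrightarrow> ddcof \<mu> \<rho> a \<nu> x = ddcof \<rho> \<mu> a \<nu> x"
  unfolding ddcof_def dcof_def by (rule partial_commute[OF open_W _ coframe_Ck])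

lemma sum_kron:
  fixes g :: "'m \<Rightarrow> real"
  shows "(\<^bold>\<Sum>k. (if i = k then 1 else 0) * g k) = g i" "(\<^bold>\<Sum>k. g k * (if i = k then 1 else 0)) = g i"
    "(\<^bold>\<Sum>k. (if k = i then 1 else 0) * g k) = g i" "(\<^bold>\<Sum>k. g k * (if k = i then 1 else 0)) = g i"
  by (simp_all add: if_distrib if_distribR cong: if_cong)

lemma spray_eq:
  assumes "x \<in> W" "y \<in> dom_y x"
  shows "spray F \<mu> x y = 1/2 * (\<^bold>\<Sum>a. frm x $ \<mu> $ a * (acc x y $ a + tens (HC a) x (\<epsilon> x *v y)))"
  using spray_vec[OF assms]
  by (simp add: vec_eq_iff matrix_vector_mult_def[of "frm x"] Hv_def)

lemma dom_xy: "x \<in> W \<Longrightarrow> y \<in> dom_y x \<Longrightarrow> x \<in> dom_x y" "x \<in> dom_x y \<Longrightarrow> x \<in> W" "x \<in> dom_x y \<Longrightarrow> y \<in> dom_y x"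
  "y \<in> dom_y x \<Longrightarrow> \<epsilon> x *v y \<in> \<omega>"
  by (auto simp: dom_x_def dom_y_def)

lemma acc_component: "acc x y $ a = (\<^bold>\<Sum>\<rho>. (\<^bold>\<Sum>\<nu>. dcof \<rho> a \<nu> x * y $ \<nu>) * y $ \<rho>)"
  by (simp add: acc_def DX_def matrix_vector_mult_def)

lemma acc_diff_y:
  "(\<lambda>y. acc x y $ a) differentiable (at y)"
  "partial \<nu> (\<lambda>y. acc x y $ a) y = DX x y $ a $ \<nu> + DZ x y $ a $ \<nu>"
  unfolding acc_component
  by (simp_all add: nth_diff partial_sum partial_mult partial_cmult partial_nth DX_def DZ_def sum.distrib sum_kron)

lemma acc_diff_x:
  assumes "x \<in> W"
  shows "(\<lambda>x. acc x y $ a) differentiable (at x)"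
  "partial \<mu> (\<lambda>x. acc x y $ a) x = (\<^bold>\<Sum>\<rho> \<nu>. ddcof \<mu> \<rho> a \<nu> x * y $ \<nu> * y $ \<rho>)"
  unfolding acc_component
  by (simp_all add: W_diff[OF assms] partial_sum partial_multc ddcof_def sum_distrib_right)

lemma spray_diff_y:
  assumes "x \<in> W" "y \<in> dom_y x"
  shows "spray F \<mu> x differentiable (at y)"
proof (rule differentiable_cong_open[OF open_dom_y assms(2), where g = "spray F \<mu> x"])
  show "(\<lambda>y. 1/2 * (\<^bold>\<Sum>a. frm x $ \<mu> $ a * (acc x y $ a + tens (HC a) x (\<epsilon> x *v y)))) differentiable (at y)"
    by (simp add: acc_diff_y tens_comp_y cone_diff[OF dom_xy(4)[OF assms(2)]])
qed (rule spray_eq[OF assms(1), symmetric])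

lemma spray_diff_x:
  assumes "x \<in> W" "y \<in> dom_y x"
  shows "(\<lambda>x. spray F \<mu> x y) differentiable (at x)"
proof (rule differentiable_cong_open[OF open_dom_x dom_xy(1)[OF assms], where g = "\<lambda>x. spray F \<mu> x y"])
  show "(\<lambda>x. 1/2 * (\<^bold>\<Sum>a. frm x $ \<mu> $ a * (acc x y $ a + tens (HC a) x (\<epsilon> x *v y)))) differentiable (at x)"
    by (simp add: acc_diff_x assms(1) tens_comp_x W_diff cone_diff[OF dom_xy(4)[OF assms(2)]])
qed (rule spray_eq[symmetric], erule dom_xy(2), erule dom_xy(3))

section \<open>The non-linear connection\<close>

lemma nonlin_conn_eq:
  assumes "x \<in> W" "y \<in> dom_y x"
  shows "nonlin_conn F \<mu> \<nu> x y = 1/2 * (\<^bold>\<Sum>a. frm x $ \<mu> $ a *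
    (DX x y $ a $ \<nu> + DZ x y $ a $ \<nu>
      + (\<^bold>\<Sum>b. tens (\<lambda>d i k. partial b (HC a d i k)) x (\<epsilon> x *v y) * \<epsilon> x $ b $ \<nu>)))"
proof -
  have "nonlin_conn F \<mu> \<nu> x y = partial \<nu> (\<lambda>y. 1/2 * (\<^bold>\<Sum>a. frm x $ \<mu> $ a * (acc x y $ a + tens (HC a) x (\<epsilon> x *v y)))) y"
    unfolding nonlin_conn_def py_def
    by (rule partial_cong_open[OF open_dom_y assms(2)]) (simp add: spray_eq[OF assms(1)])
  also have "\<dots> = 1/2 * (\<^bold>\<Sum>a. frm x $ \<mu> $ a *
    (DX x y $ a $ \<nu> + DZ x y $ a $ \<nu>
      + (\<^bold>\<Sum>b. partial b (tens (HC a) x) (\<epsilon> x *v y) * \<epsilon> x $ b $ \<nu>)))"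
    by (simp add: partial_cmult partial_sum partial_add acc_diff_y tens_comp_y cone_diff[OF dom_xy(4)[OF assms(2)]]
        del: times_divide_eq_left)
  finally show ?thesis by (simp add: partial_tens cone_diff[OF dom_xy(4)[OF assms(2)]])
qed

lemma nonlin_conn_mat:
  assumes "x \<in> W" "y \<in> dom_y x"
  shows "(\<chi> \<mu> \<nu>. nonlin_conn F \<mu> \<nu> x y) = (1/2) *\<^sub>R (frm x ** (DX x y + DZ x y + Hm x (\<epsilon> x *v y) ** \<epsilon> x))"
  by (simp add: vec_eq_iff nonlin_conn_eq assms matrix_matrix_mult_def Hm_def partial_tens
      cone_diff[OF dom_xy(4)[OF assms(2)]])

lemma DX_diff: "x \<in> W \<Longrightarrow> (\<lambda>x. DX x y $ a $ b) differentiable (at x)" "(\<lambda>y. DX x y $ a $ b) differentiable (at y)"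
  and DZ_diff: "x \<in> W \<Longrightarrow> (\<lambda>x. DZ x y $ a $ b) differentiable (at x)" "(\<lambda>y. DZ x y $ a $ b) differentiable (at y)"
  by (simp_all add: DX_def DZ_def W_diff nth_diff)

lemma nonlin_conn_diff_x:
  assumes "x \<in> W" "y \<in> dom_y x"
  shows "(\<lambda>x. nonlin_conn F \<mu> \<nu> x y) differentiable (at x)"
proof (rule differentiable_cong_open[OF open_dom_x dom_xy(1)[OF assms], where g = "\<lambda>x. nonlin_conn F \<mu> \<nu> x y"])
  show "(\<lambda>x. 1/2 * (\<^bold>\<Sum>a. frm x $ \<mu> $ a *
    (DX x y $ a $ \<nu> + DZ x y $ a $ \<nu>
      + (\<^bold>\<Sum>b. tens (\<lambda>d i k. partial b (HC a d i k)) x (\<epsilon> x *v y) * \<epsilon> x $ b $ \<nu>)))) differentiable (at x)"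
    by (simp add: DX_diff DZ_diff assms(1) tens_comp_x W_diff cone_diff[OF dom_xy(4)[OF assms(2)]])
qed (rule nonlin_conn_eq[symmetric], erule dom_xy(2), erule dom_xy(3))

lemma nonlin_conn_diff_y:
  assumes "x \<in> W" "y \<in> dom_y x"
  shows "nonlin_conn F \<mu> \<nu> x differentiable (at y)"
proof (rule differentiable_cong_open[OF open_dom_y assms(2), where g = "nonlin_conn F \<mu> \<nu> x"])
  show "(\<lambda>y. 1/2 * (\<^bold>\<Sum>a. frm x $ \<mu> $ a *
    (DX x y $ a $ \<nu> + DZ x y $ a $ \<nu>
      + (\<^bold>\<Sum>b. tens (\<lambda>d i k. partial b (HC a d i k)) x (\<epsilon> x *v y) * \<epsilon> x $ b $ \<nu>)))) differentiable (at y)"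
    by (simp add: DX_diff DZ_diff tens_comp_y cone_diff[OF dom_xy(4)[OF assms(2)]])
qed (rule nonlin_conn_eq[OF assms(1), symmetric])

section \<open>Homogeneity and the first expression for the Ricci scalar\<close>

lemma cone_scale: "\<eta> \<in> \<omega> \<Longrightarrow> s > 0 \<Longrightarrow> s *\<^sub>R \<eta> \<in> \<omega>"
  using cone by (simp add: open_cone_def)

lemma fd_hom:
  assumes "\<eta> \<in> \<omega>" "s > 0"
  shows "partial a f (s *\<^sub>R \<eta>) = s * partial a f \<eta>"
  using partial_homogeneous[OF open_cone_dom assms(1) _ _ assms(2), of f 1 a] assms f_hom cone_diff(1) cone_scale
  by (simp add: power2_eq_square)

lemma gm_hom:
  assumes "\<eta> \<in> \<omega>" "s > 0"
  shows "gm (s *\<^sub>R \<eta>) = gm \<eta>"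
proof -
  have "partial a (partial b f) (s *\<^sub>R \<eta>) = partial a (partial b f) \<eta>" for a b
    using partial_homogeneous[OF open_cone_dom assms(1) _ _ assms(2), of "partial b f" 0 a] assms
      fd_hom cone_diff(2) cone_scale
    by simp
  then show ?thesis by (simp add: metric_mat_def)
qed

lemma spray_hom:
  assumes "x \<in> W" "y \<in> dom_y x" "s > 0"
  shows "spray F \<mu> x (s *\<^sub>R y) = s\<^sup>2 * spray F \<mu> x y"
proof -
  have \<eta>: "\<epsilon> x *v y \<in> \<omega>" using assms dom_xy by auto
  have sc: "\<epsilon> x *v (s *\<^sub>R y) = s *\<^sub>R (\<epsilon> x *v y)"
    by (rule matrix_vector_mult_scaleR)
  have y': "s *\<^sub>R y \<in> dom_y x" using \<eta> assms(3) by (simp add: dom_y_def sc cone_scale)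
  have "HC a d i k (s *\<^sub>R \<eta>) = s\<^sup>2 * HC a d i k \<eta>" if "\<eta> \<in> \<omega>" for a d i k \<eta>
    by (simp add: HC_def metric_inv_def gm_hom fd_hom that assms(3) power2_eq_square)
  then have "tens (HC a) x (s *\<^sub>R \<eta>) = s\<^sup>2 * tens (HC a) x \<eta>" if "\<eta> \<in> \<omega>" for a \<eta>
    by (simp add: tens_def that sum_distrib_left mult.assoc)
  moreover have "acc x (s *\<^sub>R y) $ a = s\<^sup>2 * acc x y $ a" for a
    by (simp add: acc_component sum_distrib_left sum_distrib_right power2_eq_square mult_ac)
  ultimately show ?thesis
    using assms by (simp add: spray_eq y' sc \<eta> sum_distrib_left algebra_simps)
qed

lemma nonlin_conn_euler:
  assumes "x \<in> W" "y \<in> dom_y x"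
  shows "(\<^bold>\<Sum>\<alpha>. y $ \<alpha> * nonlin_conn F \<mu> \<alpha> x y) = 2 * spray F \<mu> x y"
  using euler_homogeneous[OF spray_diff_y[OF assms] spray_hom[OF assms]]
  by (simp add: nonlin_conn_def py_def)

text \<open>The contracted index is the lower index of N, not that of the derivative. So
  \<open>nonlin_conn_euler\<close> is differentiated as a whole: the product rule contributes one
  extra N on the left, the right side is 2 N.\<close>

lemma nonlin_conn_euler':
  assumes "x \<in> W" "y \<in> dom_y x"
  shows "(\<^bold>\<Sum>\<alpha>. y $ \<alpha> * py \<rho> (nonlin_conn F \<mu> \<alpha>) x y) = nonlin_conn F \<mu> \<rho> x y"
proof -
  have "(\<^bold>\<Sum>\<alpha>. y $ \<alpha> * py \<rho> (nonlin_conn F \<mu> \<alpha>) x y) + nonlin_conn F \<mu> \<rho> x y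
      = partial \<rho> (\<lambda>y. \<^bold>\<Sum>\<alpha>. y $ \<alpha> * nonlin_conn F \<mu> \<alpha> x y) y"
    using assms
    by (simp add: partial_sum partial_mult nth_diff nonlin_conn_diff_y partial_nth py_def sum.distrib sum_kron)
  also have "\<dots> = partial \<rho> (\<lambda>y. 2 * spray F \<mu> x y) y"
    by (rule partial_cong_open[OF open_dom_y assms(2)]) (simp add: nonlin_conn_euler assms(1))
  also have "\<dots> = 2 * nonlin_conn F \<mu> \<rho> x y"
    by (simp add: partial_cmult spray_diff_y assms nonlin_conn_def py_def)
  finally show ?thesis by simp
qed

text \<open>Since y is fixed under an x-derivative, the contraction with y moves inside and Euler's
  relation replaces N by 2 G. Of the two products of N with its y-derivative, one becomes the trace
  of N^2 by \<open>nonlin_conn_euler'\<close>, the other 2 G times the derivative of the trace of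
  N.\<close>

lemma Ric_spray:
  assumes "x \<in> W" "y \<in> dom_y x"
  shows "Ric F x y = 2 * (\<^bold>\<Sum>\<mu>. px \<mu> (spray F \<mu>) x y)
         - (\<^bold>\<Sum>\<mu> \<nu>. y $ \<mu> * px \<mu> (py \<nu> (spray F \<nu>)) x y)
         + 2 * (\<^bold>\<Sum>\<mu> \<nu>. spray F \<mu> x y * py \<mu> (py \<nu> (spray F \<nu>)) x y)
         - (\<^bold>\<Sum>\<mu> \<nu>. py \<nu> (spray F \<mu>) x y * py \<mu> (spray F \<nu>) x y)"
proof -
  let ?N = "nonlin_conn F"
  have 1: "(\<^bold>\<Sum>\<alpha>. px \<mu> (?N \<mu> \<alpha>) x y * y $ \<alpha>) = 2 * px \<mu> (spray F \<mu>) x y" for \<mu>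
  proof -
    have "(\<^bold>\<Sum>\<alpha>. px \<mu> (?N \<mu> \<alpha>) x y * y $ \<alpha>) = partial \<mu> (\<lambda>x. \<^bold>\<Sum>\<alpha>. y $ \<alpha> * ?N \<mu> \<alpha> x y) x"
      by (simp add: partial_sum partial_cmult nonlin_conn_diff_x assms px_def mult.commute)
    also have "\<dots> = partial \<mu> (\<lambda>x. 2 * spray F \<mu> x y) x"
      by (rule partial_cong_open[OF open_dom_x dom_xy(1)[OF assms]]) (rule nonlin_conn_euler, erule dom_xy(2), erule dom_xy(3))
    finally show ?thesis by (simp add: partial_cmult spray_diff_x assms px_def)
  qed
  have 2: "(\<^bold>\<Sum>\<alpha>. (\<^bold>\<Sum>\<rho>. ?N \<rho> \<mu> x y * py \<rho> (?N \<mu> \<alpha>) x y) * y $ \<alpha>)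
      = (\<^bold>\<Sum>\<rho>. ?N \<rho> \<mu> x y * ?N \<mu> \<rho> x y)" for \<mu>
  proof -
    have "(\<^bold>\<Sum>\<alpha>. (\<^bold>\<Sum>\<rho>. ?N \<rho> \<mu> x y * py \<rho> (?N \<mu> \<alpha>) x y) * y $ \<alpha>)
      = (\<^bold>\<Sum>\<rho>. ?N \<rho> \<mu> x y * (\<^bold>\<Sum>\<alpha>. y $ \<alpha> * py \<rho> (?N \<mu> \<alpha>) x y))"
      by (simp add: sum_distrib_left sum_distrib_right mult_ac) (rule sum.swap)
    then show ?thesis by (simp add: nonlin_conn_euler' assms)
  qed
  have 3: "(\<^bold>\<Sum>\<alpha>. (\<^bold>\<Sum>\<rho>. ?N \<rho> \<alpha> x y * py \<rho> (?N \<mu> \<mu>) x y) * y $ \<alpha>)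
      = 2 * (\<^bold>\<Sum>\<rho>. spray F \<rho> x y * py \<rho> (?N \<mu> \<mu>) x y)" for \<mu>
  proof -
    have "(\<^bold>\<Sum>\<alpha>. (\<^bold>\<Sum>\<rho>. ?N \<rho> \<alpha> x y * py \<rho> (?N \<mu> \<mu>) x y) * y $ \<alpha>)
      = (\<^bold>\<Sum>\<rho>. (\<^bold>\<Sum>\<alpha>. y $ \<alpha> * ?N \<rho> \<alpha> x y) * py \<rho> (?N \<mu> \<mu>) x y)"
      by (simp add: sum_distrib_left sum_distrib_right mult_ac) (rule sum.swap)
    then show ?thesis by (simp add: nonlin_conn_euler assms sum_distrib_left mult.assoc)
  qed
  have "(\<^bold>\<Sum>\<alpha>. curvature F \<mu> \<mu> \<alpha> x y * y $ \<alpha>) = 2 * px \<mu> (spray F \<mu>) x y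
      - (\<^bold>\<Sum>\<rho>. ?N \<rho> \<mu> x y * ?N \<mu> \<rho> x y) - (\<^bold>\<Sum>\<alpha>. y $ \<alpha> * px \<alpha> (?N \<mu> \<mu>) x y)
      + 2 * (\<^bold>\<Sum>\<rho>. spray F \<rho> x y * py \<rho> (?N \<mu> \<mu>) x y)" for \<mu>
  proof -
    have 4: "(\<^bold>\<Sum>\<alpha>. px \<alpha> (?N \<mu> \<mu>) x y * y $ \<alpha>) = (\<^bold>\<Sum>\<alpha>. y $ \<alpha> * px \<alpha> (?N \<mu> \<mu>) x y)"
      by (simp add: mult.commute)
    show ?thesis
      unfolding curvature_def delta_deriv_def left_diff_distrib sum_subtractf 1 2 3 4 by simp
  qed
  then have "Ric F x y = 2 * (\<^bold>\<Sum>\<mu>. px \<mu> (spray F \<mu>) x y)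
      - (\<^bold>\<Sum>\<mu> \<rho>. ?N \<rho> \<mu> x y * ?N \<mu> \<rho> x y)
      - (\<^bold>\<Sum>\<mu> \<alpha>. y $ \<alpha> * px \<alpha> (?N \<mu> \<mu>) x y)
      + 2 * (\<^bold>\<Sum>\<mu> \<rho>. spray F \<rho> x y * py \<rho> (?N \<mu> \<mu>) x y)"
    by (simp add: Ric_def sum.distrib sum_subtractf sum_distrib_left)
  moreover have "(\<^bold>\<Sum>\<mu> \<alpha>. y $ \<alpha> * px \<alpha> (?N \<mu> \<mu>) x y) = (\<^bold>\<Sum>\<mu> \<nu>. y $ \<mu> * px \<mu> (py \<nu> (spray F \<nu>)) x y)"
    unfolding nonlin_conn_def by (rule sum.swap)
  moreover have "(\<^bold>\<Sum>\<mu> \<rho>. spray F \<rho> x y * py \<rho> (?N \<mu> \<mu>) x y) = (\<^bold>\<Sum>\<mu> \<nu>. spray F \<mu> x y * py \<mu> (py \<nu> (spray F \<nu>)) x y)"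
    unfolding nonlin_conn_def by (rule sum.swap)
  moreover have "(\<^bold>\<Sum>\<mu> \<rho>. ?N \<rho> \<mu> x y * ?N \<mu> \<rho> x y) = (\<^bold>\<Sum>\<mu> \<nu>. py \<nu> (spray F \<mu>) x y * py \<mu> (spray F \<nu>) x y)"
    unfolding nonlin_conn_def by (simp add: mult.commute)
  ultimately show ?thesis by simp
qed

section \<open>The divergence of H\<close>

lemma cartan_sym:
  assumes "\<eta> \<in> \<omega>"
  shows "cartan f a b c \<eta> = cartan f b a c \<eta>" "cartan f a b c \<eta> = cartan f a c b \<eta>"
proof -
  have "partial a (partial b (partial c f)) \<eta> = partial b (partial a (partial c f)) \<eta>"
    by (rule partial_commute[OF open_cone_dom assms Ck_on_le[OF fd_Ck]]) simp
  then show "cartan f a b c \<eta> = cartan f b a c \<eta>" by (simp add: cartan_def)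
  have "partial a (partial b (partial c f)) \<eta> = partial a (partial c (partial b f)) \<eta>"
    by (rule partial_cong_open[OF open_cone_dom assms], rule partial_commute[OF open_cone_dom _ Ck_on_le[OF f_Ck]]) simp_all
  then show "cartan f a b c \<eta> = cartan f a c b \<eta>" by (simp add: cartan_def)
qed

lemma hm_swap: "\<eta> \<in> \<omega> \<Longrightarrow> hm \<eta> $ a $ b = hm \<eta> $ b $ a"
  and gm_swap: "\<eta> \<in> \<omega> \<Longrightarrow> gm \<eta> $ a $ b = gm \<eta> $ b $ a"
  using hm_sym gm_sym by (auto simp: transpose_def vec_eq_iff)

lemma partial_hm:
  assumes "\<eta> \<in> \<omega>"
  shows "partial b (\<lambda>\<eta>. hm \<eta> $ a $ d) \<eta> = - 2 * (\<^bold>\<Sum>m n. hm \<eta> $ a $ m * cartan f b m n \<eta> * hm \<eta> $ n $ d)"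
proof -
  have "partial b (\<lambda>\<eta>. gm \<eta> $ m $ n) \<eta> = 2 * cartan f b m n \<eta>" for m n
    by (simp add: metric_mat_def cartan_def)
  then show ?thesis
    using partial_matrix_inv[where M = gm and i = b and a = a and d = d,
        OF open_cone_dom assms nondeg Ck_on_le[OF gm_Ck]]
    by (simp add: metric_inv_def sum_distrib_left mult_ac sum_negf)
qed

text \<open>Here the mean Cartan torsion appears: the derivative of the inverse metric is - 2 C with
  two indices raised, and total symmetry of C lets the divergence contract any pair of its
  indices.\<close>

lemma div_hm:
  assumes "\<eta> \<in> \<omega>"
  shows "(\<^bold>\<Sum>a. partial a (\<lambda>\<eta>. hm \<eta> $ a $ d) \<eta>) = - 2 * mean_cartan_up f d \<eta>"
proof -
  have "(\<^bold>\<Sum>a m n. hm \<eta> $ a $ m * cartan f a m n \<eta> * hm \<eta> $ n $ d)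
     = (\<^bold>\<Sum>a m n. hm \<eta> $ d $ n * (hm \<eta> $ a $ m * cartan f n a m \<eta>))"
    by (intro sum.cong refl) (metis assms cartan_sym hm_swap mult.commute)
  also have "\<dots> = (\<^bold>\<Sum>a n m. hm \<eta> $ d $ n * (hm \<eta> $ a $ m * cartan f n a m \<eta>))"
    by (rule sum.cong[OF refl], rule sum.swap)
  also have "\<dots> = (\<^bold>\<Sum>n a m. hm \<eta> $ d $ n * (hm \<eta> $ a $ m * cartan f n a m \<eta>))"
    by (rule sum.swap)
  also have "\<dots> = mean_cartan_up f d \<eta>"
    by (simp add: mean_cartan_up_def mean_cartan_def sum_distrib_left)
  finally show ?thesis by (simp add: partial_hm assms sum_distrib_left[symmetric] sum_negf)
qed

lemma strc_antisym: "strc i j k x = - strc i k j x"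
  unfolding strc_def by (subst sum.swap) (simp add: sum_negf[symmetric] algebra_simps)

lemma partial_HC:
  assumes "\<eta> \<in> \<omega>"
  shows "partial b (HC a d i k) \<eta> = partial b (\<lambda>\<eta>. hm \<eta> $ a $ d) \<eta> * partial i f \<eta> * \<eta> $ k
    + hm \<eta> $ a $ d * gm \<eta> $ b $ i * \<eta> $ k + hm \<eta> $ a $ d * partial i f \<eta> * (if b = k then 1 else 0)"
  unfolding HC_def[abs_def]
  by (simp add: partial_mult cone_diff assms nth_diff partial_nth metric_mat_def algebra_simps)

text \<open>The product rule for g^ad y_i \<eta>^k leaves three terms. The divergence of the inverse
  metric gives - 2 J; g^ad g_ai is a Kronecker symbol and gives the traced structure coefficient; in
  the last term g^kd is symmetric and c^i_dk antisymmetric, so it vanishes.\<close>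

lemma trace_Hm:
  assumes \<eta>: "\<eta> \<in> \<omega>"
  shows "trace (Hm x \<eta>) = - 2 * tens JC x \<eta> + (\<^bold>\<Sum>d k. strc d d k x * \<eta> $ k)"
proof -
  have s1: "(\<^bold>\<Sum>a. partial a (HC a d i k) \<eta>) =
     - 2 * JC d i k \<eta> + (if d = i then 1 else 0) * \<eta> $ k + hm \<eta> $ k $ d * partial i f \<eta>" for d i k
  proof -
    have "(\<^bold>\<Sum>a. hm \<eta> $ a $ d * gm \<eta> $ a $ i) = (if d = i then 1 else 0)"
      using hm_gm(1)[OF \<eta>] hm_swap[OF \<eta>, of _ d] by (simp add: matrix_matrix_mult_def vec_eq_iff mat_def)
    then show ?thesis
      by (simp add: partial_HC \<eta> sum.distrib sum_distrib_right[symmetric] div_hm JC_def sum_kron)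
  qed
  have "trace (Hm x \<eta>) = (\<^bold>\<Sum>a d i k. partial a (HC a d i k) \<eta> * strc i d k x)"
    by (simp add: trace_def Hm_def partial_tens cone_diff \<eta> tens_def)
  also have "\<dots> = (\<^bold>\<Sum>d a i k. partial a (HC a d i k) \<eta> * strc i d k x)"
    by (rule sum.swap)
  also have "\<dots> = (\<^bold>\<Sum>d i a k. partial a (HC a d i k) \<eta> * strc i d k x)"
    by (rule sum.cong[OF refl], rule sum.swap)
  also have "\<dots> = (\<^bold>\<Sum>d i k a. partial a (HC a d i k) \<eta> * strc i d k x)"
    by (rule sum.cong[OF refl], rule sum.cong[OF refl], rule sum.swap)
  also have "\<dots> = (\<^bold>\<Sum>d i k. (- 2 * JC d i k \<eta> + (if d = i then 1 else 0) * \<eta> $ k + hm \<eta> $ k $ d * partial i f \<eta>) * strc i d k x)"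
    by (simp only: sum_distrib_right[symmetric] s1)
  also have "\<dots> = - 2 * tens JC x \<eta> + (\<^bold>\<Sum>d i k. (if d = i then 1 else 0) * \<eta> $ k * strc i d k x)
      + (\<^bold>\<Sum>d i k. hm \<eta> $ k $ d * partial i f \<eta> * strc i d k x)"
    by (simp only: distrib_right sum.distrib) (simp add: tens_def sum_distrib_left mult.assoc sum_negf)
  also have "(\<^bold>\<Sum>d i k. (if d = i then 1 else 0) * \<eta> $ k * strc i d k x) = (\<^bold>\<Sum>d k. strc d d k x * \<eta> $ k)"
  proof (rule sum.cong[OF refl])
    fix d :: 'm
    have "(\<^bold>\<Sum>i k. (if d = i then 1 else 0) * \<eta> $ k * strc i d k x) = (\<^bold>\<Sum>i. if d = i then \<^bold>\<Sum>k. \<eta> $ k * strc i d k x else 0)"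
      by (intro sum.cong refl) simp
    then show "(\<^bold>\<Sum>i k. (if d = i then 1 else 0) * \<eta> $ k * strc i d k x) = (\<^bold>\<Sum>k. strc d d k x * \<eta> $ k)"
      by (simp add: mult.commute)
  qed
  also have "(\<^bold>\<Sum>d i k. hm \<eta> $ k $ d * partial i f \<eta> * strc i d k x) = 0"
  proof -
    have "(\<^bold>\<Sum>d i k. hm \<eta> $ k $ d * partial i f \<eta> * strc i d k x)
      = (\<^bold>\<Sum>i d k. hm \<eta> $ k $ d * partial i f \<eta> * strc i d k x)" (is "?S = (\<^bold>\<Sum>i. ?T i)")
      by (rule sum.swap)
    moreover have "?T i = - ?T i" for i
    proof -
      have "?T i = (\<^bold>\<Sum>k d. hm \<eta> $ k $ d * partial i f \<eta> * strc i d k x)" by (rule sum.swap)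
      also have "\<dots> = - ?T i"
        unfolding sum_negf[symmetric]
        by (intro sum.cong refl) (subst strc_antisym, subst hm_swap[OF \<eta>], simp)
      finally show ?thesis .
    qed
    then have "?T i = 0" for i by (simp add: eq_neg_iff_add_eq_0)
    ultimately show ?thesis by simp
  qed
  finally show ?thesis by simp
qed

section \<open>The Ricci scalar in a frame\<close>

text \<open>
  \<open>sdv n\<close> is \<open>e\<^sup>\<rho>\<^sub>m \<partial>\<^sub>n e\<^sup>m\<^sub>\<rho>\<close>, \<open>kap n\<close> is \<open>e\<^sup>\<rho>\<^sub>m \<partial>\<^sub>\<rho> e\<^sup>m\<^sub>n\<close>, \<open>cdv a\<close> is
  \<open>c\<^sup>d\<^sub>d\<^sub>a\<close> and \<open>dstr i j k d\<close> is \<open>c\<^sup>i\<^sub>j\<^sub>k\<^sub>,\<^sub>d\<close>.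
\<close>

definition kap :: "'m \<Rightarrow> real^'m \<Rightarrow> real" where
  "kap n x = (\<^bold>\<Sum>m \<rho>. frm x $ \<rho> $ m * dcof \<rho> m n x)"

definition sdv :: "'m \<Rightarrow> real^'m \<Rightarrow> real" where
  "sdv n x = (\<^bold>\<Sum>m \<rho>. frm x $ \<rho> $ m * dcof n m \<rho> x)"

definition cdv :: "'m \<Rightarrow> real^'m \<Rightarrow> real" where
  "cdv a x = (\<^bold>\<Sum>d. strc d d a x)"

definition dstr :: "'m \<Rightarrow> 'm \<Rightarrow> 'm \<Rightarrow> 'm \<Rightarrow> real^'m \<Rightarrow> real" where
  "dstr i j k d x = (\<^bold>\<Sum>\<mu>. frm x $ \<mu> $ d * partial \<mu> (strc i j k) x)"

section \<open>Derivatives of the frame and of the traced structure coefficients\<close>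

lemma partial_frm:
  assumes "x \<in> W"
  shows "partial \<mu> (\<lambda>x. frm x $ \<rho> $ a) x = - (\<^bold>\<Sum>m n. frm x $ \<rho> $ m * dcof \<mu> m n x * frm x $ n $ a)"
  using partial_matrix_inv[where M = \<epsilon> and i = \<mu> and a = \<rho> and d = a, OF open_W assms coframe_inv coframe_Ck_le]
  by (simp add: frm_def dcof_def)

lemma partial_frm_dir:
  assumes "x \<in> W"
  shows "(\<^bold>\<Sum>\<mu>. y $ \<mu> * partial \<mu> (\<lambda>x. frm x $ \<rho> $ a) x) = - (frm x ** (DZ x y ** frm x)) $ \<rho> $ a"
proof -
  have "(\<^bold>\<Sum>\<mu>. y $ \<mu> * partial \<mu> (\<lambda>x. frm x $ \<rho> $ a) x)
    = - (\<^bold>\<Sum>\<mu> m n. frm x $ \<rho> $ m * (dcof \<mu> m n x * y $ \<mu>) * frm x $ n $ a)"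
    by (simp add: partial_frm assms sum_distrib_left sum_negf mult_ac)
  also have "(\<^bold>\<Sum>\<mu> m n. frm x $ \<rho> $ m * (dcof \<mu> m n x * y $ \<mu>) * frm x $ n $ a)
    = (\<^bold>\<Sum>m n \<mu>. frm x $ \<rho> $ m * (dcof \<mu> m n x * y $ \<mu>) * frm x $ n $ a)"
    by (subst sum.swap, rule sum.cong[OF refl], rule sum.swap)
  also have "\<dots> = (frm x ** (DZ x y ** frm x)) $ \<rho> $ a"
    by (simp add: matrix_matrix_mult_def DZ_def sum_distrib_left sum_distrib_right mult_ac)
  finally show ?thesis .
qed

text \<open>\<open>D\<close> stands for either placement of the indices of the coframe derivative,
  one for \<open>sdv\<close> and one for \<open>kap\<close>. Along y the frame changes by - frm DZ
  frm, which closes the sum to a trace.\<close>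

lemma partial_frm_contract:
  assumes "x \<in> W"
  shows "(\<^bold>\<Sum>\<mu> \<sigma>. y $ \<mu> * y $ \<sigma> * (\<^bold>\<Sum>m \<rho>. partial \<mu> (\<lambda>x. frm x $ \<rho> $ m) x * D m \<rho> \<sigma>))
    = - trace (DZ x y ** frm x ** ((\<chi> m \<rho>. \<^bold>\<Sum>\<sigma>. D m \<rho> \<sigma> * y $ \<sigma>) ** frm x))" (is "?lhs = _")
proof -
  let ?M = "(\<chi> m \<rho>. \<^bold>\<Sum>\<sigma>. D m \<rho> \<sigma> * y $ \<sigma>) :: real^'m^'m"
  have "?lhs
    = (\<^bold>\<Sum>\<mu> \<sigma> m \<rho>. (y $ \<mu> * partial \<mu> (\<lambda>x. frm x $ \<rho> $ m) x) * (D m \<rho> \<sigma> * y $ \<sigma>))"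
    by (simp add: sum_distrib_left mult_ac)
  also have "\<dots> = (\<^bold>\<Sum>m \<rho> \<mu> \<sigma>. (y $ \<mu> * partial \<mu> (\<lambda>x. frm x $ \<rho> $ m) x) * (D m \<rho> \<sigma> * y $ \<sigma>))"
    by (rule sum_swap4)
  also have "\<dots> = (\<^bold>\<Sum>m \<rho>. - (frm x ** (DZ x y ** frm x)) $ \<rho> $ m * ?M $ m $ \<rho>)"
    by (simp only: sum_product[symmetric] partial_frm_dir[OF assms] vec_lambda_beta)
  also have "\<dots> = - trace (?M ** (frm x ** (DZ x y ** frm x)))"
    by (simp add: trace_mult_sum sum_negf mult.commute)
  also have "\<dots> = - trace (DZ x y ** frm x ** (?M ** frm x))"
    by (subst trace_mul_sym[of "DZ x y ** frm x"]) (simp add: matrix_mul_assoc)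
  finally show ?thesis .
qed

text \<open>The second derivatives of the coframe; \<open>\<beta>2 - \<beta>1\<close> is absorbed by \<open>c\<^sup>a\<^sub>a\<^sub>b\<^sub>,\<^sub>c\<close>.\<close>

definition \<beta>1 :: "real^'m \<Rightarrow> real^'m \<Rightarrow> real" where
  "\<beta>1 x y = (\<^bold>\<Sum>m \<rho> \<mu> \<sigma>. y $ \<mu> * y $ \<sigma> * (frm x $ \<rho> $ m * ddcof \<rho> \<mu> m \<sigma> x))"

definition \<beta>2 :: "real^'m \<Rightarrow> real^'m \<Rightarrow> real" where
  "\<beta>2 x y = (\<^bold>\<Sum>m \<rho> \<mu> \<sigma>. y $ \<mu> * y $ \<sigma> * (frm x $ \<rho> $ m * ddcof \<mu> \<sigma> m \<rho> x))"

lemma sdv_diff: "x \<in> W \<Longrightarrow> sdv n differentiable (at x)"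
  and kap_diff: "x \<in> W \<Longrightarrow> kap n differentiable (at x)"
  unfolding sdv_def kap_def by (simp_all add: W_diff)

lemma partial_sdv:
  assumes "x \<in> W"
  shows "(\<^bold>\<Sum>\<mu> \<sigma>. y $ \<mu> * y $ \<sigma> * partial \<mu> (sdv \<sigma>) x) = - trace (DZ x y ** frm x ** (DZ x y ** frm x)) + \<beta>2 x y"
proof -
  have "partial \<mu> (sdv \<sigma>) x = (\<^bold>\<Sum>m \<rho>. partial \<mu> (\<lambda>x. frm x $ \<rho> $ m) x * dcof \<sigma> m \<rho> x)
     + (\<^bold>\<Sum>m \<rho>. frm x $ \<rho> $ m * ddcof \<mu> \<sigma> m \<rho> x)" for \<mu> \<sigma>
    unfolding sdv_def by (simp add: W_diff[OF assms] partial_sum partial_mult sum.distrib ddcof_def)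
  then have "(\<^bold>\<Sum>\<mu> \<sigma>. y $ \<mu> * y $ \<sigma> * partial \<mu> (sdv \<sigma>) x)
    = (\<^bold>\<Sum>\<mu> \<sigma>. y $ \<mu> * y $ \<sigma> * (\<^bold>\<Sum>m \<rho>. partial \<mu> (\<lambda>x. frm x $ \<rho> $ m) x * dcof \<sigma> m \<rho> x))
    + (\<^bold>\<Sum>\<mu> \<sigma> m \<rho>. y $ \<mu> * y $ \<sigma> * (frm x $ \<rho> $ m * ddcof \<mu> \<sigma> m \<rho> x))"
    by (simp add: distrib_left sum.distrib sum_distrib_left)
  also have "(\<^bold>\<Sum>\<mu> \<sigma> m \<rho>. y $ \<mu> * y $ \<sigma> * (frm x $ \<rho> $ m * ddcof \<mu> \<sigma> m \<rho> x)) = \<beta>2 x y"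
    unfolding \<beta>2_def by (rule sum_swap4)
  finally show ?thesis by (simp add: partial_frm_contract[OF assms] DZ_def)
qed

lemma partial_kap:
  assumes "x \<in> W"
  shows "(\<^bold>\<Sum>\<mu> \<sigma>. y $ \<mu> * y $ \<sigma> * partial \<mu> (kap \<sigma>) x) = - trace (DZ x y ** frm x ** (DX x y ** frm x)) + \<beta>1 x y"
proof -
  \<comment> \<open>The second derivatives of the coframe are commuted so that the index \<rho>
    contracted with the frame comes first, the order in which the divergence of the spray produces
    them.\<close>
  have "partial \<mu> (kap \<sigma>) x = (\<^bold>\<Sum>m \<rho>. partial \<mu> (\<lambda>x. frm x $ \<rho> $ m) x * dcof \<rho> m \<sigma> x)
     + (\<^bold>\<Sum>m \<rho>. frm x $ \<rho> $ m * ddcof \<rho> \<mu> m \<sigma> x)" for \<mu> \<sigma>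
    unfolding kap_def ddcof_sym[OF assms, of _ \<mu>]
    by (simp add: W_diff[OF assms] partial_sum partial_mult sum.distrib ddcof_def)
  then have "(\<^bold>\<Sum>\<mu> \<sigma>. y $ \<mu> * y $ \<sigma> * partial \<mu> (kap \<sigma>) x)
    = (\<^bold>\<Sum>\<mu> \<sigma>. y $ \<mu> * y $ \<sigma> * (\<^bold>\<Sum>m \<rho>. partial \<mu> (\<lambda>x. frm x $ \<rho> $ m) x * dcof \<rho> m \<sigma> x))
    + (\<^bold>\<Sum>\<mu> \<sigma> m \<rho>. y $ \<mu> * y $ \<sigma> * (frm x $ \<rho> $ m * ddcof \<rho> \<mu> m \<sigma> x))"
    by (simp add: distrib_left sum.distrib sum_distrib_left)
  also have "(\<^bold>\<Sum>\<mu> \<sigma> m \<rho>. y $ \<mu> * y $ \<sigma> * (frm x $ \<rho> $ m * ddcof \<rho> \<mu> m \<sigma> x)) = \<beta>1 x y"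
    unfolding \<beta>1_def by (rule sum_swap4)
  finally show ?thesis by (simp add: partial_frm_contract[OF assms, where D = "\<lambda>m \<rho> \<sigma>. dcof \<rho> m \<sigma> x"] DX_def)
qed

text \<open>\<open>sdv\<close> comes from the trace of the connection and \<open>kap\<close> from
  the divergence of the frame in the spray. Both depend on the coordinates; their difference, moved
  to the frame, is the trace of the structure coefficients.\<close>

lemma cdv_eq: "cdv a x = (\<^bold>\<Sum>n. (sdv n x - kap n x) * frm x $ n $ a)"
proof -
  have "cdv a x = (\<^bold>\<Sum>d n \<rho>. (frm x $ \<rho> $ d * dcof n d \<rho> x - frm x $ \<rho> $ d * dcof \<rho> d n x) * frm x $ n $ a)"
    unfolding cdv_def strc_def
    by (rule sum.cong[OF refl], subst sum.swap) (simp add: algebra_simps)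
  also have "\<dots> = (\<^bold>\<Sum>n d \<rho>. (frm x $ \<rho> $ d * dcof n d \<rho> x - frm x $ \<rho> $ d * dcof \<rho> d n x) * frm x $ n $ a)"
    by (rule sum.swap)
  also have "\<dots> = (\<^bold>\<Sum>n. (sdv n x - kap n x) * frm x $ n $ a)"
    by (simp add: sdv_def kap_def sum_subtractf[symmetric] sum_distrib_right)
  finally show ?thesis .
qed

lemma frame_expand: "x \<in> W \<Longrightarrow> (\<^bold>\<Sum>k. frm x $ \<mu> $ k * (\<epsilon> x *v y) $ k) = y $ \<mu>"
  using frm_cof_vec[of x y] by (simp add: matrix_vector_mult_def[of "frm x"] vec_eq_iff)

lemma dstr_contract:
  assumes "x \<in> W"
  shows "(\<^bold>\<Sum>c. (\<epsilon> x *v y) $ c * dstr i j k c x) = (\<^bold>\<Sum>\<mu>. y $ \<mu> * partial \<mu> (strc i j k) x)"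
proof -
  have "(\<^bold>\<Sum>c. (\<epsilon> x *v y) $ c * dstr i j k c x)
    = (\<^bold>\<Sum>c \<mu>. (frm x $ \<mu> $ c * (\<epsilon> x *v y) $ c) * partial \<mu> (strc i j k) x)"
    by (simp add: dstr_def sum_distrib_left mult_ac)
  also have "\<dots> = (\<^bold>\<Sum>\<mu> c. (frm x $ \<mu> $ c * (\<epsilon> x *v y) $ c) * partial \<mu> (strc i j k) x)"
    by (rule sum.swap)
  finally show ?thesis by (simp add: sum_distrib_right[symmetric] frame_expand assms)
qed

text \<open>By \<open>cdv_eq\<close> the derivative of c^a_ab along y consists of second derivatives
  of the coframe, \<open>\<beta>2 x y - \<beta>1 x y\<close>, and of traces from the frame factors
  inside \<open>sdv\<close> and \<open>kap\<close>. The last sum arises from the outer frame factor: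
  its change - frm DZ frm sends \<eta> to - frm v.\<close>

lemma dstr_trace:
  assumes x: "x \<in> W"
  shows "(\<^bold>\<Sum>a b c. (\<epsilon> x *v y) $ b * ((\<epsilon> x *v y) $ c * dstr a a b c x))
    = - trace (DZ x y ** frm x ** (DZ x y ** frm x)) + \<beta>2 x y
      + trace (DZ x y ** frm x ** (DX x y ** frm x)) - \<beta>1 x y - (\<^bold>\<Sum>p. cdv p x * acc x y $ p)"
proof -
  let ?\<eta> = "\<epsilon> x *v y"
  have "(\<^bold>\<Sum>a b c. ?\<eta> $ b * (?\<eta> $ c * dstr a a b c x))
    = (\<^bold>\<Sum>a b \<mu>. ?\<eta> $ b * (y $ \<mu> * partial \<mu> (strc a a b) x))"
    by (simp only: sum_distrib_left[symmetric] dstr_contract[OF x])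
  also have "\<dots> = (\<^bold>\<Sum>b a \<mu>. ?\<eta> $ b * (y $ \<mu> * partial \<mu> (strc a a b) x))"
    by (rule sum.swap)
  also have "\<dots> = (\<^bold>\<Sum>b \<mu> a. ?\<eta> $ b * (y $ \<mu> * partial \<mu> (strc a a b) x))"
    by (rule sum.cong[OF refl], rule sum.swap)
  also have "\<dots> = (\<^bold>\<Sum>b \<mu>. ?\<eta> $ b * (y $ \<mu> * partial \<mu> (cdv b) x))"
    by (simp add: cdv_def[abs_def] partial_sum W_diff[OF x] sum_distrib_left)
  also have "\<dots> = (\<^bold>\<Sum>b \<mu> n. y $ \<mu> * (partial \<mu> (sdv n) x - partial \<mu> (kap n) x) * (frm x $ n $ b * ?\<eta> $ b))
    + (\<^bold>\<Sum>b \<mu> n. (sdv n x - kap n x) * ((y $ \<mu> * partial \<mu> (\<lambda>x. frm x $ n $ b) x) * ?\<eta> $ b))"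
    (is "_ = ?A + ?B")
  proof -
    have "partial \<mu> (cdv b) x = (\<^bold>\<Sum>n. (partial \<mu> (sdv n) x - partial \<mu> (kap n) x) * frm x $ n $ b)
       + (\<^bold>\<Sum>n. (sdv n x - kap n x) * partial \<mu> (\<lambda>x. frm x $ n $ b) x)" for \<mu> b
      unfolding cdv_eq[abs_def]
      by (simp add: partial_sum partial_mult partial_diff sdv_diff[OF x] kap_diff[OF x] W_diff[OF x] sum.distrib)
    then show ?thesis by (simp add: distrib_left sum.distrib sum_distrib_left mult_ac)
  qed
  also have "?A = (\<^bold>\<Sum>\<mu> n. y $ \<mu> * y $ n * partial \<mu> (sdv n) x) - (\<^bold>\<Sum>\<mu> n. y $ \<mu> * y $ n * partial \<mu> (kap n) x)"
  proof -
    have "?A = (\<^bold>\<Sum>\<mu> n b. y $ \<mu> * (partial \<mu> (sdv n) x - partial \<mu> (kap n) x) * (frm x $ n $ b * ?\<eta> $ b))"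
      by (subst sum.swap, rule sum.cong[OF refl], rule sum.swap)
    also have "\<dots> = (\<^bold>\<Sum>\<mu> n. y $ \<mu> * (partial \<mu> (sdv n) x - partial \<mu> (kap n) x) * y $ n)"
      by (simp only: sum_distrib_left[symmetric] frame_expand[OF x])
    finally show ?thesis by (simp add: sum_subtractf[symmetric] algebra_simps)
  qed
  also have "?B = - (\<^bold>\<Sum>p. cdv p x * acc x y $ p)"
  proof -
    have "?B = (\<^bold>\<Sum>b n \<mu>. (sdv n x - kap n x) * ((y $ \<mu> * partial \<mu> (\<lambda>x. frm x $ n $ b) x) * ?\<eta> $ b))"
      by (rule sum.cong[OF refl], rule sum.swap)
    also have "\<dots> = (\<^bold>\<Sum>b n. (sdv n x - kap n x) * (- (frm x ** (DZ x y ** frm x)) $ n $ b * ?\<eta> $ b))"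
      by (simp only: sum_distrib_left[symmetric] sum_distrib_right[symmetric] partial_frm_dir[OF x])
    also have "\<dots> = (\<^bold>\<Sum>n b. (sdv n x - kap n x) * (- (frm x ** (DZ x y ** frm x)) $ n $ b * ?\<eta> $ b))"
      by (rule sum.swap)
    also have "\<dots> = - (\<^bold>\<Sum>n. (sdv n x - kap n x) * ((frm x ** (DZ x y ** frm x)) *v ?\<eta>) $ n)"
      by (simp add: matrix_vector_mult_def[of "frm x ** _"] sum_distrib_left sum_negf)
    also have "(frm x ** (DZ x y ** frm x)) *v ?\<eta> = frm x *v acc x y"
      by (simp only: acc_eq matrix_vector_mul_assoc[symmetric] frm_cof_vec[OF x])
    also have "(\<^bold>\<Sum>n. (sdv n x - kap n x) * (frm x *v acc x y) $ n)
      = (\<^bold>\<Sum>n p. (sdv n x - kap n x) * frm x $ n $ p * acc x y $ p)"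
      by (simp add: matrix_vector_mult_def[of "frm x"] sum_distrib_left mult.assoc)
    also have "\<dots> = (\<^bold>\<Sum>p n. (sdv n x - kap n x) * frm x $ n $ p * acc x y $ p)"
      by (rule sum.swap)
    also have "\<dots> = (\<^bold>\<Sum>p. cdv p x * acc x y $ p)"
      by (simp only: sum_distrib_right[symmetric] cdv_eq)
    finally show ?thesis .
  qed
  finally show ?thesis by (simp add: partial_sdv[OF x] partial_kap[OF x])
qed

section \<open>The four terms of the first expression in the frame\<close>

lemma trace_nonlin_conn:
  assumes x: "x \<in> W" and y: "y \<in> dom_y x"
  shows "(\<^bold>\<Sum>\<nu>. nonlin_conn F \<nu> \<nu> x y) = (\<^bold>\<Sum>\<sigma>. sdv \<sigma> x * y $ \<sigma>) - tens JC x (\<epsilon> x *v y)"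
proof -
  let ?\<eta> = "\<epsilon> x *v y"
  have "(\<^bold>\<Sum>\<nu>. nonlin_conn F \<nu> \<nu> x y) = trace (\<chi> \<mu> \<nu>. nonlin_conn F \<mu> \<nu> x y)"
    by (simp add: trace_def)
  also have "\<dots> = 1/2 * trace (frm x ** (DX x y + DZ x y + Hm x ?\<eta> ** \<epsilon> x))"
    by (simp add: nonlin_conn_mat[OF x y] trace_scaleR)
  also have "\<dots> = 1/2 * trace ((DX x y + DZ x y + Hm x ?\<eta> ** \<epsilon> x) ** frm x)"
    by (subst trace_mul_sym) (rule refl)
  also have "(DX x y + DZ x y + Hm x ?\<eta> ** \<epsilon> x) ** frm x = DX x y ** frm x + DZ x y ** frm x + Hm x ?\<eta>"
    by (simp add: matrix_add_rdistrib matrix_mul_assoc[symmetric] frm_cof[OF x])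
  also have "trace \<dots> = trace (DX x y ** frm x) + trace (DZ x y ** frm x) + trace (Hm x ?\<eta>)"
    by (simp only: trace_add)
  \<comment> \<open>The trace of W is tr Z - tr X, with X and Z the matrices DX and DZ times frm. It
    cancels tr X and doubles tr Z, and the factor 1/2 restores tr Z - J.\<close>
  also have "trace (Hm x ?\<eta>) = - 2 * tens JC x ?\<eta> + trace (Wm x ?\<eta>)"
    by (simp only: trace_Hm[OF dom_xy(4)[OF y]]) (simp add: trace_def Wm_def)
  also have "trace (Wm x ?\<eta>) = trace (DZ x y ** frm x) - trace (DX x y ** frm x)"
    by (simp add: Wm_eq[OF x] matrix_sub_rdistrib trace_sub)
  also have "trace (DZ x y ** frm x) = (\<^bold>\<Sum>\<sigma>. sdv \<sigma> x * y $ \<sigma>)"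
  proof -
    have "trace (DZ x y ** frm x) = (\<^bold>\<Sum>m \<rho> \<sigma>. frm x $ \<rho> $ m * dcof \<sigma> m \<rho> x * y $ \<sigma>)"
      by (simp add: trace_mult_sum DZ_def sum_distrib_right sum_distrib_left mult_ac)
    also have "\<dots> = (\<^bold>\<Sum>m \<sigma> \<rho>. frm x $ \<rho> $ m * dcof \<sigma> m \<rho> x * y $ \<sigma>)"
      by (rule sum.cong[OF refl], rule sum.swap)
    also have "\<dots> = (\<^bold>\<Sum>\<sigma> m \<rho>. frm x $ \<rho> $ m * dcof \<sigma> m \<rho> x * y $ \<sigma>)"
      by (rule sum.swap)
    finally show ?thesis by (simp only: sum_distrib_right[symmetric] sdv_def)
  qed
  finally show ?thesis by simp
qed

lemma px_trace_nonlin_conn: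
  assumes x: "x \<in> W" and y: "y \<in> dom_y x"
  shows "(\<^bold>\<Sum>\<nu>. px \<mu> (nonlin_conn F \<nu> \<nu>) x y) = (\<^bold>\<Sum>\<sigma>. partial \<mu> (sdv \<sigma>) x * y $ \<sigma>)
     - (\<^bold>\<Sum>d i k. JC d i k (\<epsilon> x *v y) * partial \<mu> (strc i d k) x)
     - (\<^bold>\<Sum>b. partial b (tens JC x) (\<epsilon> x *v y) * DX x y $ b $ \<mu>)"
proof -
  have "(\<^bold>\<Sum>\<nu>. px \<mu> (nonlin_conn F \<nu> \<nu>) x y) = partial \<mu> (\<lambda>x. \<^bold>\<Sum>\<nu>. nonlin_conn F \<nu> \<nu> x y) x"
    by (simp add: px_def partial_sum nonlin_conn_diff_x x y)
  also have "\<dots> = partial \<mu> (\<lambda>x. (\<^bold>\<Sum>\<sigma>. sdv \<sigma> x * y $ \<sigma>) - tens JC x (\<epsilon> x *v y)) x"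
    by (rule partial_cong_open[OF open_dom_x dom_xy(1)[OF x y]], rule trace_nonlin_conn, erule dom_xy(2), erule dom_xy(3))
  also have "\<dots> = (\<^bold>\<Sum>\<sigma>. partial \<mu> (sdv \<sigma>) x * y $ \<sigma>) - partial \<mu> (\<lambda>x. tens JC x (\<epsilon> x *v y)) x"
    by (simp add: partial_diff partial_sum partial_multc sdv_diff[OF x] tens_comp_x(1)[OF x] cone_diff[OF dom_xy(4)[OF y]])
  finally show ?thesis by (simp add: tens_comp_x(2)[OF x] cone_diff[OF dom_xy(4)[OF y]])
qed

lemma py_trace_nonlin_conn:
  assumes x: "x \<in> W" and y: "y \<in> dom_y x"
  shows "(\<^bold>\<Sum>\<nu>. py \<mu> (nonlin_conn F \<nu> \<nu>) x y) = sdv \<mu> x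
     - (\<^bold>\<Sum>b. partial b (tens JC x) (\<epsilon> x *v y) * \<epsilon> x $ b $ \<mu>)"
proof -
  have "(\<^bold>\<Sum>\<nu>. py \<mu> (nonlin_conn F \<nu> \<nu>) x y) = partial \<mu> (\<lambda>y. \<^bold>\<Sum>\<nu>. nonlin_conn F \<nu> \<nu> x y) y"
    by (simp add: py_def partial_sum nonlin_conn_diff_y x y)
  also have "\<dots> = partial \<mu> (\<lambda>y. (\<^bold>\<Sum>\<sigma>. sdv \<sigma> x * y $ \<sigma>) - tens JC x (\<epsilon> x *v y)) y"
    by (rule partial_cong_open[OF open_dom_y y], rule trace_nonlin_conn[OF x])
  also have "\<dots> = sdv \<mu> x - partial \<mu> (\<lambda>y. tens JC x (\<epsilon> x *v y)) y"
    by (simp add: partial_diff partial_sum partial_cmult partial_nth nth_diff tens_comp_y(1) cone_diff[OF dom_xy(4)[OF y]] sum_kron)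
  finally show ?thesis by (simp add: tens_comp_y(2) cone_diff[OF dom_xy(4)[OF y]])
qed

lemma tens_deriv_contract:
  assumes x: "x \<in> W"
  shows "(\<^bold>\<Sum>\<mu>. y $ \<mu> * (\<^bold>\<Sum>d i k. \<Phi> d i k * partial \<mu> (strc i d k) x))
    = (\<^bold>\<Sum>c. (\<epsilon> x *v y) $ c * (\<^bold>\<Sum>d i k. \<Phi> d i k * dstr i d k c x))"
proof -
  have swap: "(\<^bold>\<Sum>\<mu>. z \<mu> * (\<^bold>\<Sum>d i k. \<Phi> d i k * q \<mu> i d k))
    = (\<^bold>\<Sum>d i k. \<Phi> d i k * (\<^bold>\<Sum>\<mu>. z \<mu> * q \<mu> i d k))" for z :: "'m \<Rightarrow> real" and q
  proof -
    have "(\<^bold>\<Sum>\<mu>. z \<mu> * (\<^bold>\<Sum>d i k. \<Phi> d i k * q \<mu> i d k))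
      = (\<^bold>\<Sum>\<mu> d i k. \<Phi> d i k * (z \<mu> * q \<mu> i d k))"
      by (simp add: sum_distrib_left mult_ac)
    also have "\<dots> = (\<^bold>\<Sum>d \<mu> i k. \<Phi> d i k * (z \<mu> * q \<mu> i d k))"
      by (rule sum.swap)
    also have "\<dots> = (\<^bold>\<Sum>d i \<mu> k. \<Phi> d i k * (z \<mu> * q \<mu> i d k))"
      by (rule sum.cong[OF refl], rule sum.swap)
    also have "\<dots> = (\<^bold>\<Sum>d i k \<mu>. \<Phi> d i k * (z \<mu> * q \<mu> i d k))"
      by (rule sum.cong[OF refl], rule sum.cong[OF refl], rule sum.swap)
    finally show ?thesis by (simp only: sum_distrib_left)
  qed
  show ?thesis unfolding swap dstr_contract[OF x] ..
qed

lemma y_px_trace: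
  assumes x: "x \<in> W" and y: "y \<in> dom_y x"
  shows "(\<^bold>\<Sum>\<mu>. y $ \<mu> * (\<^bold>\<Sum>\<nu>. px \<mu> (nonlin_conn F \<nu> \<nu>) x y))
    = - trace (DZ x y ** frm x ** (DZ x y ** frm x)) + \<beta>2 x y
      - (\<^bold>\<Sum>c. (\<epsilon> x *v y) $ c * (\<^bold>\<Sum>d i k. JC d i k (\<epsilon> x *v y) * dstr i d k c x))
      - (\<^bold>\<Sum>b. partial b (tens JC x) (\<epsilon> x *v y) * acc x y $ b)" (is "?lhs = _")
proof -
  let ?J = "\<lambda>b. partial b (tens JC x) (\<epsilon> x *v y)"
  have "?lhs
    = (\<^bold>\<Sum>\<mu> \<sigma>. y $ \<mu> * y $ \<sigma> * partial \<mu> (sdv \<sigma>) x)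
      - (\<^bold>\<Sum>\<mu>. y $ \<mu> * (\<^bold>\<Sum>d i k. JC d i k (\<epsilon> x *v y) * partial \<mu> (strc i d k) x))
      - (\<^bold>\<Sum>\<mu> b. ?J b * (DX x y $ b $ \<mu> * y $ \<mu>))"
    unfolding px_trace_nonlin_conn[OF x y] right_diff_distrib sum_subtractf
    by (simp add: sum_distrib_left mult_ac)
  also have "(\<^bold>\<Sum>\<mu> b. ?J b * (DX x y $ b $ \<mu> * y $ \<mu>)) = (\<^bold>\<Sum>b \<mu>. ?J b * (DX x y $ b $ \<mu> * y $ \<mu>))"
    by (rule sum.swap)
  also have "\<dots> = (\<^bold>\<Sum>b. ?J b * acc x y $ b)"
    by (simp add: acc_def matrix_vector_mult_def sum_distrib_left)
  finally show ?thesis by (simp only: partial_sdv[OF x] tens_deriv_contract[OF x])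
qed

lemma G_py_trace:
  assumes x: "x \<in> W" and y: "y \<in> dom_y x"
  shows "2 * (\<^bold>\<Sum>\<mu>. spray F \<mu> x y * (\<^bold>\<Sum>\<nu>. py \<mu> (nonlin_conn F \<nu> \<nu>) x y))
    = (\<^bold>\<Sum>\<mu>. (frm x *v (acc x y + Hv x (\<epsilon> x *v y))) $ \<mu> * sdv \<mu> x)
      - (\<^bold>\<Sum>b. partial b (tens JC x) (\<epsilon> x *v y) * (acc x y + Hv x (\<epsilon> x *v y)) $ b)"
proof -
  let ?J = "\<lambda>b. partial b (tens JC x) (\<epsilon> x *v y)"
  let ?k = "acc x y + Hv x (\<epsilon> x *v y)"
  have s: "2 * spray F \<mu> x y = (frm x *v ?k) $ \<mu>" for \<mu>
    using spray_vec[OF x y] by (simp add: vec_eq_iff mult.commute)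
  have "2 * (\<^bold>\<Sum>\<mu>. spray F \<mu> x y * (\<^bold>\<Sum>\<nu>. py \<mu> (nonlin_conn F \<nu> \<nu>) x y))
    = (\<^bold>\<Sum>\<mu>. (frm x *v ?k) $ \<mu> * (sdv \<mu> x - (\<^bold>\<Sum>b. ?J b * \<epsilon> x $ b $ \<mu>)))"
    by (simp only: sum_distrib_left mult.assoc[symmetric] s py_trace_nonlin_conn[OF x y])
  also have "\<dots> = (\<^bold>\<Sum>\<mu>. (frm x *v ?k) $ \<mu> * sdv \<mu> x) - (\<^bold>\<Sum>\<mu> b. ?J b * (\<epsilon> x $ b $ \<mu> * (frm x *v ?k) $ \<mu>))"
    unfolding right_diff_distrib sum_subtractf by (simp add: sum_distrib_left mult_ac)
  also have "(\<^bold>\<Sum>\<mu> b. ?J b * (\<epsilon> x $ b $ \<mu> * (frm x *v ?k) $ \<mu>)) = (\<^bold>\<Sum>b \<mu>. ?J b * (\<epsilon> x $ b $ \<mu> * (frm x *v ?k) $ \<mu>))"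
    by (rule sum.swap)
  also have "\<dots> = (\<^bold>\<Sum>b. ?J b * (\<epsilon> x *v (frm x *v ?k)) $ b)"
    by (simp add: matrix_vector_mult_def[of "\<epsilon> x"] sum_distrib_left)
  also have "\<epsilon> x *v (frm x *v ?k) = ?k"
    by (simp add: matrix_vector_mul_assoc frm_cof[OF x])
  finally show ?thesis .
qed

lemma nonlin_conn_trace_square:
  assumes x: "x \<in> W" and y: "y \<in> dom_y x"
  shows "(\<^bold>\<Sum>\<mu> \<nu>. nonlin_conn F \<mu> \<nu> x y * nonlin_conn F \<nu> \<mu> x y)
    = 1/4 * trace ((DX x y ** frm x + DZ x y ** frm x + Hm x (\<epsilon> x *v y)) ** (DX x y ** frm x + DZ x y ** frm x + Hm x (\<epsilon> x *v y)))"
proof -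
  let ?K = "DX x y + DZ x y + Hm x (\<epsilon> x *v y) ** \<epsilon> x"
  let ?N = "(\<chi> \<mu> \<nu>. nonlin_conn F \<mu> \<nu> x y) :: real^'m^'m"
  have K: "?K ** frm x = DX x y ** frm x + DZ x y ** frm x + Hm x (\<epsilon> x *v y)"
    by (simp add: matrix_add_rdistrib matrix_mul_assoc[symmetric] frm_cof[OF x])
  have "(\<^bold>\<Sum>\<mu> \<nu>. nonlin_conn F \<mu> \<nu> x y * nonlin_conn F \<nu> \<mu> x y) = trace (?N ** ?N)"
    by (simp add: trace_mult_sum)
  also have "\<dots> = 1/4 * trace (frm x ** ?K ** (frm x ** ?K))"
  proof -
    have "((1/2) *\<^sub>R A) ** ((1/2) *\<^sub>R A) = (1/4) *\<^sub>R (A ** A)" for A :: "real^'m^'m"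
      by (simp add: matrix_matrix_mult_def vec_eq_iff sum_distrib_left)
    then show ?thesis by (simp only: nonlin_conn_mat[OF x y] trace_scaleR)
  qed
  also have "trace (frm x ** ?K ** (frm x ** ?K)) = trace (frm x ** (?K ** (frm x ** ?K)))"
    by (simp only: matrix_mul_assoc)
  also have "\<dots> = trace (?K ** (frm x ** ?K) ** frm x)"
    by (rule trace_mul_sym)
  also have "?K ** (frm x ** ?K) ** frm x = (?K ** frm x) ** (?K ** frm x)"
    by (simp only: matrix_mul_assoc)
  finally show ?thesis by (simp only: K)
qed

text \<open>The x-derivative of frm (v + H) falls on four places: on the frame, giving
  \<open>kap\<close>; on the coframe derivative in v, giving \<open>\<beta>1\<close>; on the
  structure coefficients in H, giving \<open>dstr\<close>; and on \<eta> inside H, giving the trace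
  of \<open>Hm\<close> with \<open>DX\<close>.\<close>

lemma px_spray_div:
  assumes x: "x \<in> W" and y: "y \<in> dom_y x"
  shows "2 * (\<^bold>\<Sum>\<mu>. px \<mu> (spray F \<mu>) x y)
    = - (\<^bold>\<Sum>\<mu>. (frm x *v (acc x y + Hv x (\<epsilon> x *v y))) $ \<mu> * kap \<mu> x) + \<beta>1 x y
      + (\<^bold>\<Sum>a d i k. HC a d i k (\<epsilon> x *v y) * dstr i d k a x)
      + trace (Hm x (\<epsilon> x *v y) ** (DX x y ** frm x))"
proof -
  let ?\<eta> = "\<epsilon> x *v y"
  let ?k = "acc x y + Hv x ?\<eta>"
  note cd = cone_diff[OF dom_xy(4)[OF y]]
  have "2 * px \<mu> (spray F \<mu>) x y = (\<^bold>\<Sum>a. partial \<mu> (\<lambda>x. frm x $ \<mu> $ a) x * ?k $ a)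
     + (\<^bold>\<Sum>a. frm x $ \<mu> $ a * (\<^bold>\<Sum>\<rho> \<nu>. ddcof \<mu> \<rho> a \<nu> x * y $ \<nu> * y $ \<rho>))
     + (\<^bold>\<Sum>a. frm x $ \<mu> $ a * (\<^bold>\<Sum>d i k. HC a d i k ?\<eta> * partial \<mu> (strc i d k) x))
     + (\<^bold>\<Sum>a. frm x $ \<mu> $ a * (\<^bold>\<Sum>b. Hm x ?\<eta> $ a $ b * DX x y $ b $ \<mu>))" for \<mu>
  proof -
    have "px \<mu> (spray F \<mu>) x y = partial \<mu> (\<lambda>x. 1/2 * (\<^bold>\<Sum>a. frm x $ \<mu> $ a * (acc x y $ a + tens (HC a) x (\<epsilon> x *v y)))) x"
      unfolding px_def
      by (rule partial_cong_open[OF open_dom_x dom_xy(1)[OF x y]], rule spray_eq, erule dom_xy(2), erule dom_xy(3))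
    also have "\<dots> = 1/2 * partial \<mu> (\<lambda>x. \<^bold>\<Sum>a. frm x $ \<mu> $ a * (acc x y $ a + tens (HC a) x (\<epsilon> x *v y))) x"
      by (rule partial_cmult) (simp add: W_diff[OF x] acc_diff_x[OF x] tens_comp_x(1)[OF x] cd)
    also have "partial \<mu> (\<lambda>x. \<^bold>\<Sum>a. frm x $ \<mu> $ a * (acc x y $ a + tens (HC a) x (\<epsilon> x *v y))) x
      = (\<^bold>\<Sum>a. partial \<mu> (\<lambda>x. frm x $ \<mu> $ a) x * ?k $ a + frm x $ \<mu> $ a *
        ((\<^bold>\<Sum>\<rho> \<nu>. ddcof \<mu> \<rho> a \<nu> x * y $ \<nu> * y $ \<rho>)
         + ((\<^bold>\<Sum>d i k. HC a d i k ?\<eta> * partial \<mu> (strc i d k) x)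
         + (\<^bold>\<Sum>b. Hm x ?\<eta> $ a $ b * DX x y $ b $ \<mu>))))"
      by (simp add: partial_sum partial_mult partial_add W_diff[OF x] acc_diff_x[OF x] tens_comp_x[OF x] cd Hv_def Hm_def)
    finally show ?thesis by (simp only: distrib_left sum.distrib)
  qed
  then have "2 * (\<^bold>\<Sum>\<mu>. px \<mu> (spray F \<mu>) x y) =
     (\<^bold>\<Sum>\<mu> a. partial \<mu> (\<lambda>x. frm x $ \<mu> $ a) x * ?k $ a)
     + (\<^bold>\<Sum>\<mu> a. frm x $ \<mu> $ a * (\<^bold>\<Sum>\<rho> \<nu>. ddcof \<mu> \<rho> a \<nu> x * y $ \<nu> * y $ \<rho>))
     + (\<^bold>\<Sum>\<mu> a. frm x $ \<mu> $ a * (\<^bold>\<Sum>d i k. HC a d i k ?\<eta> * partial \<mu> (strc i d k) x))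
     + (\<^bold>\<Sum>\<mu> a. frm x $ \<mu> $ a * (\<^bold>\<Sum>b. Hm x ?\<eta> $ a $ b * DX x y $ b $ \<mu>))"
    by (simp add: sum_distrib_left sum.distrib)
  also have "(\<^bold>\<Sum>\<mu> a. frm x $ \<mu> $ a * (\<^bold>\<Sum>b. Hm x ?\<eta> $ a $ b * DX x y $ b $ \<mu>)) = trace (Hm x ?\<eta> ** (DX x y ** frm x))"
  proof -
    have "trace (Hm x ?\<eta> ** (DX x y ** frm x)) = trace (frm x ** (Hm x ?\<eta> ** DX x y))"
      by (subst trace_mul_sym[of "frm x"]) (simp add: matrix_mul_assoc)
    then show ?thesis by (simp add: trace_mult_sum[of "frm x"] matrix_matrix_mult_def[of "Hm x _"])
  qed
  also have "(\<^bold>\<Sum>\<mu> a. frm x $ \<mu> $ a * (\<^bold>\<Sum>\<rho> \<nu>. ddcof \<mu> \<rho> a \<nu> x * y $ \<nu> * y $ \<rho>)) = \<beta>1 x y"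
    unfolding \<beta>1_def by (subst sum.swap) (simp add: sum_distrib_left mult_ac)
  also have "(\<^bold>\<Sum>\<mu> a. frm x $ \<mu> $ a * (\<^bold>\<Sum>d i k. HC a d i k ?\<eta> * partial \<mu> (strc i d k) x))
    = (\<^bold>\<Sum>a d i k. HC a d i k ?\<eta> * dstr i d k a x)"
  proof -
    have "(\<^bold>\<Sum>\<mu> a. frm x $ \<mu> $ a * (\<^bold>\<Sum>d i k. HC a d i k ?\<eta> * partial \<mu> (strc i d k) x))
      = (\<^bold>\<Sum>a \<mu> d i k. HC a d i k ?\<eta> * (frm x $ \<mu> $ a * partial \<mu> (strc i d k) x))"
      by (subst sum.swap) (simp add: sum_distrib_left mult_ac)
    also have "\<dots> = (\<^bold>\<Sum>a d \<mu> i k. HC a d i k ?\<eta> * (frm x $ \<mu> $ a * partial \<mu> (strc i d k) x))"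
      by (rule sum.cong[OF refl], rule sum.swap)
    also have "\<dots> = (\<^bold>\<Sum>a d i \<mu> k. HC a d i k ?\<eta> * (frm x $ \<mu> $ a * partial \<mu> (strc i d k) x))"
      by (rule sum.cong[OF refl], rule sum.cong[OF refl], rule sum.swap)
    also have "\<dots> = (\<^bold>\<Sum>a d i k \<mu>. HC a d i k ?\<eta> * (frm x $ \<mu> $ a * partial \<mu> (strc i d k) x))"
      by (rule sum.cong[OF refl], rule sum.cong[OF refl], rule sum.cong[OF refl], rule sum.swap)
    finally show ?thesis by (simp only: sum_distrib_left dstr_def)
  qed
  also have "(\<^bold>\<Sum>\<mu> a. partial \<mu> (\<lambda>x. frm x $ \<mu> $ a) x * ?k $ a) = - (\<^bold>\<Sum>\<mu>. (frm x *v ?k) $ \<mu> * kap \<mu> x)"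
  proof -
    have "(\<^bold>\<Sum>\<mu> a. partial \<mu> (\<lambda>x. frm x $ \<mu> $ a) x * ?k $ a)
      = - (\<^bold>\<Sum>\<mu> a m n. frm x $ \<mu> $ m * dcof \<mu> m n x * (frm x $ n $ a * ?k $ a))"
      by (simp add: partial_frm[OF x] sum_distrib_right sum_distrib_left sum_negf mult_ac del: vector_add_component)
    also have "(\<^bold>\<Sum>\<mu> a m n. frm x $ \<mu> $ m * dcof \<mu> m n x * (frm x $ n $ a * ?k $ a))
      = (\<^bold>\<Sum>\<mu> m n a. frm x $ \<mu> $ m * dcof \<mu> m n x * (frm x $ n $ a * ?k $ a))"
      by (rule sum.cong[OF refl], subst sum.swap, rule sum.cong[OF refl], rule sum.swap)
    also have "\<dots> = (\<^bold>\<Sum>\<mu> m n. frm x $ \<mu> $ m * dcof \<mu> m n x * (frm x *v ?k) $ n)"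
      by (simp only: sum_distrib_left[symmetric] matrix_vector_mult_def vec_lambda_beta)
    also have "\<dots> = (\<^bold>\<Sum>\<mu> n m. frm x $ \<mu> $ m * dcof \<mu> m n x * (frm x *v ?k) $ n)"
      by (rule sum.cong[OF refl], rule sum.swap)
    also have "\<dots> = (\<^bold>\<Sum>n \<mu> m. frm x $ \<mu> $ m * dcof \<mu> m n x * (frm x *v ?k) $ n)"
      by (rule sum.swap)
    also have "\<dots> = (\<^bold>\<Sum>n m \<mu>. frm x $ \<mu> $ m * dcof \<mu> m n x * (frm x *v ?k) $ n)"
      by (rule sum.cong[OF refl], rule sum.swap)
    also have "\<dots> = (\<^bold>\<Sum>n. (frm x *v ?k) $ n * kap n x)"
      by (simp only: sum_distrib_right[symmetric] kap_def mult.commute)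
    finally show ?thesis .
  qed
  finally show ?thesis by simp
qed

text \<open>\<open>sdv\<close> and \<open>kap\<close> merge into \<open>cdv\<close>. The second
  derivatives of the coframe and the product of \<open>cdv\<close> with v are absorbed by
  \<open>dstr_trace\<close>. The derivative of J along v enters through \<open>y_px_trace\<close>
  and \<open>G_py_trace\<close> with opposite signs. What is left of the coframe derivatives sits in
  traces of products of two matrices.\<close>

lemma Ric_frame:
  assumes x: "x \<in> W" and y: "y \<in> dom_y x"
  defines "\<eta> \<equiv> \<epsilon> x *v y"
  defines "Q \<equiv> Wm x \<eta> + Hm x \<eta>"
  shows "Ric F x y = (\<^bold>\<Sum>a d i k. HC a d i k \<eta> * dstr i d k a x)
    - (\<^bold>\<Sum>a b c. \<eta> $ b * (\<eta> $ c * dstr a a b c x))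
    + (\<^bold>\<Sum>c. \<eta> $ c * (\<^bold>\<Sum>d i k. JC d i k \<eta> * dstr i d k c x))
    + (\<^bold>\<Sum>a. cdv a x * Hv x \<eta> $ a)
    - (\<^bold>\<Sum>b. partial b (tens JC x) \<eta> * Hv x \<eta> $ b)
    - 1/4 * trace (Q ** Q)"
proof -
  let ?X = "DX x y ** frm x" and ?Z = "DZ x y ** frm x"
  let ?k = "acc x y + Hv x \<eta>"
  have Z: "?Z = ?X + Wm x \<eta>"
    using Wm_eq[OF x, of y] by (simp add: \<eta>_def matrix_sub_rdistrib)
  have c1: "(\<^bold>\<Sum>\<mu>. (frm x *v k) $ \<mu> * sdv \<mu> x) - (\<^bold>\<Sum>\<mu>. (frm x *v k) $ \<mu> * kap \<mu> x) = (\<^bold>\<Sum>a. cdv a x * k $ a)" for k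
  proof -
    have "(\<^bold>\<Sum>\<mu>. (frm x *v k) $ \<mu> * sdv \<mu> x) - (\<^bold>\<Sum>\<mu>. (frm x *v k) $ \<mu> * kap \<mu> x)
      = (\<^bold>\<Sum>\<mu> a. (sdv \<mu> x - kap \<mu> x) * frm x $ \<mu> $ a * k $ a)"
      by (simp add: sum_subtractf[symmetric] matrix_vector_mult_def[of "frm x"]
          sum_distrib_right sum_distrib_left algebra_simps)
    also have "\<dots> = (\<^bold>\<Sum>a \<mu>. (sdv \<mu> x - kap \<mu> x) * frm x $ \<mu> $ a * k $ a)"
      by (rule sum.swap)
    finally show ?thesis by (simp only: sum_distrib_right[symmetric] cdv_eq)
  qed
  have c2: "(\<^bold>\<Sum>a. cdv a x * ?k $ a) = (\<^bold>\<Sum>p. cdv p x * acc x y $ p) + (\<^bold>\<Sum>a. cdv a x * Hv x \<eta> $ a)"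
    "(\<^bold>\<Sum>b. partial b (tens JC x) \<eta> * ?k $ b) = (\<^bold>\<Sum>b. partial b (tens JC x) \<eta> * acc x y $ b) + (\<^bold>\<Sum>b. partial b (tens JC x) \<eta> * Hv x \<eta> $ b)"
    by (simp_all add: distrib_left sum.distrib)
  \<comment> \<open>Completing the square: since Z = X + W, the sum X + Z + H' with H' =
    \<open>Hm x \<eta>\<close> equals 2 X + Q. The terms tr (X^2) and tr (Q X) of its square cancel
    against the two traces in front, so X disappears.\<close>
  have tr: "trace (?Z ** ?X) + trace (Hm x \<eta> ** ?X) - 1/4 * trace ((?X + ?Z + Hm x \<eta>) ** (?X + ?Z + Hm x \<eta>)) = - 1/4 * trace (Q ** Q)"
  proof -
    have e: "?X + ?Z + Hm x \<eta> = ?X + ?X + Q" by (simp add: Z Q_def)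
    have e1: "trace ((?X + ?X + Q) ** (?X + ?X + Q)) = 4 * trace (?X ** ?X) + 2 * trace (Q ** ?X) + 2 * trace (?X ** Q) + trace (Q ** Q)"
      by (simp only: matrix_add_rdistrib matrix_add_ldistrib trace_add)
    have e2: "trace (?X ** Q) = trace (Q ** ?X)" by (rule trace_mul_sym)
    have e3: "trace (?Z ** ?X) + trace (Hm x \<eta> ** ?X) = trace (?X ** ?X) + trace (Q ** ?X)"
      by (simp only: Z Q_def matrix_add_rdistrib trace_add)
    show ?thesis unfolding e using e1 e2 e3 by linarith
  qed
  have "Ric F x y = 2 * (\<^bold>\<Sum>\<mu>. px \<mu> (spray F \<mu>) x y)
       - (\<^bold>\<Sum>\<mu>. y $ \<mu> * (\<^bold>\<Sum>\<nu>. px \<mu> (nonlin_conn F \<nu> \<nu>) x y))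
       + 2 * (\<^bold>\<Sum>\<mu>. spray F \<mu> x y * (\<^bold>\<Sum>\<nu>. py \<mu> (nonlin_conn F \<nu> \<nu>) x y))
       - (\<^bold>\<Sum>\<mu> \<nu>. nonlin_conn F \<mu> \<nu> x y * nonlin_conn F \<nu> \<mu> x y)"
    unfolding Ric_spray[OF x y] by (simp only: sum_distrib_left nonlin_conn_def)
  then show ?thesis
    unfolding px_spray_div[OF x y] y_px_trace[OF x y] G_py_trace[OF x y] nonlin_conn_trace_square[OF x y]
    using c1[of ?k] c2 tr dstr_trace[OF x, of y] unfolding \<eta>_def[symmetric] by linarith
qed

section \<open>Contractions with the structure coefficients\<close>

text \<open>
  \<open>Gm\<close> is \<open>Wm\<close> with its first index lowered, \<open>FF x \<eta> $ d $ k\<close> is \<open>y\<^sub>i c\<^sup>i\<^sub>d\<^sub>k\<close>, \<open>Pv\<close> is \<open>P\<^sub>d\<close>,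
  \<open>CH x \<eta> $ m $ b\<close> is \<open>C\<^sub>b\<^sub>m\<^sub>n H\<^sup>n\<close> (\<open>Bm\<close> below: with \<open>m\<close> raised) and \<open>cl x \<eta> a j k\<close> is \<open>g\<^sub>i\<^sub>a c\<^sup>i\<^sub>j\<^sub>k\<close>.
\<close>

definition Gm :: "real^'m \<Rightarrow> real^'m \<Rightarrow> real^'m^'m" where
  "Gm x \<eta> = gm \<eta> ** Wm x \<eta>"

definition FF :: "real^'m \<Rightarrow> real^'m \<Rightarrow> real^'m^'m" where
  "FF x \<eta> = (\<chi> d k. \<^bold>\<Sum>i. partial i f \<eta> * strc i d k x)"

definition Pv :: "real^'m \<Rightarrow> real^'m \<Rightarrow> real^'m" where
  "Pv x \<eta> = FF x \<eta> *v \<eta>"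

definition CH :: "real^'m \<Rightarrow> real^'m \<Rightarrow> real^'m^'m" where
  "CH x \<eta> = (\<chi> m b. \<^bold>\<Sum>n. cartan f b m n \<eta> * Hv x \<eta> $ n)"

definition cl :: "real^'m \<Rightarrow> real^'m \<Rightarrow> 'm \<Rightarrow> 'm \<Rightarrow> 'm \<Rightarrow> real" where
  "cl x \<eta> a j k = (\<^bold>\<Sum>i. gm \<eta> $ i $ a * strc i j k x)"

section \<open>The derivative of H as a matrix and the trace of Q^2\<close>

lemma Pv_eq: "Pv x \<eta> = transpose (Wm x \<eta>) *v gradf \<eta>"
proof -
  have "(FF x \<eta> *v \<eta>) $ d = (transpose (Wm x \<eta>) *v gradf \<eta>) $ d" for d
    unfolding FF_def Wm_def gradf_def transpose_def matrix_vector_mult_def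
    by (simp add: sum_distrib_left sum_distrib_right) (subst sum.swap, simp add: mult_ac)
  then show ?thesis by (simp add: Pv_def vec_eq_iff del: transpose_matrix_vector)
qed

lemma Hv_Pv: "Hv x \<eta> = hm \<eta> *v Pv x \<eta>"
  by (simp add: Hv_eq Pv_eq del: transpose_matrix_vector)

lemma tens_Pv: "tens (\<lambda>d i k \<eta>. p d \<eta> * partial i f \<eta> * \<eta> $ k) x \<eta> = (\<^bold>\<Sum>d. p d \<eta> * Pv x \<eta> $ d)"
  by (simp add: tens_split Pv_eq del: transpose_matrix_vector)

lemma FF_antisym: "FF x \<eta> $ d $ k = - FF x \<eta> $ k $ d"
  unfolding FF_def by (simp add: sum_negf[symmetric]) (subst strc_antisym, simp)

lemma transpose_FF: "transpose (FF x \<eta>) = - FF x \<eta>"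
  by (simp add: vec_eq_iff transpose_def) (metis FF_antisym)

lemma Wm_hm_Gm: "\<eta> \<in> \<omega> \<Longrightarrow> Wm x \<eta> = hm \<eta> ** Gm x \<eta>"
  by (simp add: Gm_def matrix_mul_assoc hm_gm)

text \<open>In a coefficient of the form p_d y_i \<eta>^k a derivative can fall on p, on y_i or on
  \<eta>^k. \<open>tens_Pv\<close>, this lemma and \<open>tens_last\<close> evaluate the three
  cases, for \<open>HC\<close> and \<open>JC\<close> alike.\<close>

lemma tens_middle: "tens (\<lambda>d i k \<eta>. p d * gm \<eta> $ b $ i * \<eta> $ k) x \<eta> = (\<^bold>\<Sum>d. p d * Gm x \<eta> $ b $ d)"
  by (simp add: tens_def Gm_def Wm_def matrix_matrix_mult_def sum_distrib_left mult_ac)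

lemma tens_last: "tens (\<lambda>d i k \<eta>. p d * partial i f \<eta> * (if b = k then 1 else 0)) x \<eta> = (\<^bold>\<Sum>d. p d * FF x \<eta> $ d $ b)"
proof -
  have "(\<^bold>\<Sum>k. p d * partial i f \<eta> * (if b = k then 1 else 0) * strc i d k x) = p d * partial i f \<eta> * strc i d b x" for d i
    using sum_kron(2)[of "\<lambda>k. p d * partial i f \<eta> * strc i d k x" b] by (simp add: mult_ac)
  then show ?thesis by (simp add: tens_def FF_def sum_distrib_left mult_ac)
qed

lemma tens_plus: "tens (\<lambda>d i k \<eta>. \<Phi> d i k \<eta> + \<Psi> d i k \<eta>) x \<eta> = tens \<Phi> x \<eta> + tens \<Psi> x \<eta>"
  by (simp add: tens_def distrib_right sum.distrib)

lemma tens_cong: "(\<And>d i k. \<Phi> d i k \<eta> = \<Psi> d i k \<eta>) \<Longrightarrow> tens \<Phi> x \<eta> = tens \<Psi> x \<eta>"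
  by (simp add: tens_def)

text \<open>Every summand keeps \<open>hm \<eta>\<close> on the left. Together with
  \<open>Wm_hm_Gm\<close> this makes Q equal to \<open>hm \<eta>\<close> times a lowered matrix
  whose symmetric part, - 2 CH + Gm + Gm^T, and antisymmetric part, FF, can be read off.\<close>

lemma Hm_eq:
  assumes \<eta>: "\<eta> \<in> \<omega>"
  shows "Hm x \<eta> = (- 2) *\<^sub>R (hm \<eta> ** CH x \<eta>) + hm \<eta> ** transpose (Gm x \<eta>) + hm \<eta> ** FF x \<eta>"
proof -
  have "Hm x \<eta> $ a $ b = (- 2) * (hm \<eta> ** CH x \<eta>) $ a $ b + (hm \<eta> ** transpose (Gm x \<eta>)) $ a $ b + (hm \<eta> ** FF x \<eta>) $ a $ b" for a b
  proof -
    have "Hm x \<eta> $ a $ b = tens (\<lambda>d i k \<eta>'. (partial b (\<lambda>\<eta>. hm \<eta> $ a $ d) \<eta>' * partial i f \<eta>' * \<eta>' $ k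
        + hm \<eta> $ a $ d * gm \<eta>' $ b $ i * \<eta>' $ k) + hm \<eta> $ a $ d * partial i f \<eta>' * (if b = k then 1 else 0)) x \<eta>"
      unfolding Hm_def by (simp add: partial_tens cone_diff \<eta>) (rule tens_cong, simp add: partial_HC \<eta>)
    also have "\<dots> = (\<^bold>\<Sum>d. partial b (\<lambda>\<eta>. hm \<eta> $ a $ d) \<eta> * Pv x \<eta> $ d)
      + (\<^bold>\<Sum>d. hm \<eta> $ a $ d * Gm x \<eta> $ b $ d) + (\<^bold>\<Sum>d. hm \<eta> $ a $ d * FF x \<eta> $ d $ b)"
      by (simp only: tens_plus tens_middle tens_last tens_Pv)
    also have "(\<^bold>\<Sum>d. partial b (\<lambda>\<eta>. hm \<eta> $ a $ d) \<eta> * Pv x \<eta> $ d) = (- 2) * (hm \<eta> ** CH x \<eta>) $ a $ b"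
    proof -
      have "(\<^bold>\<Sum>d. partial b (\<lambda>\<eta>. hm \<eta> $ a $ d) \<eta> * Pv x \<eta> $ d)
        = (- 2) * (\<^bold>\<Sum>d m n. hm \<eta> $ a $ m * (cartan f b m n \<eta> * (hm \<eta> $ n $ d * Pv x \<eta> $ d)))"
        by (simp add: partial_hm \<eta> sum_distrib_left sum_distrib_right sum_negf mult_ac)
      also have "(\<^bold>\<Sum>d m n. hm \<eta> $ a $ m * (cartan f b m n \<eta> * (hm \<eta> $ n $ d * Pv x \<eta> $ d)))
        = (\<^bold>\<Sum>m n d. hm \<eta> $ a $ m * (cartan f b m n \<eta> * (hm \<eta> $ n $ d * Pv x \<eta> $ d)))"
        by (subst sum.swap, rule sum.cong[OF refl], rule sum.swap)
      also have "\<dots> = (\<^bold>\<Sum>m. hm \<eta> $ a $ m * (\<^bold>\<Sum>n. cartan f b m n \<eta> * Hv x \<eta> $ n))"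
        by (simp only: sum_distrib_left[symmetric] Hv_Pv matrix_vector_mult_def vec_lambda_beta)
      finally show ?thesis by (simp add: CH_def matrix_matrix_mult_def)
    qed
    finally show ?thesis by (simp add: matrix_matrix_mult_def transpose_def)
  qed
  then show ?thesis by (simp add: vec_eq_iff)
qed

lemma transpose_CH:
  assumes \<eta>: "\<eta> \<in> \<omega>"
  shows "transpose (CH x \<eta>) = CH x \<eta>"
proof -
  have "CH x \<eta> $ m $ b = CH x \<eta> $ b $ m" for m b
    by (simp add: CH_def cartan_sym(1)[OF \<eta>, of b m])
  then show ?thesis by (simp add: transpose_def vec_eq_iff)
qed

text \<open>Transposition preserves the trace, reverses the product and changes the sign of one
  factor; cyclicity then restores the original product, so the trace equals its own
  negative.\<close>

lemma trace_sym_antisym: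
  fixes h S R :: "real^'m^'m"
  assumes "transpose h = h" "transpose S = S" "transpose R = - R"
  shows "trace (h ** S ** (h ** R)) = 0"
proof -
  have "trace (h ** S ** (h ** R)) = trace (transpose (h ** S ** (h ** R)))"
    by (simp add: trace_transpose)
  also have "transpose (h ** S ** (h ** R)) = - (R ** (h ** S ** h))"
    by (simp add: matrix_transpose_mul assms matrix_neg_mult matrix_mul_assoc)
  also have "trace \<dots> = - trace (h ** S ** h ** R)"
    by (simp add: trace_neg) (rule trace_mul_sym)
  finally show ?thesis by (simp add: matrix_mul_assoc)
qed

text \<open>The mixed terms of the symmetric part S and FF vanish by
  \<open>trace_sym_antisym\<close>. In the square of S, transposition identifies the terms with Gm
  and with its transpose: the four products of - 2 CH with them add up to the factor - 8, and the
  squares of Gm and of its transpose coincide.\<close>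

lemma trace_Q:
  fixes x :: "real^'m"
  assumes \<eta>: "\<eta> \<in> \<omega>"
  defines "h \<equiv> hm \<eta>" and "A \<equiv> hm \<eta> ** CH x \<eta>" and "Q \<equiv> Wm x \<eta> + Hm x \<eta>"
  shows "trace (Q ** Q) = 4 * trace (A ** A) + 2 * trace (h ** Gm x \<eta> ** (h ** Gm x \<eta>)) - 8 * trace (A ** (h ** Gm x \<eta>))
    + 2 * trace (h ** Gm x \<eta> ** (h ** transpose (Gm x \<eta>))) + trace (h ** FF x \<eta> ** (h ** FF x \<eta>))"
proof -
  let ?G = "Gm x \<eta>" and ?F = "FF x \<eta>" and ?C = "CH x \<eta>"
  let ?B = "h ** ?G" and ?B' = "h ** transpose ?G" and ?R = "h ** ?F"
  define S where "S = (- 2) *\<^sub>R ?C + ?G + transpose ?G"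
  have hs: "transpose h = h" using hm_sym[OF \<eta>] by (simp add: h_def)
  have Ss: "transpose S = S"
  proof -
    have "transpose (a *\<^sub>R M + N + N') = a *\<^sub>R transpose M + transpose N + transpose N'" for a and M N N' :: "real^'m^'m"
      by (simp add: transpose_def vec_eq_iff)
    then show ?thesis by (simp only: S_def transpose_CH[OF \<eta>] transpose_transpose add_ac)
  qed
  have Q1: "Q = h ** S + ?R"
    unfolding Q_def Hm_eq[OF \<eta>] Wm_hm_Gm[OF \<eta>] S_def h_def matrix_add_ldistrib matrix_scaleR_mult
    by (simp only: add_ac)
  have "trace (h ** S ** ?R) = 0" by (rule trace_sym_antisym[OF hs Ss transpose_FF])
  moreover have "trace (?R ** (h ** S)) = trace (h ** S ** ?R)" by (rule trace_mul_sym)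
  ultimately have "trace (Q ** Q) = trace (h ** S ** (h ** S)) + trace (?R ** ?R)"
    by (simp add: Q1 matrix_add_ldistrib matrix_add_rdistrib trace_add)
  also have "trace (h ** S ** (h ** S)) = 4 * trace (A ** A) + 2 * trace (?B ** ?B) - 8 * trace (A ** ?B) + 2 * trace (?B ** ?B')"
  proof -
    have hS: "h ** S = (- 2) *\<^sub>R A + ?B + ?B'"
      unfolding S_def A_def h_def matrix_add_ldistrib matrix_scaleR_mult ..
    have 1: "trace (?B' ** ?B') = trace (?B ** ?B)"
    proof -
      have "trace (?B' ** ?B') = trace (transpose (?B' ** ?B'))" by (simp add: trace_transpose)
      also have "transpose (?B' ** ?B') = (?G ** h ** ?G) ** h"
        by (simp add: matrix_transpose_mul hs matrix_mul_assoc)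
      also have "trace \<dots> = trace (h ** (?G ** h ** ?G))" by (rule trace_mul_sym)
      finally show ?thesis by (simp add: matrix_mul_assoc)
    qed
    have 2: "trace (A ** ?B') = trace (A ** ?B)"
    proof -
      have "trace (A ** ?B') = trace (transpose (A ** ?B'))" by (simp add: trace_transpose)
      also have "transpose (A ** ?B') = ?G ** h ** (transpose A)"
        by (simp add: matrix_transpose_mul hs)
      also have "transpose A = ?C ** h"
        using hs by (simp add: A_def h_def matrix_transpose_mul transpose_CH \<eta>)
      also have "?G ** h ** (?C ** h) = ?G ** (A ** h)"
        by (simp add: A_def h_def matrix_mul_assoc)
      also have "trace \<dots> = trace (A ** h ** ?G)" by (rule trace_mul_sym)
      finally show ?thesis by (simp add: matrix_mul_assoc)
    qed
    have 3: "trace (?B ** A) = trace (A ** ?B)" "trace (?B' ** A) = trace (A ** ?B')" "trace (?B' ** ?B) = trace (?B ** ?B')"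
      by (rule trace_mul_sym)+
    show ?thesis unfolding hS
      by (simp only: matrix_add_ldistrib matrix_add_rdistrib matrix_scaleR_mult trace_add trace_scaleR 1 2 3) simp
  qed
  finally show ?thesis .
qed

lemma partial_JC:
  assumes \<eta>: "\<eta> \<in> \<omega>"
  shows "partial b (tens JC x) \<eta> = (\<^bold>\<Sum>d. partial b (mean_cartan_up f d) \<eta> * Pv x \<eta> $ d)
    + (\<^bold>\<Sum>d. mean_cartan_up f d \<eta> * Gm x \<eta> $ b $ d) + (\<^bold>\<Sum>d. mean_cartan_up f d \<eta> * FF x \<eta> $ d $ b)"
proof -
  have "partial b (tens JC x) \<eta> = tens (\<lambda>d i k \<eta>'. (partial b (mean_cartan_up f d) \<eta>' * partial i f \<eta>' * \<eta>' $ k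
        + mean_cartan_up f d \<eta> * gm \<eta>' $ b $ i * \<eta>' $ k) + mean_cartan_up f d \<eta> * partial i f \<eta>' * (if b = k then 1 else 0)) x \<eta>"
    unfolding partial_tens[OF cone_diff(7)[OF \<eta>]]
    by (rule tens_cong)
       (simp add: JC_def[abs_def] partial_mult cone_diff \<eta> nth_diff partial_nth metric_mat_def algebra_simps)
  then show ?thesis by (simp only: tens_plus tens_middle tens_last tens_Pv)
qed

section \<open>Contractions of the lowered structure coefficients\<close>

lemma gm_euler:
  assumes \<eta>: "\<eta> \<in> \<omega>"
  shows "(\<^bold>\<Sum>a. gm \<eta> $ i $ a * \<eta> $ a) = partial i f \<eta>"
  using euler_homogeneous[OF cone_diff(2)[OF \<eta>], where k = 1] fd_hom[OF \<eta>] gm_swap[OF \<eta>, of i]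
  by (simp add: metric_mat_def mult.commute)

lemma cl_grad:
  assumes \<eta>: "\<eta> \<in> \<omega>"
  shows "(\<^bold>\<Sum>a. cl x \<eta> a j k * \<eta> $ a) = FF x \<eta> $ j $ k"
proof -
  have "(\<^bold>\<Sum>a. cl x \<eta> a j k * \<eta> $ a) = (\<^bold>\<Sum>a i. (gm \<eta> $ i $ a * \<eta> $ a) * strc i j k x)"
    by (simp add: cl_def sum_distrib_right sum_distrib_left mult_ac)
  also have "\<dots> = (\<^bold>\<Sum>i. (\<^bold>\<Sum>a. gm \<eta> $ i $ a * \<eta> $ a) * strc i j k x)"
    by (subst sum.swap) (simp add: sum_distrib_right)
  finally show ?thesis by (simp add: gm_euler \<eta> FF_def)
qed

text \<open>\<open>Gm\<close> and \<open>Pv\<close> contract \<eta> with the last index of c, here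
  it meets the first lower index; antisymmetry of c accounts for the minus sign here and in
  \<open>cl_first_grad\<close> and \<open>cl_trace\<close>.\<close>

lemma cl_first:
  assumes \<eta>: "\<eta> \<in> \<omega>"
  shows "(\<^bold>\<Sum>j. cl x \<eta> a j k * \<eta> $ j) = - Gm x \<eta> $ a $ k"
proof -
  have "(\<^bold>\<Sum>j. cl x \<eta> a j k * \<eta> $ j) = - (\<^bold>\<Sum>j i. gm \<eta> $ a $ i * (strc i k j x * \<eta> $ j))"
    unfolding cl_def gm_swap[OF \<eta>, of a] by (simp add: sum_distrib_right sum_negf[symmetric]) (subst strc_antisym, simp add: mult_ac)
  also have "(\<^bold>\<Sum>j i. gm \<eta> $ a $ i * (strc i k j x * \<eta> $ j)) = (\<^bold>\<Sum>i j. gm \<eta> $ a $ i * (strc i k j x * \<eta> $ j))"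
    by (rule sum.swap)
  finally show ?thesis by (simp add: Gm_def Wm_def matrix_matrix_mult_def sum_distrib_left)
qed

lemma cl_first_grad:
  assumes \<eta>: "\<eta> \<in> \<omega>"
  shows "(\<^bold>\<Sum>j a. cl x \<eta> a j k * \<eta> $ a * \<eta> $ j) = - Pv x \<eta> $ k"
proof -
  have "(\<^bold>\<Sum>j a. cl x \<eta> a j k * \<eta> $ a * \<eta> $ j) = (\<^bold>\<Sum>j. FF x \<eta> $ j $ k * \<eta> $ j)"
    by (simp only: sum_distrib_right[symmetric] cl_grad[OF \<eta>])
  then show ?thesis
    by (subst (asm) FF_antisym) (simp add: Pv_def matrix_vector_mult_def sum_negf)
qed

lemma cl_trace:
  assumes \<eta>: "\<eta> \<in> \<omega>"
  shows "(\<^bold>\<Sum>n b. cl x \<eta> b p n * hm \<eta> $ b $ n) = - cdv p x"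
proof -
  have d: "(\<^bold>\<Sum>b. gm \<eta> $ l $ b * hm \<eta> $ b $ n) = (if l = n then 1 else 0)" for l n
    using hm_gm(2)[OF \<eta>] by (simp add: matrix_matrix_mult_def vec_eq_iff mat_def)
  have "(\<^bold>\<Sum>b. cl x \<eta> b p n * hm \<eta> $ b $ n) = strc n p n x" for n
  proof -
    have "(\<^bold>\<Sum>b. cl x \<eta> b p n * hm \<eta> $ b $ n) = (\<^bold>\<Sum>b l. strc l p n x * (gm \<eta> $ l $ b * hm \<eta> $ b $ n))"
      by (simp add: cl_def sum_distrib_right sum_distrib_left mult_ac)
    also have "\<dots> = (\<^bold>\<Sum>l b. strc l p n x * (gm \<eta> $ l $ b * hm \<eta> $ b $ n))"
      by (rule sum.swap)
    finally show ?thesis by (simp only: sum_distrib_left[symmetric] d sum_kron)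
  qed
  moreover have "strc n p n x = - strc n n p x" for n by (rule strc_antisym)
  ultimately show ?thesis by (simp add: cdv_def sum_negf)
qed

definition Bm :: "real^'m \<Rightarrow> real^'m \<Rightarrow> real^'m^'m" where
  "Bm x \<eta> = hm \<eta> ** CH x \<eta>"

text \<open>Contracting C with H is the same as contracting C, with that index raised, with P; total
  symmetry of C permits any slot. This connects the matrix found in the derivative of H with the
  C^kq_r of the theorem.\<close>

lemma Bm_cartan:
  assumes \<eta>: "\<eta> \<in> \<omega>"
  shows "Bm x \<eta> $ q $ r = (\<^bold>\<Sum>k. Pv x \<eta> $ k * cartan_up2 f k q r \<eta>)"
proof -
  have "(\<^bold>\<Sum>k. Pv x \<eta> $ k * cartan_up2 f k q r \<eta>)
    = (\<^bold>\<Sum>k i m. hm \<eta> $ q $ m * (cartan f i m r \<eta> * (hm \<eta> $ k $ i * Pv x \<eta> $ k)))"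
    by (simp add: cartan_up2_def sum_distrib_left mult_ac)
  also have "\<dots> = (\<^bold>\<Sum>i k m. hm \<eta> $ q $ m * (cartan f i m r \<eta> * (hm \<eta> $ k $ i * Pv x \<eta> $ k)))"
    by (rule sum.swap)
  also have "\<dots> = (\<^bold>\<Sum>i m k. hm \<eta> $ q $ m * (cartan f r m i \<eta> * (hm \<eta> $ i $ k * Pv x \<eta> $ k)))"
  proof (rule sum.cong[OF refl])
    fix i
    have "cartan f i m r \<eta> = cartan f r m i \<eta>" for m
      by (metis \<eta> cartan_sym)
    then show "(\<^bold>\<Sum>k m. hm \<eta> $ q $ m * (cartan f i m r \<eta> * (hm \<eta> $ k $ i * Pv x \<eta> $ k)))
      = (\<^bold>\<Sum>m k. hm \<eta> $ q $ m * (cartan f r m i \<eta> * (hm \<eta> $ i $ k * Pv x \<eta> $ k)))"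
      by (subst sum.swap) (simp add: hm_swap[OF \<eta>, of _ i])
  qed
  also have "\<dots> = (\<^bold>\<Sum>m i k. hm \<eta> $ q $ m * (cartan f r m i \<eta> * (hm \<eta> $ i $ k * Pv x \<eta> $ k)))"
    by (rule sum.swap)
  also have "\<dots> = (\<^bold>\<Sum>m. hm \<eta> $ q $ m * (\<^bold>\<Sum>i. cartan f r m i \<eta> * Hv x \<eta> $ i))"
    by (simp only: sum_distrib_left[symmetric] Hv_Pv matrix_vector_mult_def vec_lambda_beta)
  finally show ?thesis by (simp add: Bm_def CH_def matrix_matrix_mult_def)
qed

lemma cartan_up2_swap:
  assumes \<eta>: "\<eta> \<in> \<omega>"
  shows "cartan_up2 f a b c \<eta> = cartan_up2 f b a c \<eta>"
  unfolding cartan_up2_def by (subst sum.swap) (simp add: cartan_sym(1)[OF \<eta>, of _ _ c] mult_ac)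

lemma Bm_hm_cartan:
  assumes \<eta>: "\<eta> \<in> \<omega>"
  shows "(Bm x \<eta> ** hm \<eta>) $ b $ n = (\<^bold>\<Sum>k. Pv x \<eta> $ k * cartan_up3 f b k n \<eta>)"
proof -
  have "(\<^bold>\<Sum>k. Pv x \<eta> $ k * cartan_up3 f b k n \<eta>)
    = (\<^bold>\<Sum>k r. Pv x \<eta> $ k * cartan_up2 f k b r \<eta> * hm \<eta> $ r $ n)"
    by (simp add: cartan_up3_def sum_distrib_left cartan_up2_swap[OF \<eta>, of b] hm_swap[OF \<eta>, of n] mult_ac)
  also have "\<dots> = (\<^bold>\<Sum>r k. Pv x \<eta> $ k * cartan_up2 f k b r \<eta> * hm \<eta> $ r $ n)"
    by (rule sum.swap)
  also have "\<dots> = (\<^bold>\<Sum>r. Bm x \<eta> $ b $ r * hm \<eta> $ r $ n)"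
    by (simp only: sum_distrib_right[symmetric] Bm_cartan[OF \<eta>])
  finally show ?thesis by (simp add: matrix_matrix_mult_def)
qed

lemma Bm_hm_sym:
  assumes \<eta>: "\<eta> \<in> \<omega>"
  shows "(Bm x \<eta> ** hm \<eta>) $ b $ n = (Bm x \<eta> ** hm \<eta>) $ n $ b"
proof -
  have "transpose (Bm x \<eta> ** hm \<eta>) = Bm x \<eta> ** hm \<eta>"
    by (simp add: Bm_def matrix_transpose_mul hm_sym \<eta> transpose_CH matrix_mul_assoc)
  then show ?thesis by (simp add: transpose_def vec_eq_iff)
qed

section \<open>The nine summands of the quadratic part\<close>

lemma Hv_component: "\<eta> \<in> \<omega> \<Longrightarrow> Hv x \<eta> $ k = (\<^bold>\<Sum>p. Pv x \<eta> $ p * hm \<eta> $ k $ p)"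
  by (simp add: Hv_Pv matrix_vector_mult_def mult.commute)

text \<open>In the nine summands \<eta> meets a factor \<open>cl x \<eta> a j k\<close> through a
  alone, which gives \<open>FF\<close>, through j alone, which gives minus \<open>Gm\<close>, or
  through both, which gives minus \<open>Pv\<close>; one factor is instead traced with the inverse
  metric and gives minus \<open>cdv\<close>. Here both factors are \<open>FF\<close>, and the
  antisymmetry used once to bring the indices into cyclic order produces the sign.\<close>

lemma contract_to_trace_FF:
  assumes \<eta>: "\<eta> \<in> \<omega>"
  shows "(\<^bold>\<Sum>j k p n a b. cl x \<eta> a j k * cl x \<eta> b p n *
      (1/4 * hm \<eta> $ j $ p * hm \<eta> $ k $ n * \<eta> $ a * \<eta> $ b))
    = - 1/4 * trace (hm \<eta> ** FF x \<eta> ** (hm \<eta> ** FF x \<eta>))" (is "?lhs = _")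
proof -
  have "?lhs
    = (\<^bold>\<Sum>j k p n. 1/4 * hm \<eta> $ j $ p * hm \<eta> $ k $ n *
      (\<^bold>\<Sum>a b. (cl x \<eta> a j k * \<eta> $ a) * (cl x \<eta> b p n * \<eta> $ b)))"
    by (simp add: sum_distrib_left mult_ac)
  also have "\<dots> = (\<^bold>\<Sum>j k p n. - 1/4 * (hm \<eta> $ p $ j * FF x \<eta> $ j $ k * (hm \<eta> $ k $ n * FF x \<eta> $ n $ p)))"
  proof -
    have "1/4 * hm \<eta> $ j $ p * hm \<eta> $ k $ n * (FF x \<eta> $ j $ k * FF x \<eta> $ p $ n)
      = - 1/4 * (hm \<eta> $ p $ j * FF x \<eta> $ j $ k * (hm \<eta> $ k $ n * FF x \<eta> $ n $ p))" for j k p n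
      using FF_antisym[of x \<eta> p n] hm_swap[OF \<eta>, of j p] by simp
    then show ?thesis by (simp only: sum_product11 cl_grad[OF \<eta>])
  qed
  also have "\<dots> = - 1/4 * (\<^bold>\<Sum>j k p n. hm \<eta> $ p $ j * FF x \<eta> $ j $ k * (hm \<eta> $ k $ n * FF x \<eta> $ n $ p))"
    by (simp only: sum_distrib_left)
  also have "(\<^bold>\<Sum>j k p n. hm \<eta> $ p $ j * FF x \<eta> $ j $ k * (hm \<eta> $ k $ n * FF x \<eta> $ n $ p))
    = (\<^bold>\<Sum>p k j n. hm \<eta> $ p $ j * FF x \<eta> $ j $ k * (hm \<eta> $ k $ n * FF x \<eta> $ n $ p))"
  proof -
    have "(\<^bold>\<Sum>j k p. s j k p) = (\<^bold>\<Sum>p k j. s j k p)" for s :: "'m \<Rightarrow> 'm \<Rightarrow> 'm \<Rightarrow> real"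
      by (subst sum.swap, subst (2) sum.swap, subst sum.swap, rule refl)
    then show ?thesis .
  qed
  also have "\<dots> = trace (hm \<eta> ** FF x \<eta> ** (hm \<eta> ** FF x \<eta>))"
    by (simp only: trace_mult_sum) (simp only: sum_product11 matrix_matrix_mult_def vec_lambda_beta)
  finally show ?thesis .
qed

lemma contract_to_cdv_Hv:
  assumes \<eta>: "\<eta> \<in> \<omega>"
  shows "(\<^bold>\<Sum>j k p n a b. cl x \<eta> a j k * cl x \<eta> b p n *
      (hm \<eta> $ b $ n * hm \<eta> $ k $ p * \<eta> $ a * \<eta> $ j))
    = (\<^bold>\<Sum>p. cdv p x * Hv x \<eta> $ p)" (is "?lhs = _")
proof -
  have "?lhs
    = (\<^bold>\<Sum>k p j a n b. cl x \<eta> a j k * cl x \<eta> b p n *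
      (hm \<eta> $ b $ n * hm \<eta> $ k $ p * \<eta> $ a * \<eta> $ j))"
    by (rule sum6_perm(2))
  also have "\<dots> = (\<^bold>\<Sum>k p. hm \<eta> $ k $ p * (\<^bold>\<Sum>j a n b. (cl x \<eta> a j k * \<eta> $ a * \<eta> $ j) * (cl x \<eta> b p n * hm \<eta> $ b $ n)))"
    by (simp add: sum_distrib_left mult_ac)
  also have "\<dots> = (\<^bold>\<Sum>k p. cdv p x * (hm \<eta> $ p $ k * Pv x \<eta> $ k))"
    by (simp only: sum_product22 cl_first_grad[OF \<eta>] cl_trace[OF \<eta>]) (simp add: mult_ac hm_swap[OF \<eta>])
  also have "\<dots> = (\<^bold>\<Sum>p k. cdv p x * (hm \<eta> $ p $ k * Pv x \<eta> $ k))"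
    by (rule sum.swap)
  finally show ?thesis by (simp only: sum_distrib_left[symmetric] Hv_Pv matrix_vector_mult_def vec_lambda_beta)
qed

text \<open>The coefficient \<open>z\<close> stays open because the two traces that follow differ
  only in how the four free indices are paired. The two signs from \<open>cl_first\<close>
  cancel.\<close>

lemma contract_to_Gm_Gm:
  assumes \<eta>: "\<eta> \<in> \<omega>"
  shows "(\<^bold>\<Sum>j k p n a b. cl x \<eta> a j k * cl x \<eta> b p n *
      (z a k b n * \<eta> $ j * \<eta> $ p))
    = (\<^bold>\<Sum>a k b n. z a k b n * (Gm x \<eta> $ a $ k * Gm x \<eta> $ b $ n))" (is "?lhs = _")
proof -
  have "?lhs
    = (\<^bold>\<Sum>a k b n j p. cl x \<eta> a j k * cl x \<eta> b p n *
      (z a k b n * \<eta> $ j * \<eta> $ p))"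
    by (rule sum6_perm(3))
  also have "\<dots> = (\<^bold>\<Sum>a k b n. z a k b n * (\<^bold>\<Sum>j p. (cl x \<eta> a j k * \<eta> $ j) * (cl x \<eta> b p n * \<eta> $ p)))"
    by (simp add: sum_distrib_left mult_ac)
  finally show ?thesis by (simp only: sum_product11 cl_first[OF \<eta>]) simp
qed

lemma contract_to_trace_Gm_Gm:
  assumes \<eta>: "\<eta> \<in> \<omega>"
  shows "(\<^bold>\<Sum>j k p n a b. cl x \<eta> a j k * cl x \<eta> b p n *
      (1/2 * hm \<eta> $ a $ n * hm \<eta> $ b $ k * \<eta> $ j * \<eta> $ p))
    = 1/2 * trace (hm \<eta> ** Gm x \<eta> ** (hm \<eta> ** Gm x \<eta>))"
proof -
  have "trace (hm \<eta> ** Gm x \<eta> ** (hm \<eta> ** Gm x \<eta>)) = (\<^bold>\<Sum>n k a b. (hm \<eta> $ n $ a * Gm x \<eta> $ a $ k) * (hm \<eta> $ k $ b * Gm x \<eta> $ b $ n))"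
    by (simp only: trace_mult_sum) (simp only: sum_product11 matrix_matrix_mult_def vec_lambda_beta)
  also have "\<dots> = (\<^bold>\<Sum>a b n k. (hm \<eta> $ n $ a * Gm x \<eta> $ a $ k) * (hm \<eta> $ k $ b * Gm x \<eta> $ b $ n))"
    by (rule sum_swap4)
  also have "\<dots> = (\<^bold>\<Sum>a k b n. (hm \<eta> $ n $ a * Gm x \<eta> $ a $ k) * (hm \<eta> $ k $ b * Gm x \<eta> $ b $ n))"
  proof (rule sum.cong[OF refl])
    have "(\<^bold>\<Sum>b n k. s b n k) = (\<^bold>\<Sum>k b n. s b n k)"
      for s :: "'m \<Rightarrow> 'm \<Rightarrow> 'm \<Rightarrow> real"
    proof -
      have "(\<^bold>\<Sum>b n k. s b n k) = (\<^bold>\<Sum>b k n. s b n k)"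
        by (rule sum.cong[OF refl], rule sum.swap)
      also have "\<dots> = (\<^bold>\<Sum>k b n. s b n k)"
        by (rule sum.swap)
      finally show ?thesis .
    qed
    then show "(\<^bold>\<Sum>b n k. (hm \<eta> $ n $ a * Gm x \<eta> $ a $ k) * (hm \<eta> $ k $ b * Gm x \<eta> $ b $ n))
      = (\<^bold>\<Sum>k b n. (hm \<eta> $ n $ a * Gm x \<eta> $ a $ k) * (hm \<eta> $ k $ b * Gm x \<eta> $ b $ n))" for a .
  qed
  finally have "trace (hm \<eta> ** Gm x \<eta> ** (hm \<eta> ** Gm x \<eta>)) = \<dots>" .
  then show ?thesis
    unfolding contract_to_Gm_Gm[OF \<eta>, where z = "\<lambda>a k b n. 1/2 * hm \<eta> $ a $ n * hm \<eta> $ b $ k"]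
    by (simp add: sum_distrib_left mult_ac hm_swap[OF \<eta>])
qed

lemma contract_to_trace_Gm_transpose_Gm:
  assumes \<eta>: "\<eta> \<in> \<omega>"
  shows "(\<^bold>\<Sum>j k p n a b. cl x \<eta> a j k * cl x \<eta> b p n *
      (1/2 * hm \<eta> $ a $ b * hm \<eta> $ k $ n * \<eta> $ j * \<eta> $ p))
    = 1/2 * trace (hm \<eta> ** Gm x \<eta> ** (hm \<eta> ** transpose (Gm x \<eta>)))"
proof -
  have "trace (hm \<eta> ** Gm x \<eta> ** (hm \<eta> ** transpose (Gm x \<eta>))) = (\<^bold>\<Sum>b k a n. (hm \<eta> $ b $ a * Gm x \<eta> $ a $ k) * (hm \<eta> $ k $ n * Gm x \<eta> $ b $ n))"
    by (simp only: trace_mult_sum) (simp only: sum_product11 matrix_matrix_mult_def vec_lambda_beta transpose_def)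
  also have "\<dots> = (\<^bold>\<Sum>b a k n. (hm \<eta> $ b $ a * Gm x \<eta> $ a $ k) * (hm \<eta> $ k $ n * Gm x \<eta> $ b $ n))"
    by (rule sum.cong[OF refl], rule sum.swap)
  also have "\<dots> = (\<^bold>\<Sum>a b k n. (hm \<eta> $ b $ a * Gm x \<eta> $ a $ k) * (hm \<eta> $ k $ n * Gm x \<eta> $ b $ n))"
    by (rule sum.swap)
  also have "\<dots> = (\<^bold>\<Sum>a k b n. (hm \<eta> $ b $ a * Gm x \<eta> $ a $ k) * (hm \<eta> $ k $ n * Gm x \<eta> $ b $ n))"
    by (rule sum.cong[OF refl], rule sum.swap)
  finally have "trace (hm \<eta> ** Gm x \<eta> ** (hm \<eta> ** transpose (Gm x \<eta>))) = \<dots>" .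
  then show ?thesis
    unfolding contract_to_Gm_Gm[OF \<eta>, where z = "\<lambda>a k b n. 1/2 * hm \<eta> $ a $ b * hm \<eta> $ k $ n"]
    by (simp add: sum_distrib_left mult_ac hm_swap[OF \<eta>])
qed

text \<open>One factor becomes minus \<open>Gm\<close>, the other minus \<open>Pv\<close>, and the
  signs cancel. The open \<open>z\<close> covers the summand with C^bkn and the one with
  I^n.\<close>

lemma contract_to_Gm_Pv:
  assumes \<eta>: "\<eta> \<in> \<omega>"
  shows "(\<^bold>\<Sum>j k p n a b. cl x \<eta> a j k * cl x \<eta> b p n *
      (z b n k * \<eta> $ a * \<eta> $ j * \<eta> $ p))
    = (\<^bold>\<Sum>b n. Gm x \<eta> $ b $ n * (\<^bold>\<Sum>k. Pv x \<eta> $ k * z b n k))" (is "?lhs = _")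
proof -
  have "?lhs
    = (\<^bold>\<Sum>b n k j a p. cl x \<eta> a j k * cl x \<eta> b p n *
      (z b n k * \<eta> $ a * \<eta> $ j * \<eta> $ p))"
    by (rule sum6_perm(4))
  also have "\<dots> = (\<^bold>\<Sum>b n k. z b n k * (\<^bold>\<Sum>j a p. (cl x \<eta> a j k * \<eta> $ a * \<eta> $ j) * (cl x \<eta> b p n * \<eta> $ p)))"
    by (simp add: sum_distrib_left mult_ac)
  finally show ?thesis
    by (simp only: sum_product21 cl_first_grad[OF \<eta>] cl_first[OF \<eta>]) (simp add: sum_distrib_left mult_ac)
qed

text \<open>C^bkn contracted with P is the entry b, n of Bm hm, whereas the trace asks for the entry
  n, b; the symmetry \<open>Bm_hm_sym\<close> bridges the two.\<close>

lemma contract_to_trace_Bm_Gm: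
  assumes \<eta>: "\<eta> \<in> \<omega>"
  shows "(\<^bold>\<Sum>j k p n a b. cl x \<eta> a j k * cl x \<eta> b p n *
      (2 * \<eta> $ a * \<eta> $ j * \<eta> $ p * cartan_up3 f b k n \<eta>))
    = 2 * trace (Bm x \<eta> ** (hm \<eta> ** Gm x \<eta>))" (is "?lhs = _")
proof -
  have "?lhs
    = (\<^bold>\<Sum>b n. Gm x \<eta> $ b $ n * (\<^bold>\<Sum>k. Pv x \<eta> $ k * (2 * cartan_up3 f b k n \<eta>)))"
    using contract_to_Gm_Pv[OF \<eta>, where z = "\<lambda>b n k. 2 * cartan_up3 f b k n \<eta>"] by (simp add: mult_ac)
  also have "\<dots> = 2 * (\<^bold>\<Sum>b n. Gm x \<eta> $ b $ n * (Bm x \<eta> ** hm \<eta>) $ n $ b)"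
  proof -
    have "(\<^bold>\<Sum>k. Pv x \<eta> $ k * (2 * cartan_up3 f b k n \<eta>)) = 2 * (Bm x \<eta> ** hm \<eta>) $ n $ b" for b n
      using Bm_hm_sym[OF \<eta>, of x b n] Bm_hm_cartan[OF \<eta>, of x b n] by (simp add: sum_distrib_left[symmetric] mult_ac)
    then show ?thesis by (simp add: sum_distrib_left mult_ac)
  qed
  also have "(\<^bold>\<Sum>b n. Gm x \<eta> $ b $ n * (Bm x \<eta> ** hm \<eta>) $ n $ b) = trace (Gm x \<eta> ** (Bm x \<eta> ** hm \<eta>))"
    by (simp only: trace_mult_sum)
  also have "\<dots> = trace (Bm x \<eta> ** hm \<eta> ** Gm x \<eta>)" by (rule trace_mul_sym)
  finally show ?thesis by (simp only: matrix_mul_assoc)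
qed

lemma contract_to_mean_cartan_Gm:
  assumes \<eta>: "\<eta> \<in> \<omega>"
  shows "(\<^bold>\<Sum>j k p n a b. cl x \<eta> a j k * cl x \<eta> b p n *
      (hm \<eta> $ b $ k * mean_cartan_up f n \<eta> * \<eta> $ a * \<eta> $ j * \<eta> $ p))
    = (\<^bold>\<Sum>b. (\<^bold>\<Sum>n. mean_cartan_up f n \<eta> * Gm x \<eta> $ b $ n) * Hv x \<eta> $ b)"
proof -
  have "(\<^bold>\<Sum>k. Pv x \<eta> $ k * (hm \<eta> $ b $ k * mean_cartan_up f n \<eta>)) = mean_cartan_up f n \<eta> * Hv x \<eta> $ b" for b n
    by (simp add: Hv_component \<eta> sum_distrib_left mult_ac)
  then show ?thesis
    unfolding contract_to_Gm_Pv[OF \<eta>, where z = "\<lambda>b n k. hm \<eta> $ b $ k * mean_cartan_up f n \<eta>"]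
    by (simp only:) (simp add: sum_distrib_left mult_ac)
qed

text \<open>Both factors become minus \<open>Pv\<close>. The open \<open>z\<close> covers the
  summand quadratic in C and the one with the derivative of I.\<close>

lemma contract_to_Pv_Pv:
  assumes \<eta>: "\<eta> \<in> \<omega>"
  shows "(\<^bold>\<Sum>j k p n a b. cl x \<eta> a j k * cl x \<eta> b p n *
      (z k n * \<eta> $ a * \<eta> $ j * \<eta> $ b * \<eta> $ p))
    = (\<^bold>\<Sum>k n. z k n * (Pv x \<eta> $ k * Pv x \<eta> $ n))" (is "?lhs = _")
proof -
  have "?lhs
    = (\<^bold>\<Sum>k n j a p b. cl x \<eta> a j k * cl x \<eta> b p n *
      (z k n * \<eta> $ a * \<eta> $ j * \<eta> $ b * \<eta> $ p))"
    by (rule sum6_perm(1))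
  also have "\<dots> = (\<^bold>\<Sum>k n. z k n * (\<^bold>\<Sum>j a p b. (cl x \<eta> a j k * \<eta> $ a * \<eta> $ j) * (cl x \<eta> b p n * \<eta> $ b * \<eta> $ p)))"
    by (simp add: sum_distrib_left mult_ac)
  finally show ?thesis by (simp only: sum_product22 cl_first_grad[OF \<eta>]) simp
qed

lemma contract_to_trace_Bm_Bm:
  assumes \<eta>: "\<eta> \<in> \<omega>"
  shows "(\<^bold>\<Sum>j k p n a b. cl x \<eta> a j k * cl x \<eta> b p n *
      (\<^bold>\<Sum>q r. \<eta> $ a * \<eta> $ j * \<eta> $ b * \<eta> $ p * cartan_up2 f k q r \<eta> * cartan_up2 f n r q \<eta>))
    = trace (Bm x \<eta> ** Bm x \<eta>)" (is "?lhs = _")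
proof -
  have "?lhs
    = (\<^bold>\<Sum>j k p n a b. cl x \<eta> a j k * cl x \<eta> b p n *
      ((\<^bold>\<Sum>q r. cartan_up2 f k q r \<eta> * cartan_up2 f n r q \<eta>) * \<eta> $ a * \<eta> $ j * \<eta> $ b * \<eta> $ p))"
    by (simp add: sum_distrib_left sum_distrib_right mult_ac)
  also have "\<dots> = (\<^bold>\<Sum>k n. (\<^bold>\<Sum>q r. cartan_up2 f k q r \<eta> * cartan_up2 f n r q \<eta>) * (Pv x \<eta> $ k * Pv x \<eta> $ n))"
    by (rule contract_to_Pv_Pv[OF \<eta>])
  also have "\<dots> = (\<^bold>\<Sum>k n q r. (Pv x \<eta> $ k * cartan_up2 f k q r \<eta>) * (Pv x \<eta> $ n * cartan_up2 f n r q \<eta>))"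
    by (simp add: sum_distrib_right sum_distrib_left mult_ac)
  also have "\<dots> = (\<^bold>\<Sum>q r k n. (Pv x \<eta> $ k * cartan_up2 f k q r \<eta>) * (Pv x \<eta> $ n * cartan_up2 f n r q \<eta>))"
    by (rule sum_swap4)
  also have "\<dots> = trace (Bm x \<eta> ** Bm x \<eta>)"
    by (simp only: sum_product11 trace_mult_sum Bm_cartan[OF \<eta>])
  finally show ?thesis .
qed

lemma contract_to_partial_mean_cartan:
  assumes \<eta>: "\<eta> \<in> \<omega>"
  shows "(\<^bold>\<Sum>j k p n a b. cl x \<eta> a j k * cl x \<eta> b p n *
      (\<^bold>\<Sum>s. hm \<eta> $ s $ n * \<eta> $ a * \<eta> $ j * \<eta> $ b * \<eta> $ p * partial s (mean_cartan_up f k) \<eta>))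
    = (\<^bold>\<Sum>s. (\<^bold>\<Sum>k. partial s (mean_cartan_up f k) \<eta> * Pv x \<eta> $ k) * Hv x \<eta> $ s)" (is "?lhs = _")
proof -
  have "?lhs
    = (\<^bold>\<Sum>j k p n a b. cl x \<eta> a j k * cl x \<eta> b p n *
      ((\<^bold>\<Sum>s. hm \<eta> $ s $ n * partial s (mean_cartan_up f k) \<eta>) * \<eta> $ a * \<eta> $ j * \<eta> $ b * \<eta> $ p))"
    by (simp add: sum_distrib_left sum_distrib_right mult_ac)
  also have "\<dots> = (\<^bold>\<Sum>k n. (\<^bold>\<Sum>s. hm \<eta> $ s $ n * partial s (mean_cartan_up f k) \<eta>) * (Pv x \<eta> $ k * Pv x \<eta> $ n))"
    by (rule contract_to_Pv_Pv[OF \<eta>])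
  also have "\<dots> = (\<^bold>\<Sum>k n s. (partial s (mean_cartan_up f k) \<eta> * Pv x \<eta> $ k) * (hm \<eta> $ s $ n * Pv x \<eta> $ n))"
    by (simp add: sum_distrib_right sum_distrib_left mult_ac)
  also have "\<dots> = (\<^bold>\<Sum>k s n. (partial s (mean_cartan_up f k) \<eta> * Pv x \<eta> $ k) * (hm \<eta> $ s $ n * Pv x \<eta> $ n))"
    by (rule sum.cong[OF refl], rule sum.swap)
  also have "\<dots> = (\<^bold>\<Sum>s k n. (partial s (mean_cartan_up f k) \<eta> * Pv x \<eta> $ k) * (hm \<eta> $ s $ n * Pv x \<eta> $ n))"
    by (rule sum.swap)
  finally show ?thesis
    by (simp only: sum_product11 Hv_Pv matrix_vector_mult_def vec_lambda_beta)
qed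

text \<open>Only the factor \<open>Pv\<close> carries a minus sign. This is why the summand stands
  with a plus in the theorem although it stems from - H^b times the derivative of J.\<close>

lemma contract_to_mean_cartan_FF:
  assumes \<eta>: "\<eta> \<in> \<omega>"
  shows "(\<^bold>\<Sum>j k p n a b. cl x \<eta> a j k * cl x \<eta> b p n *
      (mean_cartan_up f j \<eta> * hm \<eta> $ k $ n * \<eta> $ a * \<eta> $ b * \<eta> $ p))
    = - (\<^bold>\<Sum>k. (\<^bold>\<Sum>j. mean_cartan_up f j \<eta> * FF x \<eta> $ j $ k) * Hv x \<eta> $ k)" (is "?lhs = _")
proof -
  have "?lhs
    = (\<^bold>\<Sum>j k n a p b. cl x \<eta> a j k * cl x \<eta> b p n *
      (mean_cartan_up f j \<eta> * hm \<eta> $ k $ n * \<eta> $ a * \<eta> $ b * \<eta> $ p))"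
    by (rule sum6_perm(5))
  also have "\<dots> = (\<^bold>\<Sum>j k n. mean_cartan_up f j \<eta> * hm \<eta> $ k $ n * (\<^bold>\<Sum>a p b. (cl x \<eta> a j k * \<eta> $ a) * (cl x \<eta> b p n * \<eta> $ b * \<eta> $ p)))"
    by (simp add: sum_distrib_left mult_ac)
  also have "\<dots> = - (\<^bold>\<Sum>j k n. (mean_cartan_up f j \<eta> * FF x \<eta> $ j $ k) * (hm \<eta> $ k $ n * Pv x \<eta> $ n))"
    by (simp only: sum_product12 cl_first_grad[OF \<eta>] cl_grad[OF \<eta>]) (simp add: sum_negf mult_ac)
  also have "\<dots> = - (\<^bold>\<Sum>j k. (mean_cartan_up f j \<eta> * FF x \<eta> $ j $ k) * Hv x \<eta> $ k)"
    by (simp only: sum_distrib_left[symmetric] Hv_Pv matrix_vector_mult_def vec_lambda_beta)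
  also have "(\<^bold>\<Sum>j k. (mean_cartan_up f j \<eta> * FF x \<eta> $ j $ k) * Hv x \<eta> $ k)
    = (\<^bold>\<Sum>k j. (mean_cartan_up f j \<eta> * FF x \<eta> $ j $ k) * Hv x \<eta> $ k)"
    by (rule sum.swap)
  finally show ?thesis by (simp only: sum_distrib_right)
qed

text \<open>The summands are matched by origin: \<open>cdv\<close> times H is the second; - 1/4 of
  the trace of Q^2 supplies the first, third, fourth, fifth and sixth by \<open>trace_Q\<close>; the
  derivative of J along H supplies the last three by \<open>partial_JC\<close>, one for each factor
  of I^d y_i \<eta>^k.\<close>

lemma Ric_structure_quadratic:
  assumes \<eta>: "\<eta> \<in> \<omega>"
  shows "(\<^bold>\<Sum>a. cdv a x * Hv x \<eta> $ a) - (\<^bold>\<Sum>b. partial b (tens JC x) \<eta> * Hv x \<eta> $ b)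
      - 1/4 * trace ((Wm x \<eta> + Hm x \<eta>) ** (Wm x \<eta> + Hm x \<eta>))
    = (\<^bold>\<Sum>i j k l p n a b. strc i j k x * strc l p n x * gm \<eta> $ i $ a * gm \<eta> $ l $ b *
      (1/4 * hm \<eta> $ j $ p * hm \<eta> $ k $ n * \<eta> $ a * \<eta> $ b
       + hm \<eta> $ b $ n * hm \<eta> $ k $ p * \<eta> $ a * \<eta> $ j
       - 1/2 * hm \<eta> $ a $ n * hm \<eta> $ b $ k * \<eta> $ j * \<eta> $ p
       - 1/2 * hm \<eta> $ a $ b * hm \<eta> $ k $ n * \<eta> $ j * \<eta> $ p
       + 2 * \<eta> $ a * \<eta> $ j * \<eta> $ p * cartan_up3 f b k n \<eta>
       - (\<^bold>\<Sum>q r. \<eta> $ a * \<eta> $ j * \<eta> $ b * \<eta> $ p * cartan_up2 f k q r \<eta> * cartan_up2 f n r q \<eta>)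
       + mean_cartan_up f j \<eta> * hm \<eta> $ k $ n * \<eta> $ a * \<eta> $ b * \<eta> $ p
       - hm \<eta> $ b $ k * mean_cartan_up f n \<eta> * \<eta> $ a * \<eta> $ j * \<eta> $ p
       - (\<^bold>\<Sum>s. hm \<eta> $ s $ n * \<eta> $ a * \<eta> $ j * \<eta> $ b * \<eta> $ p * partial s (mean_cartan_up f k) \<eta>)))"
    (is "?L = ?R")
proof -
  have R: "?R = - 1/4 * trace (hm \<eta> ** FF x \<eta> ** (hm \<eta> ** FF x \<eta>))
      + (\<^bold>\<Sum>p. cdv p x * Hv x \<eta> $ p)
      - 1/2 * trace (hm \<eta> ** Gm x \<eta> ** (hm \<eta> ** Gm x \<eta>))
      - 1/2 * trace (hm \<eta> ** Gm x \<eta> ** (hm \<eta> ** transpose (Gm x \<eta>)))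
      + 2 * trace (Bm x \<eta> ** (hm \<eta> ** Gm x \<eta>))
      - trace (Bm x \<eta> ** Bm x \<eta>)
      + - (\<^bold>\<Sum>k. (\<^bold>\<Sum>j. mean_cartan_up f j \<eta> * FF x \<eta> $ j $ k) * Hv x \<eta> $ k)
      - (\<^bold>\<Sum>b. (\<^bold>\<Sum>n. mean_cartan_up f n \<eta> * Gm x \<eta> $ b $ n) * Hv x \<eta> $ b)
      - (\<^bold>\<Sum>s. (\<^bold>\<Sum>k. partial s (mean_cartan_up f k) \<eta> * Pv x \<eta> $ k) * Hv x \<eta> $ s)"
    unfolding contract8[where c = "\<lambda>i j k. strc i j k x" and g = "\<lambda>i j. gm \<eta> $ i $ j"] cl_def[symmetric]
    by (simp only: distrib_left right_diff_distrib[of "_ * _"] sum.distrib sum_subtractf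
        contract_to_trace_FF[OF \<eta>] contract_to_cdv_Hv[OF \<eta>] contract_to_trace_Gm_Gm[OF \<eta>] contract_to_trace_Gm_transpose_Gm[OF \<eta>] contract_to_trace_Bm_Gm[OF \<eta>] contract_to_trace_Bm_Bm[OF \<eta>] contract_to_mean_cartan_FF[OF \<eta>] contract_to_mean_cartan_Gm[OF \<eta>] contract_to_partial_mean_cartan[OF \<eta>])
  have J: "(\<^bold>\<Sum>b. partial b (tens JC x) \<eta> * Hv x \<eta> $ b)
      = (\<^bold>\<Sum>s. (\<^bold>\<Sum>k. partial s (mean_cartan_up f k) \<eta> * Pv x \<eta> $ k) * Hv x \<eta> $ s)
      + (\<^bold>\<Sum>b. (\<^bold>\<Sum>n. mean_cartan_up f n \<eta> * Gm x \<eta> $ b $ n) * Hv x \<eta> $ b)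
      + (\<^bold>\<Sum>k. (\<^bold>\<Sum>j. mean_cartan_up f j \<eta> * FF x \<eta> $ j $ k) * Hv x \<eta> $ k)"
    by (simp only: partial_JC[OF \<eta>] distrib_right sum.distrib)
  show ?thesis
    unfolding R J trace_Q[OF \<eta>] Bm_def by (simp add: add_divide_distrib diff_divide_distrib)
qed

lemma Ric_vierbein:
  assumes x: "x \<in> W" and y: "y \<in> dom_y x"
  defines "\<eta> \<equiv> \<epsilon> x *v y"
  shows "Ric F x y =
     (\<^bold>\<Sum>a b i d. hm \<eta> $ a $ d * \<eta> $ b * partial i f \<eta> * dstr i a b d x)
   + (\<^bold>\<Sum>a b i. \<eta> $ a * \<eta> $ b * dstr i b i a x)
   + (\<^bold>\<Sum>a b i d. mean_cartan_up f b \<eta> * \<eta> $ a * \<eta> $ i * partial d f \<eta> * dstr d b i a x)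
   + (\<^bold>\<Sum>i j k l p n a b. strc i j k x * strc l p n x * gm \<eta> $ i $ a * gm \<eta> $ l $ b *
      (1/4 * hm \<eta> $ j $ p * hm \<eta> $ k $ n * \<eta> $ a * \<eta> $ b
       + hm \<eta> $ b $ n * hm \<eta> $ k $ p * \<eta> $ a * \<eta> $ j
       - 1/2 * hm \<eta> $ a $ n * hm \<eta> $ b $ k * \<eta> $ j * \<eta> $ p
       - 1/2 * hm \<eta> $ a $ b * hm \<eta> $ k $ n * \<eta> $ j * \<eta> $ p
       + 2 * \<eta> $ a * \<eta> $ j * \<eta> $ p * cartan_up3 f b k n \<eta>
       - (\<^bold>\<Sum>q r. \<eta> $ a * \<eta> $ j * \<eta> $ b * \<eta> $ p * cartan_up2 f k q r \<eta> * cartan_up2 f n r q \<eta>)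
       + mean_cartan_up f j \<eta> * hm \<eta> $ k $ n * \<eta> $ a * \<eta> $ b * \<eta> $ p
       - hm \<eta> $ b $ k * mean_cartan_up f n \<eta> * \<eta> $ a * \<eta> $ j * \<eta> $ p
       - (\<^bold>\<Sum>s. hm \<eta> $ s $ n * \<eta> $ a * \<eta> $ j * \<eta> $ b * \<eta> $ p * partial s (mean_cartan_up f k) \<eta>)))"
proof -
  have \<eta>: "\<eta> \<in> \<omega>" using dom_xy(4)[OF y] by (simp add: \<eta>_def)
  have 1: "(\<^bold>\<Sum>a d i k. HC a d i k \<eta> * dstr i d k a x)
    = (\<^bold>\<Sum>a b i d. hm \<eta> $ a $ d * \<eta> $ b * partial i f \<eta> * dstr i a b d x)"
  proof -
    let ?t = "\<lambda>a b i d. hm \<eta> $ a $ d * \<eta> $ b * partial i f \<eta> * dstr i a b d x"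
    have "(\<^bold>\<Sum>a d i k. HC a d i k \<eta> * dstr i d k a x)
      = (\<^bold>\<Sum>d a i b. ?t a b i d)"
      by (simp add: HC_def mult_ac hm_swap[OF \<eta>])
    also have "\<dots> = (\<^bold>\<Sum>a d i b. ?t a b i d)"
      by (rule sum.swap)
    also have "\<dots> = (\<^bold>\<Sum>a d b i. ?t a b i d)"
      by (rule sum.cong[OF refl], rule sum.cong[OF refl], rule sum.swap)
    also have "\<dots> = (\<^bold>\<Sum>a b d i. ?t a b i d)"
      by (rule sum.cong[OF refl], rule sum.swap)
    also have "\<dots> = (\<^bold>\<Sum>a b i d. ?t a b i d)"
      by (rule sum.cong[OF refl], rule sum.cong[OF refl], rule sum.swap)
    finally show ?thesis .
  qed
  have 2: "- (\<^bold>\<Sum>a b c. \<eta> $ b * (\<eta> $ c * dstr a a b c x))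
    = (\<^bold>\<Sum>a b i. \<eta> $ a * \<eta> $ b * dstr i b i a x)"
  proof -
    \<comment> \<open>The theorem has the trace over the last lower index; exchanging the lower
      indices of c absorbs the minus sign.\<close>
    have anti: "dstr i b i a x = - dstr i i b a x" for i b a
    proof -
      have "partial \<mu> (strc i b i) x = - partial \<mu> (strc i i b) x" for \<mu>
      proof -
        have "strc i b i = (\<lambda>x. - strc i i b x)" by (rule ext) (rule strc_antisym)
        then show ?thesis using partial_minus[OF W_diff(4)[OF x], of \<mu> i i b] by simp
      qed
      then show ?thesis by (simp add: dstr_def sum_negf)
    qed
    have "- (\<^bold>\<Sum>a b c. \<eta> $ b * (\<eta> $ c * dstr a a b c x))
      = (\<^bold>\<Sum>i b a. \<eta> $ a * \<eta> $ b * dstr i b i a x)"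
      by (simp add: anti sum_negf mult_ac)
    also have "\<dots> = (\<^bold>\<Sum>i a b. \<eta> $ a * \<eta> $ b * dstr i b i a x)"
      by (rule sum.cong[OF refl], rule sum.swap)
    also have "\<dots> = (\<^bold>\<Sum>a i b. \<eta> $ a * \<eta> $ b * dstr i b i a x)"
      by (rule sum.swap)
    also have "\<dots> = (\<^bold>\<Sum>a b i. \<eta> $ a * \<eta> $ b * dstr i b i a x)"
      by (rule sum.cong[OF refl], rule sum.swap)
    finally show ?thesis .
  qed
  have 3: "(\<^bold>\<Sum>c. \<eta> $ c * (\<^bold>\<Sum>d i k. JC d i k \<eta> * dstr i d k c x))
    = (\<^bold>\<Sum>a b i d. mean_cartan_up f b \<eta> * \<eta> $ a * \<eta> $ i * partial d f \<eta> * dstr d b i a x)"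
  proof -
    have "(\<^bold>\<Sum>c. \<eta> $ c * (\<^bold>\<Sum>d i k. JC d i k \<eta> * dstr i d k c x))
      = (\<^bold>\<Sum>a b d i. mean_cartan_up f b \<eta> * \<eta> $ a * \<eta> $ i * partial d f \<eta> * dstr d b i a x)"
      by (simp add: JC_def sum_distrib_left mult_ac)
    also have "\<dots> = (\<^bold>\<Sum>a b i d. mean_cartan_up f b \<eta> * \<eta> $ a * \<eta> $ i * partial d f \<eta> * dstr d b i a x)"
      by (rule sum.cong[OF refl], rule sum.cong[OF refl], rule sum.swap)
    finally show ?thesis .
  qed
  show ?thesis
    unfolding Ric_structure_quadratic[OF \<eta>, of x, symmetric] 1[symmetric] 2[symmetric] 3[symmetric]
    using Ric_frame[OF x y] unfolding \<eta>_def by linarith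
qed

text \<open>The derivative of the frame is minus frame times coframe derivative times frame, so the
  bracket has the components - de^i(e_j, e_k). This is the formula that defines \<open>strc\<close>,
  and it involves derivatives of the coframe only.\<close>

lemma lie_bracket_frame:
  assumes x: "x \<in> W" and e: "\<And>a z. z \<in> W \<Longrightarrow> e a z = column a (frm z)"
  shows "lie_bracket (e j) (e k) x = frm x *v (\<chi> i. strc i j k x)"
proof -
  have pe: "partial \<nu> (\<lambda>z. e a z $ \<mu>) x = partial \<nu> (\<lambda>z. frm z $ \<mu> $ a) x" for \<nu> a \<mu>
    by (rule partial_cong_open[OF open_W x]) (simp add: e column_def)
  have half: "(\<^bold>\<Sum>\<nu>. frm x $ \<nu> $ j * partial \<nu> (\<lambda>z. frm z $ \<mu> $ k) x)
    = - (\<^bold>\<Sum>i. frm x $ \<mu> $ i * (\<^bold>\<Sum>\<rho> \<nu>. frm x $ \<rho> $ j * frm x $ \<nu> $ k * dcof \<rho> i \<nu> x))" for \<mu> j k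
  proof -
    have "(\<^bold>\<Sum>\<nu>. frm x $ \<nu> $ j * partial \<nu> (\<lambda>z. frm z $ \<mu> $ k) x)
      = - (\<^bold>\<Sum>\<rho> i \<nu>. frm x $ \<mu> $ i * (frm x $ \<rho> $ j * frm x $ \<nu> $ k * dcof \<rho> i \<nu> x))"
      by (simp add: partial_frm[OF x] sum_distrib_left sum_negf mult_ac)
    also have "(\<^bold>\<Sum>\<rho> i \<nu>. frm x $ \<mu> $ i * (frm x $ \<rho> $ j * frm x $ \<nu> $ k * dcof \<rho> i \<nu> x))
      = (\<^bold>\<Sum>i \<rho> \<nu>. frm x $ \<mu> $ i * (frm x $ \<rho> $ j * frm x $ \<nu> $ k * dcof \<rho> i \<nu> x))"
      by (rule sum.swap)
    finally show ?thesis by (simp only: sum_distrib_left)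
  qed
  have "lie_bracket (e j) (e k) x $ \<mu> = (frm x *v (\<chi> i. strc i j k x)) $ \<mu>" for \<mu>
  proof -
    have "lie_bracket (e j) (e k) x $ \<mu> = (\<^bold>\<Sum>\<nu>. frm x $ \<nu> $ j * partial \<nu> (\<lambda>z. frm z $ \<mu> $ k) x)
      - (\<^bold>\<Sum>\<nu>. frm x $ \<nu> $ k * partial \<nu> (\<lambda>z. frm z $ \<mu> $ j) x)"
      by (simp add: lie_bracket_def pe e x column_def sum_subtractf)
    also have "\<dots> = (\<^bold>\<Sum>i. frm x $ \<mu> $ i * ((\<^bold>\<Sum>\<rho> \<nu>. frm x $ \<rho> $ k * frm x $ \<nu> $ j * dcof \<rho> i \<nu> x)
      - (\<^bold>\<Sum>\<rho> \<nu>. frm x $ \<rho> $ j * frm x $ \<nu> $ k * dcof \<rho> i \<nu> x)))"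
      unfolding half by (simp add: right_diff_distrib sum_subtractf)
    also have "\<dots> = (\<^bold>\<Sum>i. frm x $ \<mu> $ i * strc i j k x)"
    proof (rule sum.cong[OF refl])
      fix i
      have "(\<^bold>\<Sum>\<rho> \<nu>. frm x $ \<rho> $ k * frm x $ \<nu> $ j * dcof \<rho> i \<nu> x)
        = (\<^bold>\<Sum>\<rho> \<nu>. frm x $ \<rho> $ j * frm x $ \<nu> $ k * dcof \<nu> i \<rho> x)"
        by (subst sum.swap) (simp add: mult_ac)
      then show "frm x $ \<mu> $ i * ((\<^bold>\<Sum>\<rho> \<nu>. frm x $ \<rho> $ k * frm x $ \<nu> $ j * dcof \<rho> i \<nu> x)
      - (\<^bold>\<Sum>\<rho> \<nu>. frm x $ \<rho> $ j * frm x $ \<nu> $ k * dcof \<rho> i \<nu> x)) = frm x $ \<mu> $ i * strc i j k x"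
        by (simp add: strc_def right_diff_distrib sum_subtractf)
    qed
    finally show ?thesis by (simp add: matrix_vector_mult_def)
  qed
  then show ?thesis by (simp add: vec_eq_iff)
qed

lemma frm_inv: "x \<in> W \<Longrightarrow> invertible (frm x)"
  using frm_cof by (auto simp: invertible_def)

lemma frame_coord_frm:
  assumes x: "x \<in> W" and e: "\<And>a z. z \<in> W \<Longrightarrow> e a z = column a (frm z)"
  shows "frame_coord (\<lambda>i. e i x) y a = (\<epsilon> x *v y) $ a"
  using frame_coord_column[OF frm_inv[OF x], of "\<epsilon> x *v y" a] by (simp add: e x frm_cof_vec)

lemma comm_coeff_frame:
  assumes x: "x \<in> W" and e: "\<And>a z. z \<in> W \<Longrightarrow> e a z = column a (frm z)"
  shows "comm_coeff e i j k x = strc i j k x"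
proof -
  have "frame_coord (\<lambda>d. e d x) v i = (\<epsilon> x *v v) $ i" for v
    by (rule frame_coord_frm[OF x e])
  moreover have "lie_bracket (e j) (e k) x = frm x *v (\<chi> i. strc i j k x)"
    by (rule lie_bracket_frame[OF x e])
  ultimately show ?thesis by (simp add: comm_coeff_def matrix_vector_mul_assoc frm_cof x)
qed

lemma comm_coeff_deriv_frame:
  assumes x: "x \<in> W" and e: "\<And>a z. z \<in> W \<Longrightarrow> e a z = column a (frm z)"
  shows "comm_coeff_deriv e i j k d x = dstr i j k d x"
proof -
  have "partial \<mu> (comm_coeff e i j k) x = partial \<mu> (strc i j k) x" for \<mu>
    by (rule partial_cong_open[OF open_W x]) (rule comm_coeff_frame[OF _ e])
  then show ?thesis by (simp add: comm_coeff_deriv_def dstr_def e x column_def)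
qed

end

section \<open>Charts and the vierbein\<close>

lemma chart_inv_facts:
  assumes "is_chart \<kappa>"
  shows "p \<in> fst \<kappa> \<Longrightarrow> chart_inv \<kappa> (snd \<kappa> p) = p"
    "x \<in> snd \<kappa> ` fst \<kappa> \<Longrightarrow> snd \<kappa> (chart_inv \<kappa> x) = x"
    "x \<in> snd \<kappa> ` fst \<kappa> \<Longrightarrow> chart_inv \<kappa> x \<in> fst \<kappa>"
    "continuous_on (snd \<kappa> ` fst \<kappa>) (chart_inv \<kappa>)"
  using assms by (auto simp: is_chart_def homeomorphism_def)

lemma open_chart_image:
  fixes \<kappa> :: "('p::topological_space, 'm::finite) chart"
  assumes \<kappa>: "is_chart \<kappa>" and U: "open U"
  shows "open (snd \<kappa> ` (U \<inter> fst \<kappa>))"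
proof -
  have "snd \<kappa> ` (U \<inter> fst \<kappa>) = snd \<kappa> ` fst \<kappa> \<inter> chart_inv \<kappa> -` U"
    using chart_inv_facts[OF \<kappa>] by (auto simp: image_iff)
  moreover have "open \<dots>"
    by (rule continuous_open_preimage) (use \<kappa> U chart_inv_facts(4)[OF \<kappa>] in \<open>auto simp: is_chart_def\<close>)
  ultimately show ?thesis by simp
qed

lemma transition_has_derivative:
  fixes A :: "('p::{t2_space, second_countable_topology}, 'm::finite) chart set"
  assumes A: "smooth_atlas A" "\<kappa> \<in> A" "\<kappa>' \<in> A" and p: "p \<in> fst \<kappa>" "p \<in> fst \<kappa>'"
  shows "(transition \<kappa> \<kappa>' has_derivative frechet_derivative (transition \<kappa> \<kappa>') (at (snd \<kappa> p))) (at (snd \<kappa> p))"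
proof -
  have "Ck_on 1 (transition \<kappa> \<kappa>') (snd \<kappa> ` (fst \<kappa> \<inter> fst \<kappa>'))"
    using A unfolding smooth_atlas_def by blast
  then have "transition \<kappa> \<kappa>' differentiable (at (snd \<kappa> p))"
    by (rule Ck_on_imp_differentiable) (use p in auto)
  then show ?thesis by (rule has_derivative_frechet)
qed

text \<open>The chain rule, applied where the composite of two transitions is the third one, namely
  on the open image of the overlap of \<kappa> and \<kappa>'. This cocycle rule makes
  \<open>tvec\<close> a tangent vector.\<close>

lemma transition_derivative_comp:
  fixes A :: "('p::{t2_space, second_countable_topology}, 'm::finite) chart set"
  assumes A: "smooth_atlas A" "\<kappa> \<in> A" "\<kappa>' \<in> A" "\<kappa>'' \<in> A"
    and p: "p \<in> fst \<kappa>" "p \<in> fst \<kappa>'" "p \<in> fst \<kappa>''"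
  shows "frechet_derivative (transition \<kappa> \<kappa>'') (at (snd \<kappa> p)) w
    = frechet_derivative (transition \<kappa>' \<kappa>'') (at (snd \<kappa>' p)) (frechet_derivative (transition \<kappa> \<kappa>') (at (snd \<kappa> p)) w)"
proof -
  let ?D = "frechet_derivative (transition \<kappa> \<kappa>') (at (snd \<kappa> p))"
  let ?D' = "frechet_derivative (transition \<kappa>' \<kappa>'') (at (snd \<kappa>' p))"
  have ch: "is_chart \<kappa>" "is_chart \<kappa>'" using A by (auto simp: smooth_atlas_def)
  have tp: "transition \<kappa> \<kappa>' (snd \<kappa> p) = snd \<kappa>' p"
    using p ch by (simp add: transition_def chart_inv_facts)
  have "(transition \<kappa>' \<kappa>'' has_derivative ?D') (at (transition \<kappa> \<kappa>' (snd \<kappa> p)))"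
    unfolding tp by (rule transition_has_derivative[OF A(1,3,4) p(2,3)])
  then have "((\<lambda>z. transition \<kappa>' \<kappa>'' (transition \<kappa> \<kappa>' z)) has_derivative (\<lambda>w. ?D' (?D w))) (at (snd \<kappa> p))"
    by (rule has_derivative_compose[where g = "transition \<kappa>' \<kappa>''", OF transition_has_derivative[OF A(1,2,3) p(1,2)]])
  then have "(transition \<kappa> \<kappa>'' has_derivative (\<lambda>w. ?D' (?D w))) (at (snd \<kappa> p))"
  proof (rule has_derivative_transform_within_open)
    have "open (fst \<kappa>')" using ch by (simp add: is_chart_def)
    then show "open (snd \<kappa> ` (fst \<kappa>' \<inter> fst \<kappa>))" by (rule open_chart_image[OF ch(1)])
    show "snd \<kappa> p \<in> snd \<kappa> ` (fst \<kappa>' \<inter> fst \<kappa>)" using p by auto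
    show "transition \<kappa>' \<kappa>'' (transition \<kappa> \<kappa>' z) = transition \<kappa> \<kappa>'' z"
      if "z \<in> snd \<kappa> ` (fst \<kappa>' \<inter> fst \<kappa>)" for z
      using that ch by (auto simp: transition_def chart_inv_facts)
  qed
  then show ?thesis by (metis frechet_derivative_at)
qed

lemma transition_self_derivative:
  fixes A :: "('p::{t2_space, second_countable_topology}, 'm::finite) chart set"
  assumes A: "smooth_atlas A" "\<kappa> \<in> A" and p: "p \<in> fst \<kappa>"
  shows "frechet_derivative (transition \<kappa> \<kappa>) (at (snd \<kappa> p)) w = w"
proof -
  have ch: "is_chart \<kappa>" using A by (auto simp: smooth_atlas_def)
  have "((\<lambda>z. z) has_derivative (\<lambda>w. w)) (at (snd \<kappa> p))" by simp
  then have "(transition \<kappa> \<kappa> has_derivative (\<lambda>w. w)) (at (snd \<kappa> p))"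
    by (rule has_derivative_transform_within_open[where s = "snd \<kappa> ` fst \<kappa>"])
       (use ch p in \<open>auto simp: is_chart_def transition_def chart_inv_facts[OF ch]\<close>)
  then show ?thesis by (metis frechet_derivative_at)
qed

lemma tvec_self:
  assumes "smooth_atlas A" "\<kappa> \<in> A" "p \<in> fst \<kappa>"
  shows "tvec A \<kappa> p w \<kappa> = w"
  using assms by (simp add: tvec_def transition_self_derivative)

lemma tvec_in_tangent_space:
  assumes "smooth_atlas A" "\<kappa> \<in> A" "p \<in> fst \<kappa>"
  shows "tvec A \<kappa> p w \<in> tangent_space A p"
proof -
  let ?v = "tvec A \<kappa> p w"
  have "?v \<kappa>'' = frechet_derivative (transition \<kappa>' \<kappa>'') (at (snd \<kappa>' p)) (?v \<kappa>')"
    if "\<kappa>' \<in> A" "\<kappa>'' \<in> A" "p \<in> fst \<kappa>'" "p \<in> fst \<kappa>''" for \<kappa>' \<kappa>''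
    using transition_derivative_comp[OF assms(1,2) that(1,2) assms(3) that(3,4), of w] that
    by (simp add: tvec_def)
  moreover have "?v \<kappa>' = 0" if "\<not> (\<kappa>' \<in> A \<and> p \<in> fst \<kappa>')" for \<kappa>'
    unfolding tvec_def by (rule if_not_P[OF that])
  ultimately show ?thesis unfolding tangent_space_def by blast
qed

text \<open>The components in the other charts around p are forced by the transition rule and all
  other values by the normalisation to 0, so a single chart gives linear coordinates on the tangent
  space.\<close>

lemma tangent_space_eq_tvec:
  assumes "smooth_atlas A" "\<kappa> \<in> A" "p \<in> fst \<kappa>" "v \<in> tangent_space A p"
  shows "v = tvec A \<kappa> p (v \<kappa>)"
proof
  fix \<kappa>'
  show "v \<kappa>' = tvec A \<kappa> p (v \<kappa>) \<kappa>'"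
  proof (cases "\<kappa>' \<in> A \<and> p \<in> fst \<kappa>'")
    case True
    then have "v \<kappa>' = frechet_derivative (transition \<kappa> \<kappa>') (at (snd \<kappa> p)) (v \<kappa>)"
      using assms(2-4) unfolding tangent_space_def by blast
    then show ?thesis unfolding tvec_def if_P[OF True] .
  next
    case False
    then have "v \<kappa>' = 0" using assms(4) unfolding tangent_space_def by blast
    then show ?thesis unfolding tvec_def if_not_P[OF False] .
  qed
qed

lemma tvec_linear:
  assumes "smooth_atlas A" "\<kappa> \<in> A" "p \<in> fst \<kappa>"
  shows "tvec A \<kappa> p (u + w) = (\<lambda>\<kappa>'. tvec A \<kappa> p u \<kappa>' + tvec A \<kappa> p w \<kappa>')"
    "tvec A \<kappa> p (r *\<^sub>R w) = (\<lambda>\<kappa>'. r *\<^sub>R tvec A \<kappa> p w \<kappa>')"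
proof -
  have "linear (frechet_derivative (transition \<kappa> \<kappa>') (at (snd \<kappa> p)))" if "\<kappa>' \<in> A" "p \<in> fst \<kappa>'" for \<kappa>'
    by (rule has_derivative_linear[OF transition_has_derivative[OF assms(1,2) that(1) assms(3) that(2)]])
  then show "tvec A \<kappa> p (u + w) = (\<lambda>\<kappa>'. tvec A \<kappa> p u \<kappa>' + tvec A \<kappa> p w \<kappa>')"
    "tvec A \<kappa> p (r *\<^sub>R w) = (\<lambda>\<kappa>'. r *\<^sub>R tvec A \<kappa> p w \<kappa>')"
    by (auto simp: tvec_def fun_eq_iff linear_add linear_scale)
qed

text \<open>It carries the non-degeneracy of \<open>hess L\<close> to the metric matrix in the
  basis. The order of differentiation is kept: the direction u belongs to the inner derivative and
  to the column index, v to the outer one and to the row index.\<close>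

lemma hess_in_basis:
  fixes L :: "'v::euclidean_space \<Rightarrow> real" and T :: "real^'m::finite \<Rightarrow> 'v"
  assumes \<omega>: "open \<omega>" and L: "Ck_on 2 L \<omega>" and T: "bounded_linear T" and \<eta>: "T \<eta> \<in> \<omega>"
  shows "hess L (T \<eta>) (T u) (T v) = (\<^bold>\<Sum>a. v $ a * (metric_mat (\<lambda>\<eta>. L (T \<eta>)) \<eta> *v u) $ a)"
proof -
  let ?f = "\<lambda>\<eta>. L (T \<eta>)"
  have op: "open (T -` \<omega>)" using \<omega> T by (simp add: continuous_open_vimage linear_continuous_at)
  have f: "Ck_on 2 ?f (T -` \<omega>)" by (rule Ck_on_comp_linear[OF \<omega> T L])
  have pf: "Ck_on 1 (partial b ?f) (T -` \<omega>)" for b by (rule Ck_on_partial'[OF op f]) simp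
  have Td: "(T has_derivative T) (at \<zeta>)" for \<zeta> by (rule bounded_linear_imp_has_derivative[OF T])
  have d1: "frechet_derivative L (at (T \<zeta>)) (T u) = (\<^bold>\<Sum>b. partial b ?f \<zeta> * u $ b)" if "T \<zeta> \<in> \<omega>" for \<zeta>
  proof -
    have "(L has_derivative frechet_derivative L (at (T \<zeta>))) (at (T \<zeta>))"
      by (rule has_derivative_frechet) (rule Ck_on_imp_differentiable[OF L _ that], simp)
    from has_derivative_compose[where f = T and g = L, OF Td this]
    have 1: "(?f has_derivative (\<lambda>w. frechet_derivative L (at (T \<zeta>)) (T w))) (at \<zeta>)" .
    have "(?f has_derivative (\<lambda>w. \<^bold>\<Sum>b. partial b ?f \<zeta> * w $ b)) (at \<zeta>)"
      by (rule partial_works) (use 1 in \<open>auto simp: differentiable_def\<close>)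
    from has_derivative_unique[OF 1 this] show ?thesis by meson
  qed
  let ?g = "\<lambda>z. frechet_derivative L (at z) (T u)"
  have "Ck_on 1 ?g \<omega>" using L by (simp add: numeral_2_eq_2)
  then have "?g differentiable (at (T \<eta>))" by (rule Ck_on_imp_differentiable) (use \<eta> in auto)
  from has_derivative_compose[where f = T and g = ?g, OF Td has_derivative_frechet[OF this]]
  have 1: "((\<lambda>\<zeta>. ?g (T \<zeta>)) has_derivative (\<lambda>w. frechet_derivative ?g (at (T \<eta>)) (T w))) (at \<eta>)" .
  have dsum: "(\<lambda>\<zeta>. \<^bold>\<Sum>b. partial b ?f \<zeta> * u $ b) differentiable (at \<eta>)"
    using Ck_on_imp_differentiable[OF pf] \<eta> by simp
  have "((\<lambda>\<zeta>. ?g (T \<zeta>)) has_derivative (\<lambda>w. \<^bold>\<Sum>a. partial a (\<lambda>\<zeta>. \<^bold>\<Sum>b. partial b ?f \<zeta> * u $ b) \<eta> * w $ a)) (at \<eta>)"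
    by (rule has_derivative_transform_within_open[OF partial_works[OF dsum] op]) (use \<eta> d1 in auto)
  from has_derivative_unique[OF 1 this]
  have "frechet_derivative ?g (at (T \<eta>)) (T v) = (\<^bold>\<Sum>a. partial a (\<lambda>\<zeta>. \<^bold>\<Sum>b. partial b ?f \<zeta> * u $ b) \<eta> * v $ a)"
    by meson
  also have "\<dots> = (\<^bold>\<Sum>a. v $ a * (metric_mat ?f \<eta> *v u) $ a)"
  proof (rule sum.cong[OF refl])
    fix a
    have "partial a (\<lambda>\<zeta>. \<^bold>\<Sum>b. partial b ?f \<zeta> * u $ b) \<eta> = (\<^bold>\<Sum>b. partial a (partial b ?f) \<eta> * u $ b)"
      using Ck_on_imp_differentiable[OF pf] \<eta> by (simp add: partial_sum partial_multc)
    then show "partial a (\<lambda>\<zeta>. \<^bold>\<Sum>b. partial b ?f \<zeta> * u $ b) \<eta> * v $ a = v $ a * (metric_mat ?f \<eta> *v u) $ a"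
      by (simp add: metric_mat_def matrix_vector_mult_def mult.commute)
  qed
  finally show ?thesis by (simp add: hess_def)
qed

section \<open>Reduction to the frame model\<close>

theorem mainTheorem8:
  fixes A :: "('p::{t2_space, second_countable_topology}, 'm::finite) chart set"
    and \<Omega> :: "('p \<times> ('p, 'm) tangent) set"
    and \<L> :: "'p \<times> ('p, 'm) tangent \<Rightarrow> real"
    and \<omega> :: "'v::euclidean_space set"
    and L :: "'v \<Rightarrow> real"
    and U :: "'p set"
    and \<phi> :: "'p \<Rightarrow> ('p, 'm) tangent \<Rightarrow> 'v"
    and E :: "'m \<Rightarrow> 'v"
    and \<kappa> :: "('p, 'm) chart"
    and x y :: "real^'m"
  assumes finsler: "pseudo_finsler A \<Omega> \<L>"
    and minkowski: "pseudo_minkowski \<omega> L"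
    and modeled: "modeled_on A \<Omega> \<L> \<omega> L"
    and local_vierbein: "local_model A \<Omega> \<L> \<omega> L U \<phi>"
    and basis: "inj E" "independent (range E)" "span (range E) = UNIV"
    and coords: "\<kappa> \<in> A"
    and point: "x \<in> snd \<kappa> ` (U \<inter> fst \<kappa>)"
    and vector: "y \<in> fibre_cone A \<Omega> \<kappa> (chart_inv \<kappa> x)"
  shows
    "let F = local_fun A \<L> \<kappa>;
         G = spray F;
         e = vierbein A \<phi> E \<kappa>;
         c = (\<lambda>i j k. comm_coeff e i j k x);
         dc = (\<lambda>i j k d. comm_coeff_deriv e i j k d x);
         Y = frame_coord (\<lambda>i. e i x) y;
         \<eta> = (\<chi> i. Y i);
         f = in_basis E L;
         yl = (\<lambda>i. partial i f \<eta>);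
         g = (\<lambda>i j. metric_mat f \<eta> $ i $ j);
         h = (\<lambda>i j. metric_inv f \<eta> $ i $ j);
         I = (\<lambda>i. mean_cartan_up f i \<eta>);
         C2 = (\<lambda>i j k. cartan_up2 f i j k \<eta>);
         C3 = (\<lambda>i j k. cartan_up3 f i j k \<eta>)
     in
       Ric F x y =
           2 * (\<Sum>\<mu>\<in>UNIV. px \<mu> (G \<mu>) x y)
         - (\<Sum>\<mu>\<in>UNIV. \<Sum>\<nu>\<in>UNIV. y $ \<mu> * px \<mu> (py \<nu> (G \<nu>)) x y)
         + 2 * (\<Sum>\<mu>\<in>UNIV. \<Sum>\<nu>\<in>UNIV. G \<mu> x y * py \<mu> (py \<nu> (G \<nu>)) x y)
         - (\<Sum>\<mu>\<in>UNIV. \<Sum>\<nu>\<in>UNIV. py \<nu> (G \<mu>) x y * py \<mu> (G \<nu>) x y)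
     \<and>
       Ric F x y =
           (\<Sum>a\<in>UNIV. \<Sum>b\<in>UNIV. \<Sum>i\<in>UNIV. \<Sum>d\<in>UNIV. h a d * Y b * yl i * dc i a b d)
         + (\<Sum>a\<in>UNIV. \<Sum>b\<in>UNIV. \<Sum>i\<in>UNIV. Y a * Y b * dc i b i a)
         + (\<Sum>a\<in>UNIV. \<Sum>b\<in>UNIV. \<Sum>i\<in>UNIV. \<Sum>d\<in>UNIV. I b * Y a * Y i * yl d * dc d b i a)
         + (\<Sum>i\<in>UNIV. \<Sum>j\<in>UNIV. \<Sum>k\<in>UNIV. \<Sum>l\<in>UNIV. \<Sum>p\<in>UNIV. \<Sum>n\<in>UNIV. \<Sum>a\<in>UNIV. \<Sum>b\<in>UNIV.
              c i j k * c l p n * g i a * g l b *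
              ( 1/4 * h j p * h k n * Y a * Y b
              + h b n * h k p * Y a * Y j
              - 1/2 * h a n * h b k * Y j * Y p
              - 1/2 * h a b * h k n * Y j * Y p
              + 2 * Y a * Y j * Y p * C3 b k n
              - (\<Sum>q\<in>UNIV. \<Sum>r\<in>UNIV. Y a * Y j * Y b * Y p * C2 k q r * C2 n r q)
              + I j * h k n * Y a * Y b * Y p
              - h b k * I n * Y a * Y j * Y p
              - (\<Sum>s\<in>UNIV. h s n * Y a * Y j * Y b * Y p * partial s (mean_cartan_up f k) \<eta>)))"
proof -
  have atlas: "smooth_atlas A" and \<Omega>TB: "\<Omega> \<subseteq> tangent_bundle A"
    using finsler by (auto simp: pseudo_finsler_def)
  have ch: "is_chart \<kappa>" using atlas coords by (auto simp: smooth_atlas_def)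
  have lm: "open U" "\<And>p. p \<in> U \<Longrightarrow> tangent_iso (tangent_space A p) (\<phi> p)"
    "\<And>p. p \<in> U \<Longrightarrow> \<phi> p ` (\<Omega> `` {p}) = \<omega>"
    "\<And>p w. p \<in> U \<inter> fst \<kappa> \<Longrightarrow> w \<in> closure (fibre_cone A \<Omega> \<kappa> p) \<Longrightarrow> L (\<phi> p (tvec A \<kappa> p w)) = fibre_fun A \<L> \<kappa> p w"
    "\<And>w. Ck_on 2 (\<lambda>x. \<phi> (chart_inv \<kappa> x) (tvec A \<kappa> (chart_inv \<kappa> x) w)) (snd \<kappa> ` (U \<inter> fst \<kappa>))"
    using local_vierbein coords unfolding local_model_def by blast+
  define W where "W = snd \<kappa> ` (U \<inter> fst \<kappa>)"
  have oW: "open W" unfolding W_def by (rule open_chart_image[OF ch lm(1)])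
  have pW: "chart_inv \<kappa> z \<in> U \<inter> fst \<kappa>" if "z \<in> W" for z
    using that chart_inv_facts(1)[OF ch] by (auto simp: W_def)
  \<comment> \<open>\<phi> read in the linear coordinates that \<kappa> induces on the tangent
    spaces.\<close>
  define \<psi> where "\<psi> z w = \<phi> (chart_inv \<kappa> z) (tvec A \<kappa> (chart_inv \<kappa> z) w)" for z w
  have inj_\<phi>: "inj_on (\<phi> p) (tangent_space A p)" and surj_\<phi>: "\<phi> p ` tangent_space A p = UNIV" if "p \<in> U" for p
    using lm(2)[OF that] by (auto simp: tangent_iso_def bij_betw_def)
  have \<psi>_lin: "linear (\<psi> z)" if z: "z \<in> W" for z
  proof -
    let ?p = "chart_inv \<kappa> z"
    have p: "?p \<in> U" "?p \<in> fst \<kappa>" using pW[OF z] by auto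
    have TS: "tvec A \<kappa> ?p w \<in> tangent_space A ?p" for w
      by (rule tvec_in_tangent_space[OF atlas coords p(2)])
    note iso = lm(2)[OF p(1), unfolded tangent_iso_def]
    show ?thesis
    proof (rule linearI)
      show "\<psi> z (u + w) = \<psi> z u + \<psi> z w" for u w
        unfolding \<psi>_def tvec_linear(1)[OF atlas coords p(2)] using iso TS by blast
      show "\<psi> z (r *\<^sub>R w) = r *\<^sub>R \<psi> z w" for r w
        unfolding \<psi>_def tvec_linear(2)[OF atlas coords p(2)] using iso TS by blast
    qed
  qed
  have \<psi>_inj: "inj (\<psi> z)" if z: "z \<in> W" for z
  proof (rule injI)
    fix u w assume "\<psi> z u = \<psi> z w"
    then have "tvec A \<kappa> (chart_inv \<kappa> z) u = tvec A \<kappa> (chart_inv \<kappa> z) w"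
      unfolding \<psi>_def using pW[OF z] inj_\<phi> tvec_in_tangent_space[OF atlas coords]
      by (meson IntD1 IntD2 inj_onD)
    then show "u = w" using tvec_self[OF atlas coords] pW[OF z] by (metis IntD2)
  qed
  \<comment> \<open>From the cone \<omega> back to \<Omega>: the model yields some vector of
    \<Omega> with the same image under \<phi>. It is tangent because \<Omega> lies in the tangent
    bundle, and injectivity of \<phi> identifies it with the given one.\<close>
  have \<psi>_mem: "w \<in> fibre_cone A \<Omega> \<kappa> (chart_inv \<kappa> z) \<longleftrightarrow> \<psi> z w \<in> \<omega>" if z: "z \<in> W" for z w
  proof -
    let ?p = "chart_inv \<kappa> z"
    have p: "?p \<in> U" "?p \<in> fst \<kappa>" using pW[OF z] by auto
    have "(?p, tvec A \<kappa> ?p w) \<in> \<Omega>" if "\<psi> z w \<in> \<omega>"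
    proof -
      from that obtain v where v: "(?p, v) \<in> \<Omega>" "\<phi> ?p v = \<phi> ?p (tvec A \<kappa> ?p w)"
        using lm(3)[OF p(1)] unfolding \<psi>_def by (metis (no_types, lifting) Image_singleton_iff imageE)
      moreover have "v \<in> tangent_space A ?p" using v(1) \<Omega>TB by (auto simp: tangent_bundle_def)
      ultimately have "v = tvec A \<kappa> ?p w"
        using inj_\<phi>[OF p(1)] tvec_in_tangent_space[OF atlas coords p(2)] by (meson inj_onD)
      then show ?thesis using v(1) by simp
    qed
    moreover have "\<psi> z w \<in> \<omega>" if "(?p, tvec A \<kappa> ?p w) \<in> \<Omega>"
      using that lm(3)[OF p(1)] unfolding \<psi>_def by blast
    ultimately show ?thesis by (auto simp: fibre_cone_def)
  qed
  \<comment> \<open>T identifies \<open>real^'m\<close> with V by means of the basis, and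
    \<open>co\<close> turns out to be its inverse.\<close>
  define T where "T \<eta> = (\<^bold>\<Sum>a. \<eta> $ a *\<^sub>R E a)" for \<eta> :: "real^'m"
  define co where "co v = (\<chi> a. representation (range E) v (E a))" for v
  have T_co: "T (co v) = v" for v
    unfolding T_def co_def using representation_family_expand[OF basis(1,2)] basis(3) by simp
  have co_T: "co (T \<eta>) = \<eta>" for \<eta>
    unfolding T_def co_def by (simp add: vec_eq_iff representation_family[OF basis(1,2)])
  have T_lin: "linear T"
    by (rule linearI) (simp_all add: T_def scaleR_add_left sum.distrib scaleR_sum_right)
  have co_lin: "linear co"
  proof (rule linearI)
    show "co (u + v) = co u + co v" for u v
      using co_T[of "co u + co v"] by (simp add: linear_add[OF T_lin] T_co)
    show "co (r *\<^sub>R v) = r *\<^sub>R co v" for r v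
      using co_T[of "r *\<^sub>R co v"] by (simp add: linear_scale[OF T_lin] T_co)
  qed
  have T_bl: "bounded_linear T" and co_bl: "bounded_linear co"
    using T_lin co_lin by (simp_all add: linear_conv_bounded_linear)
  \<comment> \<open>The matrix of \<phi> from coordinates to basis coefficients; its entries are the
    components of the dual basis, since y = y^a e_a is sent to the combination of the E a with the
    same coefficients.\<close>
  define \<epsilon> where "\<epsilon> z = matrix (\<lambda>w. co (\<psi> z w))" for z
  have \<epsilon>_mult: "\<epsilon> z *v w = co (\<psi> z w)" if "z \<in> W" for z w
    unfolding \<epsilon>_def
    using fun_cong[OF matrix_vector_mul(2)[OF linear_compose[OF \<psi>_lin[OF that] co_lin]], of w] by (simp add: o_def)
  have T_\<epsilon>: "T (\<epsilon> z *v w) = \<psi> z w" if "z \<in> W" for z w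
    by (simp add: \<epsilon>_mult that T_co)
  define \<omega>' where "\<omega>' = T -` \<omega>"
  let ?f = "in_basis E L"
  have f_def: "?f = (\<lambda>\<eta>. L (T \<eta>))" by (simp add: in_basis_def T_def fun_eq_iff)
  note mk = minkowski[unfolded pseudo_minkowski_def open_cone_def]
  have L2: "Ck_on 2 L \<omega>" using mk by (auto intro: Ck_on_le)
  interpret frame_model W \<omega>' \<epsilon> ?f "local_fun A \<L> \<kappa>"
  proof
    show "open W" by (rule oW)
    show "open_cone \<omega>'"
      using mk T_bl unfolding open_cone_def \<omega>'_def
      by (auto simp: continuous_open_vimage linear_continuous_at linear_scale[OF T_lin])
    show "Ck_on 4 ?f \<omega>'"
      unfolding f_def \<omega>'_def by (rule Ck_on_comp_linear) (use mk T_bl in auto)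
    show "?f (s *\<^sub>R \<eta>) = s\<^sup>2 * ?f \<eta>" if "\<eta> \<in> \<omega>'" "s > 0" for \<eta> s
      using mk that closure_subset[of \<omega>] by (auto simp: f_def \<omega>'_def linear_scale[OF T_lin])
    show "invertible (metric_mat ?f \<eta>)" if "\<eta> \<in> \<omega>'" for \<eta>
    proof -
      \<comment> \<open>A kernel vector u of the matrix would give a degenerate direction T u of the
        Hessian, because every vector v of V has the form T (co v).\<close>
      have "u = 0" if u: "metric_mat ?f \<eta> *v u = 0" for u
      proof (rule ccontr)
        assume "u \<noteq> 0"
        then have "T u \<noteq> 0" using co_T[of u] linear_0[OF co_lin] by auto
        moreover have "T \<eta> \<in> \<omega>" using \<open>\<eta> \<in> \<omega>'\<close> by (simp add: \<omega>'_def)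
        ultimately obtain v where "hess L (T \<eta>) (T u) v \<noteq> 0" using mk by meson
        then have "hess L (T \<eta>) (T u) (T (co v)) \<noteq> 0" by (simp add: T_co)
        moreover have "hess L (T \<eta>) (T u) (T (co v)) = 0"
          using hess_in_basis[OF _ L2 T_bl, of \<eta> u "co v"] mk u \<open>\<eta> \<in> \<omega>'\<close> by (simp add: f_def \<omega>'_def)
        ultimately show False by simp
      qed
      then show ?thesis by (simp add: invertible_left_inverse matrix_left_invertible_ker)
    qed
    \<comment> \<open>Column \<nu> of \<epsilon> consists of the coefficients of \<phi> applied to
      the coordinate vector \<partial>_\<nu>; its C^2 dependence on the point is part of
      \<open>local_model\<close>.\<close>
    show "Ck_on 2 (\<lambda>z. \<epsilon> z $ a $ \<nu>) W" for a \<nu>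
    proof -
      have "bounded_linear (\<lambda>v. co v $ a)"
        using bounded_linear_compose[OF bounded_linear_vec_nth co_bl] .
      from Ck_on_linear_comp[OF oW this, of 2 "\<lambda>z. \<psi> z (axis \<nu> 1)"] lm(5)[of "axis \<nu> 1"]
      show ?thesis by (simp add: \<epsilon>_def matrix_def \<psi>_def W_def)
    qed
    show "invertible (\<epsilon> z)" if "z \<in> W" for z
    proof -
      have "w = 0" if "\<epsilon> z *v w = 0" for w
      proof -
        have "\<psi> z w = \<psi> z 0"
          using T_\<epsilon>[OF \<open>z \<in> W\<close>, of w] that linear_0[OF T_lin] linear_0[OF \<psi>_lin[OF \<open>z \<in> W\<close>]] by simp
        then show ?thesis using \<psi>_inj[OF \<open>z \<in> W\<close>] by (simp add: inj_eq)
      qed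
      then show ?thesis by (simp add: invertible_left_inverse matrix_left_invertible_ker)
    qed
    show "local_fun A \<L> \<kappa> z w = ?f (\<epsilon> z *v w)" if z: "z \<in> W" and w: "\<epsilon> z *v w \<in> \<omega>'" for z w
    proof -
      have "w \<in> fibre_cone A \<Omega> \<kappa> (chart_inv \<kappa> z)"
        using w by (simp add: \<psi>_mem z \<omega>'_def T_\<epsilon>)
      then show ?thesis
        using lm(4)[OF pW[OF z]] closure_subset by (force simp: local_fun_def f_def T_\<epsilon> z \<psi>_def)
    qed
  qed
  \<comment> \<open>\<phi> sends e_a to E a, whose coefficient vector is the a-th unit vector; so
    the components of e_a form the a-th column of the inverse of \<epsilon>.\<close>
  have e: "vierbein A \<phi> E \<kappa> a z = column a (frm z)" if z: "z \<in> W" for a z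
  proof -
    let ?p = "chart_inv \<kappa> z"
    have p: "?p \<in> U" "?p \<in> fst \<kappa>" using pW[OF z] by auto
    define v where "v = inv_into (tangent_space A ?p) (\<phi> ?p) (E a)"
    have "E a \<in> \<phi> ?p ` tangent_space A ?p" using surj_\<phi>[OF p(1)] by simp
    then have v: "v \<in> tangent_space A ?p" "\<phi> ?p v = E a"
      unfolding v_def by (rule inv_into_into, rule f_inv_into_f)
    have "\<psi> z (v \<kappa>) = E a"
      unfolding \<psi>_def using tangent_space_eq_tvec[OF atlas coords p(2) v(1)] v(2) by simp
    also have "E a = T (axis a 1)" by (simp add: T_def axis_def if_distrib[of "\<lambda>r. r *\<^sub>R _"] cong: if_cong)
    finally have "\<epsilon> z *v v \<kappa> = axis a 1" by (simp add: \<epsilon>_mult z co_T)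
    then have "v \<kappa> = frm z *v axis a 1" using frm_cof_vec[OF z, of "v \<kappa>"] by simp
    then show ?thesis by (simp add: vierbein_def v_def matrix_vector_mult_basis)
  qed
  have x: "x \<in> W" using point by (simp add: W_def)
  have "\<epsilon> x *v y \<in> \<omega>'" using vector by (simp add: \<omega>'_def T_\<epsilon> x \<psi>_mem)
  then have y: "y \<in> dom_y x" by (simp add: dom_y_def)
  have Y: "frame_coord (\<lambda>i. vierbein A \<phi> E \<kappa> i x) y a = (\<epsilon> x *v y) $ a" for a
    by (rule frame_coord_frm[OF x e])
  have c: "comm_coeff (vierbein A \<phi> E \<kappa>) i j k x = strc i j k x" for i j k
    by (rule comm_coeff_frame[OF x e])
  have dc: "comm_coeff_deriv (vierbein A \<phi> E \<kappa>) i j k d x = dstr i j k d x" for i j k d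
    by (rule comm_coeff_deriv_frame[OF x e])
  show ?thesis
    unfolding Let_def c dc Y vec_lambda_eta
    using Ric_spray[OF x y] Ric_vierbein[OF x y] by (rule conjI)
qed

end
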